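(* Let $\alpha,\beta,\gamma,\rho,a\in\mathbb{C}$ with $\operatorname{Re}(\alpha)>0$ and $a\ne0$, put $N=[\operatorname{Re}(\alpha)]+1$, and let $\mu$ be a real number, such that $\mu>0$ and $\operatorname{Re}(\rho)+N>\max\{\operatorname{Re}(\beta)+N,\operatorname{Re}(-\alpha-\gamma)\}$. Then for every $x>0$, $$\left({}^{c}\mathcal{D}_{-}^{\alpha,\beta,\gamma}\left(t^{-\rho}I^{m,n}_{p,q}\left[at^{-\mu}\,\middle|\begin{matrix}(a_i,A_i,\alpha_i)_{1,p}\\(b_j,B_j,\beta_j)_{1,q}\end{matrix}\right]\right)\right)(x)=x^{\beta-\rho}\,I^{m,n+2}_{p+2,q+2}\left[ax^{-\mu}\,\middle|\begin{matrix}(1+\beta-\rho,\mu,1),\ (1-\alpha-\gamma-\rho-N,\mu,1),\ (a_i,A_i,\alpha_i)_{1,p}\\(b_j,B_j,\beta_j)_{1,q},\ (1-\rho,\mu,1),\ (1+\beta-\gamma-\rho-N,\mu,1)\end{matrix}\right].$$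
   Context: **$I$-function.** Let $m,n,p,q$ be integers with $0\le m\le q$, $0\le n\le p$; let $a_i\in\mathbb{C}$, $A_i,\alpha_i>0$ $(1\le i\le p)$ and $b_j\in\mathbb{C}$, $B_j,\beta_j>0$ $(1\le j\le q)$. For $z\neq0$ (with a chosen value of $\arg z$; $z^{-s}=e^{-s(\log|z|+i\arg z)}$), $$I^{m,n}_{p,q}\left[z\,\middle|\begin{matrix}(a_i,A_i,\alpha_i)_{1,p}\\(b_j,B_j,\beta_j)_{1,q}\end{matrix}\right]=\frac{1}{2\pi i}\int_{C}\chi(s)z^{-s}\,ds,\qquad \chi(s)=\frac{\prod_{j=1}^{m}\Gamma^{\beta_j}(b_j+B_js)\prod_{i=1}^{n}\Gamma^{\alpha_i}(1-a_i-A_is)}{\prod_{j=m+1}^{q}\Gamma^{\beta_j}(1-b_j-B_js)\prod_{i=n+1}^{p}\Gamma^{\alpha_i}(a_i+A_is)}.$$ Here $(a_i,A_i,\alpha_i)_{1,p}$ is the ordered list of triples for $i=1,\dots,p$ (the first $n$ upper triples and the first $m$ lower triples enter the numerator), $\Gamma^{\kappa}(w)=(\Gamma(w))^{\kappa}$, with the branch of non-integer powers fixed along $C$ and the same for the same triple in all $I$-functions considered; empty products equal $1$. The singularities of $\Gamma^{\beta_j}(b_j+B_js)$, $j\le m$, lie to the left of $C$ and those of $\Gamma^{\alpha_i}(1-a_i-A_is)$, $i\le n$, to the right. **Standing assumptions.** The contour $C$ is the imaginary axis $\operatorname{Re}(s)=0$, traversed upwards, and for each $I$-function occurring the following conditions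 for absolute convergence hold: with (computed from the parameters of that $I$-function) $\mu^*=\sum_{j=1}^q\beta_jB_j-\sum_{i=1}^p\alpha_iA_i$, $\Omega=\sum_{i=1}^p(\frac12-\operatorname{Re}(a_i))\alpha_i-\sum_{j=1}^q(\frac12-\operatorname{Re}(b_j))\beta_j$, $\Delta=\sum_{j=1}^m\beta_jB_j-\sum_{j=m+1}^q\beta_jB_j+\sum_{i=1}^n\alpha_iA_i-\sum_{i=n+1}^p\alpha_iA_i$, either $\Delta>0$ and $|\arg z|<\frac{\pi}{2}\Delta$, or $\Delta\ge0$, $|\arg z|=\frac{\pi}{2}\Delta$ and one of: $\mu^*=0$ and $\Omega<-1$; or $\mu^*\ne0$ and $\Omega+\sigma\mu^*<-1$ where $\sigma=\operatorname{Re}(s)$ on $C$ (so $\sigma=0$). For $t>0$, $\arg(at^{\pm\mu})=\arg a$. **Operators.** For $\operatorname{Re}(\alpha)>0$, $x>0$, the right-sided Saigo fractional integral is $$\left(\mathcal{I}_{-}^{\alpha,\beta,\gamma}f\right)(x)=\frac{1}{\Gamma(\alpha)}\int_x^{\infty}(t-x)^{\alpha-1}t^{-\alpha-\beta}{}_{2}F_1\left(\alpha+\beta,-\gamma;\alpha;1-\tfrac{x}{t}\right)f(t)\,dt,$$ and the right-sided generalized Caputo fractional derivative, applied to functions $f$ that are $N$ times differentiable on $(0,\infty)$, is $$\left({}^{c}\mathcal{D}_{-}^{\alpha,\beta,\gamma}f\right)(x)=(-1)^{N}\left(\mathcal{I}_{-}^{-\alpha+N,-\beta-N,\alpha+\gamma}f^{(N)}\right)(x),\qquad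 N=[\operatorname{Re}(\alpha)]+1,$$ with $[\cdot]$ the integer part and $f^{(N)}$ the $N$-th derivative. *)

theory Defs
  imports "HOL-Analysis.Analysis"
begin

section \<open>The \<open>I\<close>-function\<close>

type_synonym triple = "complex \<times> real \<times> real"

text \<open>
  A choice of branches is a function \<open>L\<close>, where \<open>L c d \<kappa>\<close> is the logarithm of \<open>\<Gamma>(c + d s)\<close> along the
  imaginary axis that is used to form the power \<open>\<Gamma>\<^sup>\<kappa>(c + d s)\<close>. It is continuous wherever the contour
  does not meet a pole (there is at most one such pole, and only a factor of the denominator of
  \<open>\<chi>\<close> can have one). Since \<open>L\<close> depends only on \<open>c\<close>, \<open>d\<close>, \<open>\<kappa>\<close>, equal triples get equal branches in
  every \<open>I\<close>-function formed with the same \<open>L\<close>. For integer \<open>\<kappa>\<close> the power does not depend on \<open>L\<close>.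
\<close>

definition Gamma_branch :: "(complex \<Rightarrow> real \<Rightarrow> real \<Rightarrow> complex \<Rightarrow> complex) \<Rightarrow> bool" where
  "Gamma_branch L \<longleftrightarrow>
     (\<forall>c d \<kappa>. let S = {s. Re s = 0 \<and> c + of_real d * s \<notin> \<int>\<^sub>\<le>\<^sub>0} in
        continuous_on S (L c d \<kappa>) \<and> (\<forall>s\<in>S. exp (L c d \<kappa> s) = Gamma (c + of_real d * s)))"

text \<open>
  As for \<^const>\<open>Gamma\<close>, the value at a pole is set to 0, so that in the denominator of \<open>\<chi>\<close>
  division by zero gives the correct value 0 of \<open>1 / \<Gamma>\<^sup>\<kappa>\<close> there.
\<close>

definition Gamma_pow ::
    "(complex \<Rightarrow> real \<Rightarrow> real \<Rightarrow> complex \<Rightarrow> complex) \<Rightarrow> complex \<Rightarrow> real \<Rightarrow> real \<Rightarrow> complex \<Rightarrow> complex" where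
  "Gamma_pow L c d \<kappa> s =
     (if c + of_real d * s \<in> \<int>\<^sub>\<le>\<^sub>0 then 0 else exp (of_real \<kappa> * L c d \<kappa> s))"

text \<open>
  In all that follows \<open>up\<close> is the list of upper triples \<open>(a\<^sub>i, A\<^sub>i, \<alpha>\<^sub>i)\<close> and \<open>lo\<close> the list of lower triples
  \<open>(b\<^sub>j, B\<^sub>j, \<beta>\<^sub>j)\<close>; thus \<open>p\<close> and \<open>q\<close> are the lengths of \<open>up\<close> and \<open>lo\<close>.
\<close>

definition I_chi ::
    "(complex \<Rightarrow> real \<Rightarrow> real \<Rightarrow> complex \<Rightarrow> complex) \<Rightarrow> nat \<Rightarrow> nat \<Rightarrow> triple list \<Rightarrow> triple list \<Rightarrow> complex \<Rightarrow> complex" where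
  "I_chi L m n up lo s =
     ((\<Prod>(b, B, \<beta>)\<leftarrow>take m lo. Gamma_pow L b B \<beta> s) *
      (\<Prod>(a, A, \<alpha>)\<leftarrow>take n up. Gamma_pow L (1 - a) (- A) \<alpha> s)) /
     ((\<Prod>(b, B, \<beta>)\<leftarrow>drop m lo. Gamma_pow L (1 - b) (- B) \<beta> s) *
      (\<Prod>(a, A, \<alpha>)\<leftarrow>drop n up. Gamma_pow L a A \<alpha> s))"

text \<open>
  \<open>\<theta>\<close> is the chosen value of \<open>arg z\<close>. The contour is the imaginary axis \<open>s = \<i>y\<close>, traversed upwards,
  so that \<open>ds = \<i> dy\<close>.
\<close>

definition I_fun ::
    "(complex \<Rightarrow> real \<Rightarrow> real \<Rightarrow> complex \<Rightarrow> complex) \<Rightarrow> nat \<Rightarrow> nat \<Rightarrow> triple list \<Rightarrow> triple list \<Rightarrow> real \<Rightarrow> complex \<Rightarrow> complex" where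
  "I_fun L m n up lo \<theta> z =
     1 / (2 * of_real pi * \<i>) *
     (LBINT y. I_chi L m n up lo (\<i> * of_real y) *
               exp (- (\<i> * of_real y) * (of_real (ln (cmod z)) + \<i> * of_real \<theta>)) * \<i>)"

definition I_params :: "nat \<Rightarrow> nat \<Rightarrow> triple list \<Rightarrow> triple list \<Rightarrow> bool" where
  "I_params m n up lo \<longleftrightarrow> m \<le> length lo \<and> n \<le> length up \<and>
     (\<forall>(a, A, \<alpha>)\<in>set up. A > 0 \<and> \<alpha> > 0) \<and> (\<forall>(b, B, \<beta>)\<in>set lo. B > 0 \<and> \<beta> > 0)"

definition I_separated :: "nat \<Rightarrow> nat \<Rightarrow> triple list \<Rightarrow> triple list \<Rightarrow> bool" where
  "I_separated m n up lo \<longleftrightarrow>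
     (\<forall>(b, B, \<beta>)\<in>set (take m lo). \<forall>s. b + of_real B * s \<in> \<int>\<^sub>\<le>\<^sub>0 \<longrightarrow> Re s < 0) \<and>
     (\<forall>(a, A, \<alpha>)\<in>set (take n up). \<forall>s. 1 - a - of_real A * s \<in> \<int>\<^sub>\<le>\<^sub>0 \<longrightarrow> Re s > 0)"

definition I_mu_star :: "triple list \<Rightarrow> triple list \<Rightarrow> real" where
  "I_mu_star up lo = (\<Sum>(b, B, \<beta>)\<leftarrow>lo. \<beta> * B) - (\<Sum>(a, A, \<alpha>)\<leftarrow>up. \<alpha> * A)"

definition I_Omega :: "triple list \<Rightarrow> triple list \<Rightarrow> real" where
  "I_Omega up lo =
     (\<Sum>(a, A, \<alpha>)\<leftarrow>up. (1/2 - Re a) * \<alpha>) - (\<Sum>(b, B, \<beta>)\<leftarrow>lo. (1/2 - Re b) * \<beta>)"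

definition I_Delta :: "nat \<Rightarrow> nat \<Rightarrow> triple list \<Rightarrow> triple list \<Rightarrow> real" where
  "I_Delta m n up lo =
     (\<Sum>(b, B, \<beta>)\<leftarrow>take m lo. \<beta> * B) - (\<Sum>(b, B, \<beta>)\<leftarrow>drop m lo. \<beta> * B) +
     (\<Sum>(a, A, \<alpha>)\<leftarrow>take n up. \<alpha> * A) - (\<Sum>(a, A, \<alpha>)\<leftarrow>drop n up. \<alpha> * A)"

text \<open>Here \<open>\<sigma>\<close> is the abscissa of the contour; it is 0 for \<^const>\<open>I_fun\<close>.\<close>

definition I_convergence :: "real \<Rightarrow> nat \<Rightarrow> nat \<Rightarrow> triple list \<Rightarrow> triple list \<Rightarrow> real \<Rightarrow> bool" where
  "I_convergence \<sigma> m n up lo \<theta> \<longleftrightarrow>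
     I_Delta m n up lo > 0 \<and> \<bar>\<theta>\<bar> < pi / 2 * I_Delta m n up lo \<or>
     I_Delta m n up lo \<ge> 0 \<and> \<bar>\<theta>\<bar> = pi / 2 * I_Delta m n up lo \<and>
       (I_mu_star up lo = 0 \<and> I_Omega up lo < -1 \<or>
        I_mu_star up lo \<noteq> 0 \<and> I_Omega up lo + \<sigma> * I_mu_star up lo < -1)"

section \<open>Fractional operators\<close>

definition hyp2F1 :: "complex \<Rightarrow> complex \<Rightarrow> complex \<Rightarrow> complex \<Rightarrow> complex" where
  "hyp2F1 a b c z =
     (\<Sum>k. pochhammer a k * pochhammer b k / (pochhammer c k * fact k) * z ^ k)"

definition saigo_integrand ::
    "complex \<Rightarrow> complex \<Rightarrow> complex \<Rightarrow> (real \<Rightarrow> complex) \<Rightarrow> real \<Rightarrow> real \<Rightarrow> complex" where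
  "saigo_integrand \<alpha> \<beta> \<gamma> f x t =
     of_real (t - x) powr (\<alpha> - 1) * of_real t powr (- \<alpha> - \<beta>) *
     hyp2F1 (\<alpha> + \<beta>) (- \<gamma>) \<alpha> (of_real (1 - x / t)) * f t"

text \<open>
  The integral is the Henstock-Kurzweil integral, which covers both absolutely convergent
  integrals and improper integrals that converge only conditionally.
\<close>

definition saigo_right ::
    "complex \<Rightarrow> complex \<Rightarrow> complex \<Rightarrow> (real \<Rightarrow> complex) \<Rightarrow> real \<Rightarrow> complex" where
  "saigo_right \<alpha> \<beta> \<gamma> f x = 1 / Gamma \<alpha> * integral {x<..} (saigo_integrand \<alpha> \<beta> \<gamma> f x)"

definition nth_deriv :: "nat \<Rightarrow> (real \<Rightarrow> complex) \<Rightarrow> real \<Rightarrow> complex" where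
  "nth_deriv N f = ((\<lambda>g t. vector_derivative g (at t)) ^^ N) f"

definition times_differentiable :: "nat \<Rightarrow> (real \<Rightarrow> complex) \<Rightarrow> bool" where
  "times_differentiable N f \<longleftrightarrow> (\<forall>k<N. \<forall>t>0. nth_deriv k f differentiable at t)"

definition caputo_order :: "complex \<Rightarrow> nat" where
  "caputo_order \<alpha> = nat \<lfloor>Re \<alpha>\<rfloor> + 1"

definition caputo_right ::
    "complex \<Rightarrow> complex \<Rightarrow> complex \<Rightarrow> (real \<Rightarrow> complex) \<Rightarrow> real \<Rightarrow> complex" where
  "caputo_right \<alpha> \<beta> \<gamma> f x =
     (let N = caputo_order \<alpha>
      in (-1) ^ N * saigo_right (- \<alpha> + of_nat N) (- \<beta> - of_nat N) (\<alpha> + \<gamma>) (nth_deriv N f) x)"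

text \<open>
  HOL functions are total, so whether \<open>f\<close> is in the domain of the operator and the defining
  integral converges at \<open>x\<close> is a separate predicate.
\<close>

definition caputo_right_exists ::
    "complex \<Rightarrow> complex \<Rightarrow> complex \<Rightarrow> (real \<Rightarrow> complex) \<Rightarrow> real \<Rightarrow> bool" where
  "caputo_right_exists \<alpha> \<beta> \<gamma> f x \<longleftrightarrow>
     (let N = caputo_order \<alpha>
      in times_differentiable N f \<and>
         saigo_integrand (- \<alpha> + of_nat N) (- \<beta> - of_nat N) (\<alpha> + \<gamma>) (nth_deriv N f) x
           integrable_on {x<..})"

end

theory Submission
  imports Defs "HOL-Complex_Analysis.Complex_Analysis" "HOL-Real_Asymp.Real_Asymp"
begin

text \<open>
  Along the imaginary axis \<open>s = \<i> y\<close> the \<open>I\<close>-function of \<open>a t\<^sup>-\<^sup>\<mu>\<close> is a superposition of powers, so that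
  \<open>f t = \<integral> h y t\<^sup>-\<^sup>w dy\<close> with \<open>w = \<rho> - \<i> \<mu> y\<close> and a density \<open>h\<close> made from \<open>\<chi>\<close>. On a single power everything is
  explicit. The \<open>N\<close>-th derivative of \<open>t\<^sup>-\<^sup>w\<close> is \<open>(-1)\<^sup>N (w)\<^sub>N t\<^sup>-\<^sup>w\<^sup>-\<^sup>N\<close>, and after the substitution \<open>v = 1 - x / t\<close>
  the Saigo integral of \<open>t\<^sup>-\<^sup>w\<^sup>-\<^sup>N\<close> becomes an Euler integral of a hypergeometric series, which termwise
  integration and Gauss's theorem evaluate as a quotient of Gamma functions. Together they multiply
  \<open>h\<close> by \<open>\<Gamma>(w - \<beta>) \<Gamma>(w + \<alpha> + \<gamma> + N) / (\<Gamma>(w) \<Gamma>(w - \<beta> + \<gamma> + N))\<close>, and these are exactly the four factors that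
  the new triples contribute to \<open>\<chi>\<close>.

  The work is in exchanging the operator with the integral over \<open>y\<close>. If \<open>|arg z| < \<pi> \<Delta> / 2\<close>, then \<open>h\<close> decays
  exponentially. If \<open>|arg z| = \<pi> \<Delta> / 2\<close>, only the bound \<open>O(|y|\<^sup>\<Omega>)\<close> remains, and the second convergence condition
  says \<open>\<Omega> + Re \<alpha> < -1\<close>. This allows \<open>N - 1\<close> differentiations under the integral sign, but in general not \<open>N\<close>
  of them: \<open>f\<^sup>(\<^sup>N\<^sup>)\<close> then exists by assumption, and may fail to be locally Lebesgue integrable. The remedy is
  to construct a primitive of the integrand. With \<open>g = f\<^sup>(\<^sup>N\<^sup>-\<^sup>1\<^sup>)\<close>, the kernel \<open>K\<close> of the Saigo operator, and the
  primitive of \<open>K (t\<^sup>-\<^sup>\<nu>)'\<close> for each power in \<open>g\<close>, the superposition \<open>P\<close> of these primitives satisfies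
  \<open>P' = K g'\<close>: the difference \<open>P - K g\<close> may be differentiated under the integral sign, because each of its
  terms has the derivative \<open>-K' t\<^sup>-\<^sup>\<nu>\<close>, without the factor \<open>\<nu>\<close>. The fundamental theorem for the
  Henstock-Kurzweil integral, which holds for every derivative, then gives the integral of \<open>K g'\<close> as
  \<open>P(\<infinity>) - P(x)\<close> (\<open>saigo_integral_of_derivative\<close>).

  The limits of \<open>P\<close> follow by dominated convergence from a bound \<open>O((1 + |y|)\<^sup>\<kappa>)\<close> for the primitives, uniform in
  \<open>t\<close>, where \<open>\<kappa>\<close> is any number with \<open>1 - Re (N - \<alpha>) < \<kappa> \<le> 1\<close> (\<open>hyp_kernel_partial_integral_bound\<close>). Since the
  kernel behaves like \<open>(t - x)\<^sup>N\<^sup>-\<^sup>\<alpha>\<^sup>-\<^sup>1\<close> near \<open>x\<close>, its integral against \<open>(t\<^sup>-\<^sup>\<nu>)'\<close> costs only that fraction of a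
  derivative, and \<open>\<Omega> + Re \<alpha> < -1\<close> leaves room for it.

  The decay of \<open>h\<close> needs the exact power of \<open>|y|\<close> in the growth of \<open>\<Gamma>\<close> on vertical lines, from above and
  from below. It is obtained from the reflection formula at \<open>Re s = 1/2\<close> and from the fact that
  \<open>ln \<Gamma>(\<sigma>) - ln |\<Gamma>(\<sigma> + \<i> y)|\<close> is a convex function of \<open>\<sigma>\<close>.
\<close>

section \<open>Growth of the Gamma function on vertical lines\<close>

text \<open>The reflection formula, since \<open>1 - s\<close> is the conjugate of \<open>s\<close> on this line.\<close>
lemma norm_Gamma_half_line: "(cmod (Gamma (Complex (1/2) y)))\<^sup>2 = pi / cosh (pi * y)"
proof -
  have 1: "1 - Complex (1/2) y = cnj (Complex (1/2) y)"
    by (simp add: complex_eq_iff)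
  have "of_real ((cmod (Gamma (Complex (1/2) y)))\<^sup>2) = Gamma (Complex (1/2) y) * Gamma (1 - Complex (1/2) y)"
    unfolding complex_norm_square 1 by (simp add: cnj_Gamma)
  also have "\<dots> = of_real pi / sin (of_real pi * Complex (1/2) y)"
    by (rule Gamma_reflection_complex)
  also have "of_real pi * Complex (1/2) y = of_real (pi / 2) + \<i> * of_real (pi * y)"
    by (simp add: complex_eq_iff)
  also have "sin (of_real (pi / 2) + \<i> * of_real (pi * y)) = of_real (cosh (pi * y))"
    unfolding sin_add sin_of_real cos_of_real
    by (simp add: cosh_conv_cos[symmetric] cosh_field_def exp_of_real exp_minus  del: of_real_mult)
  finally show ?thesis unfolding of_real_divide[symmetric] of_real_eq_iff .
qed

text \<open>
  One factor of the product formula for \<open>\<Gamma>(u) / |\<Gamma>(u + \<i> y)|\<close>, in logarithmic form: its derivative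
  \<open>-y\<^sup>2 / ((u + a) ((u + a)\<^sup>2 + y\<^sup>2))\<close> increases with \<open>u\<close>.
\<close>
lemma convex_log_ratio:
  fixes a y :: real assumes a: "a \<ge> 0"
  shows "convex_on {0<..} (\<lambda>u::real. ln ((u+a)\<^sup>2 + y\<^sup>2) / 2 - ln (u+a))"
proof (rule convex_on_realI[where f' = "\<lambda>u. - (y\<^sup>2 / ((u+a) * ((u+a)\<^sup>2 + y\<^sup>2)))"])
  fix u :: real assume "u \<in> {0<..}"
  then have u: "u + a > 0" using a by auto
  then have p: "(u+a)\<^sup>2 + y\<^sup>2 > 0" by (simp add: sum_power2_gt_zero_iff)
  have d: "((\<lambda>u. (u+a)\<^sup>2 + y\<^sup>2) has_real_derivative 2 * (u+a)) (at u)"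
    "((\<lambda>u. u + a) has_real_derivative 1) (at u)"
    by (auto intro!: derivative_eq_intros)
  have "((\<lambda>u. ln ((u+a)\<^sup>2 + y\<^sup>2) / 2 - ln (u+a)) has_real_derivative
      (1 / ((u+a)\<^sup>2 + y\<^sup>2) * (2 * (u+a))) / 2 - 1 / (u+a) * 1) (at u)"
    by (intro DERIV_diff DERIV_cdivide DERIV_chain2[OF DERIV_ln_divide] d u p)
  also have "(1 / ((u+a)\<^sup>2 + y\<^sup>2) * (2 * (u+a))) / 2 - 1 / (u+a) * 1 = - (y\<^sup>2 / ((u+a) * ((u+a)\<^sup>2 + y\<^sup>2)))"
  proof -
    have *: "(1 / Q * (2 * w)) / 2 - 1 / w * 1 = - ((Q - w * w) / (w * Q))" if "w > 0" "Q > 0" for w Q :: real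
      using that by (simp add: field_simps)
    show ?thesis using *[OF u p] by (simp add: power2_eq_square)
  qed
  finally show "((\<lambda>u. ln ((u+a)\<^sup>2 + y\<^sup>2) / 2 - ln (u+a)) has_real_derivative
      - (y\<^sup>2 / ((u+a) * ((u+a)\<^sup>2 + y\<^sup>2)))) (at u)" .
next
  fix u v :: real assume uv: "u \<in> {0<..}" "v \<in> {0<..}" "u \<le> v"
  then have "0 < u + a" using a by auto
  moreover have "(u+a)\<^sup>2 + y\<^sup>2 > 0" using calculation by (simp add: sum_power2_gt_zero_iff)
  moreover have "(u+a)\<^sup>2 \<le> (v+a)\<^sup>2" using uv calculation by (intro power_mono) auto
  moreover have "(v+a)\<^sup>2 + y\<^sup>2 > 0" using calculation by linarith
  ultimately show "- (y\<^sup>2 / ((u+a) * ((u+a)\<^sup>2 + y\<^sup>2))) \<le> - (y\<^sup>2 / ((v+a) * ((v+a)\<^sup>2 + y\<^sup>2)))"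
    using uv by (intro le_imp_neg_le divide_left_mono mult_mono mult_pos_pos) auto
qed auto

lemma Complex_not_nonpos_Int: "y \<noteq> 0 \<Longrightarrow> Complex s y \<notin> \<int>\<^sub>\<le>\<^sub>0"
  by (auto elim!: nonpos_Ints_cases simp: complex_eq_iff)

lemma Re_pos_not_nonpos_Int: "Re z > 0 \<Longrightarrow> z \<notin> \<int>\<^sub>\<le>\<^sub>0"
  by (auto elim!: nonpos_Ints_cases simp: complex_eq_iff)

lemma Complex_not_nonpos_Int': "s > 0 \<Longrightarrow> Complex s y \<notin> \<int>\<^sub>\<le>\<^sub>0"
  by (rule Re_pos_not_nonpos_Int) simp

lemma ln_norm_rGamma_series:
  assumes s: "s > 0"
  shows "ln (cmod (rGamma_series (Complex s y) n)) - ln (rGamma_series s n) =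
     (\<Sum>k\<le>n. ln ((s + real k)\<^sup>2 + y\<^sup>2) / 2 - ln (s + real k))"
proof -
  have nz: "pochhammer s (Suc n) > 0" using s by (intro pochhammer_pos)
  have nz2: "cmod (pochhammer (Complex s y) (Suc n)) > 0"
    using Complex_not_nonpos_Int'[OF s, of y] by (auto simp: pochhammer_eq_0_iff)
  have e: "cmod (exp (Complex s y * of_real (ln (of_nat n)))) = exp (s * ln (of_nat n))"
    by simp
  have "ln (cmod (rGamma_series (Complex s y) n)) - ln (rGamma_series s n) =
     ln (cmod (pochhammer (Complex s y) (Suc n))) - ln (pochhammer s (Suc n))"
    using nz nz2 unfolding rGamma_series_def
    by (simp add: norm_divide norm_mult ln_div ln_mult e)
  also have "cmod (pochhammer (Complex s y) (Suc n)) = (\<Prod>k\<le>n. cmod (Complex s y + of_nat k))"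
    by (simp add: pochhammer_prod prod_norm atLeast0AtMost lessThan_Suc_atMost atLeast0LessThan)
  also have "ln \<dots> = (\<Sum>k\<le>n. ln (cmod (Complex s y + of_nat k)))"
    using Complex_not_nonpos_Int'[OF s, of y]
    by (intro ln_prod) (use s in \<open>auto simp: add_eq_0_iff2 complex_eq_iff\<close>)
  also have "\<dots> = (\<Sum>k\<le>n. ln ((s + real k)\<^sup>2 + y\<^sup>2) / 2)"
    using s by (intro sum.cong) (auto simp: cmod_def ln_sqrt add_pos_nonneg)
  also have "pochhammer s (Suc n) = (\<Prod>k\<le>n. s + of_nat k)"
    by (simp add: pochhammer_prod  atLeast0AtMost lessThan_Suc_atMost atLeast0LessThan)
  also have "ln \<dots> = (\<Sum>k\<le>n. ln (s + real k))"
    using s by (intro ln_prod) auto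
  finally show ?thesis by (simp add: sum_subtractf)
qed

text \<open>
  A limit of sums of the convex functions above. Convexity is what transfers the exact value at
  \<open>\<sigma> = 1/2\<close> to all other lines without any loss in the power of \<open>|y|\<close>.
\<close>
lemma convex_ln_Gamma_quotient:
  "convex_on {0<..} (\<lambda>s. ln (Gamma s) - ln (cmod (Gamma (Complex s y))))"
proof -
  define L where "L = (\<lambda>n s. \<Sum>k\<le>n. ln ((s + real k)\<^sup>2 + y\<^sup>2) / 2 - ln (s + real k))"
  define D where "D = (\<lambda>s. ln (Gamma s) - ln (cmod (Gamma (Complex s y))))"
  have cL: "convex_on {0<..} (L n)" for n
    unfolding L_def by (induction n) (auto intro!: convex_on_add convex_log_ratio simp: convex_log_ratio[where a=0,simplified])
  have lim: "(\<lambda>n. L n s) \<longlonglongrightarrow> D s" if s: "s > 0" for s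
  proof -
    have 1: "rGamma s \<noteq> 0" "rGamma (Complex s y) \<noteq> 0"
      using s Complex_not_nonpos_Int'[OF s, of y] by (auto simp: rGamma_eq_zero_iff)
    have "(\<lambda>n. ln (cmod (rGamma_series (Complex s y) n)) - ln (rGamma_series s n)) \<longlonglongrightarrow>
        ln (cmod (rGamma (Complex s y))) - ln (rGamma s)"
      using 1 by (intro tendsto_intros) auto
    also have "ln (cmod (rGamma (Complex s y))) - ln (rGamma s) = D s"
      using 1 s Gamma_real_pos[OF s] unfolding D_def Gamma_def by (simp add: norm_inverse ln_inverse)
    finally show ?thesis using s by (simp add: ln_norm_rGamma_series L_def)
  qed
  have "D (u * a + v * b) \<le> u * D a + v * D b"
    if "a > 0" "b > 0" "u \<ge> 0" "v \<ge> 0" "u + v = 1" for a b u v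
  proof (rule LIMSEQ_le)
    have "u * a + v * b > 0" using that
      by (metis add_pos_nonneg add_nonneg_pos add_cancel_left_left le_less mult_nonneg_nonneg mult_pos_pos zero_less_one less_eq_real_def)
    then show "(\<lambda>n. L n (u * a + v * b)) \<longlonglongrightarrow> D (u * a + v * b)" by (rule lim)
    show "(\<lambda>n. u * L n a + v * L n b) \<longlonglongrightarrow> u * D a + v * D b"
      using that by (intro tendsto_intros lim)
    show "\<exists>N. \<forall>n\<ge>N. L n (u * a + v * b) \<le> u * L n a + v * L n b"
      using cL that by (auto simp: convex_on_def)
  qed
  then show ?thesis unfolding D_def[symmetric] convex_on_def by auto
qed

text \<open>
  The two-sided form \<open>|\<Gamma>(s + \<i> y)| \<asymp> |y|\<^sup>s\<^sup>-\<^sup>1\<^sup>/\<^sup>2 exp(-\<pi> |y| / 2)\<close> of Stirling's estimate. With logarithms, bounded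
  factors become bounded summands.
\<close>
definition vertical_growth :: "real \<Rightarrow> bool" where
  "vertical_growth s \<longleftrightarrow> (\<exists>C. \<forall>y. \<bar>y\<bar> \<ge> 1 \<longrightarrow>
     \<bar>ln (cmod (Gamma (Complex s y))) - ((s - 1/2) * ln \<bar>y\<bar> - pi / 2 * \<bar>y\<bar>)\<bar> \<le> C)"

lemma ln_norm_Complex_bounds:
  assumes "\<bar>y\<bar> \<ge> 1"
  shows "ln \<bar>y\<bar> \<le> ln (cmod (Complex s y))" "ln (cmod (Complex s y)) \<le> ln \<bar>y\<bar> + ln (1 + \<bar>s\<bar>)"
proof -
  have "\<bar>y\<bar> \<le> cmod (Complex s y)" using abs_Im_le_cmod[of "Complex s y"] by simp
  then show "ln \<bar>y\<bar> \<le> ln (cmod (Complex s y))" using assms by (subst ln_le_cancel_iff) (auto simp: complex_eq_iff)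
  have "cmod (Complex s y) \<le> \<bar>s\<bar> + \<bar>y\<bar>" using cmod_le[of "Complex s y"] by simp
  also have "\<dots> \<le> (1 + \<bar>s\<bar>) * \<bar>y\<bar>" using assms mult_left_mono[OF assms, of "\<bar>s\<bar>"] by (simp add: algebra_simps)
  finally have "ln (cmod (Complex s y)) \<le> ln ((1 + \<bar>s\<bar>) * \<bar>y\<bar>)"
    using assms by (subst ln_le_cancel_iff) (auto simp: complex_eq_iff)
  also have "\<dots> = ln \<bar>y\<bar> + ln (1 + \<bar>s\<bar>)" using assms by (subst ln_mult) auto
  finally show "ln (cmod (Complex s y)) \<le> ln \<bar>y\<bar> + ln (1 + \<bar>s\<bar>)" .
qed

lemma ln_norm_Gamma_plus1:
  assumes "y \<noteq> 0"
  shows "ln (cmod (Gamma (Complex (s+1) y))) = ln (cmod (Complex s y)) + ln (cmod (Gamma (Complex s y)))"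
proof -
  have n: "Complex s y \<notin> \<int>\<^sub>\<le>\<^sub>0" using assms by (rule Complex_not_nonpos_Int)
  have "Complex (s+1) y = Complex s y + 1" by (simp add: complex_eq_iff)
  with n have "Gamma (Complex (s+1) y) = Complex s y * Gamma (Complex s y)"
    by (simp only: Gamma_plus1 not_False_eq_True)
  then have "cmod (Gamma (Complex (s+1) y)) = cmod (Complex s y) * cmod (Gamma (Complex s y))"
    by (simp only: norm_mult)
  moreover have "cmod (Complex s y) > 0" "cmod (Gamma (Complex s y)) > 0"
    using n assms by (simp_all add: Gamma_eq_zero_iff, simp add: complex_eq_iff)
  ultimately show ?thesis by (simp only: ln_mult_pos)
qed

text \<open>The functional equation multiplies \<open>\<Gamma>\<close> by \<open>s + \<i> y\<close>, whose modulus is comparable to \<open>|y|\<close>.\<close>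
lemma vertical_growth_plus1: "vertical_growth s \<longleftrightarrow> vertical_growth (s + 1)"
proof -
  have *: "\<bar>(ln (cmod (Gamma (Complex (s+1) y))) - ((s + 1 - 1/2) * ln \<bar>y\<bar> - pi / 2 * \<bar>y\<bar>)) -
     (ln (cmod (Gamma (Complex s y))) - ((s - 1/2) * ln \<bar>y\<bar> - pi / 2 * \<bar>y\<bar>))\<bar> \<le> ln (1 + \<bar>s\<bar>)"
    if "\<bar>y\<bar> \<ge> 1" for y
    using ln_norm_Complex_bounds[OF that, of s] ln_norm_Gamma_plus1[of y s] that
    by (simp add: algebra_simps)
  show ?thesis
  proof
    assume "vertical_growth s"
    then obtain C where "\<And>y. \<bar>y\<bar> \<ge> 1 \<Longrightarrow> \<bar>ln (cmod (Gamma (Complex s y))) - ((s - 1/2) * ln \<bar>y\<bar> - pi / 2 * \<bar>y\<bar>)\<bar> \<le> C"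
      unfolding vertical_growth_def by blast
    then show "vertical_growth (s+1)" unfolding vertical_growth_def
      by (intro exI[of _ "C + ln (1 + \<bar>s\<bar>)"]) (use * in \<open>smt (verit)\<close>)
  next
    assume "vertical_growth (s+1)"
    then obtain C where "\<And>y. \<bar>y\<bar> \<ge> 1 \<Longrightarrow> \<bar>ln (cmod (Gamma (Complex (s+1) y))) - ((s + 1 - 1/2) * ln \<bar>y\<bar> - pi / 2 * \<bar>y\<bar>)\<bar> \<le> C"
      unfolding vertical_growth_def by blast
    then show "vertical_growth s" unfolding vertical_growth_def
      by (intro exI[of _ "C + ln (1 + \<bar>s\<bar>)"]) (use * in \<open>smt (verit)\<close>)
  qed
qed

lemma ln_norm_Gamma_half_line_bounds:
  "- pi / 2 * \<bar>y\<bar> + ln pi / 2 \<le> ln (cmod (Gamma (Complex (1/2) y)))"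
  "ln (cmod (Gamma (Complex (1/2) y))) \<le> - pi / 2 * \<bar>y\<bar> + ln pi / 2 + ln 2 / 2"
proof -
  have nz: "cmod (Gamma (Complex (1/2) y)) > 0"
    using Complex_not_nonpos_Int'[of "1/2" y] by (auto simp: Gamma_eq_zero_iff)
  have "ln ((cmod (Gamma (Complex (1/2) y)))\<^sup>2) = ln pi - ln (cosh (pi * y))"
    unfolding norm_Gamma_half_line by (subst ln_div) auto
  then have 1: "ln (cmod (Gamma (Complex (1/2) y))) = (ln pi - ln (cosh (pi * y))) / 2"
    using nz by (simp add: ln_realpow)
  have "cosh (pi * y) = cosh \<bar>pi * y\<bar>" by simp
  then have c: "cosh (pi * y) = (exp (pi * \<bar>y\<bar>) + exp (-(pi * \<bar>y\<bar>))) / 2"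
    by (simp add: cosh_def abs_mult)
  have "cosh (pi * y) \<le> exp (pi * \<bar>y\<bar>)" unfolding c by simp
  then have "ln (cosh (pi * y)) \<le> ln (exp (pi * \<bar>y\<bar>))"  by (subst ln_le_cancel_iff) auto
  then show "- pi / 2 * \<bar>y\<bar> + ln pi / 2 \<le> ln (cmod (Gamma (Complex (1/2) y)))"
    unfolding 1 by (simp add: field_simps)
  have "exp (pi * \<bar>y\<bar>) / 2 \<le> cosh (pi * y)" unfolding c by simp
  then have "ln (exp (pi * \<bar>y\<bar>) / 2) \<le> ln (cosh (pi * y))" by (subst ln_le_cancel_iff) auto
  then show "ln (cmod (Gamma (Complex (1/2) y))) \<le> - pi / 2 * \<bar>y\<bar> + ln pi / 2 + ln 2 / 2"
    unfolding 1 by (simp add: field_simps ln_div)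
qed

text \<open>
  With \<open>D(\<sigma>) = ln \<Gamma>(\<sigma>) - ln |\<Gamma>(\<sigma> + \<i> y)|\<close>, the functional equation gives \<open>D(\<sigma> + 1) = D(\<sigma>) - ln |y| + O(1)\<close>. Convexity on
  \<open>1/2 \<le> s \<le> 3/2\<close> bounds \<open>D(s)\<close> from above by the chord, and convexity on \<open>s \<le> 3/2 \<le> s + 1\<close> bounds it from below;
  both bounds equal \<open>D(1/2) - t ln |y|\<close> up to bounded terms.
\<close>
lemma vertical_growth_base:
  assumes "0 \<le> t" "t < 1" shows "vertical_growth (1/2 + t)"
proof -
  define s where "s = 1/2 + t"
  define C where "C = \<bar>ln (Gamma s)\<bar> + \<bar>ln (Gamma (1/2::real))\<bar> + \<bar>ln (Gamma (3/2::real))\<bar> + \<bar>ln (Gamma (s+1))\<bar>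
    + \<bar>ln pi\<bar> + \<bar>ln 2\<bar> + ln (1 + 1/2) + ln (1 + s)"
  have "\<bar>ln (cmod (Gamma (Complex s y))) - ((s - 1/2) * ln \<bar>y\<bar> - pi / 2 * \<bar>y\<bar>)\<bar> \<le> C"
    if y: "\<bar>y\<bar> \<ge> 1" for y
  proof -
    define D where "D = (\<lambda>s. ln (Gamma s) - ln (cmod (Gamma (Complex s y))))"
    define l where "l = ln \<bar>y\<bar>"
    have l0: "l \<ge> 0" using y by (simp add: l_def)
    have cD: "convex_on {0<..} D" unfolding D_def by (rule convex_ln_Gamma_quotient)
    have sh: "ln (cmod (Gamma (Complex (3/2) y))) = ln (cmod (Complex (1/2) y)) + ln (cmod (Gamma (Complex (1/2) y)))"
      "ln (cmod (Gamma (Complex (s+1) y))) = ln (cmod (Complex s y)) + ln (cmod (Gamma (Complex s y)))"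
      using ln_norm_Gamma_plus1[of y "1/2"] ln_norm_Gamma_plus1[of y s] y by auto
    have b1: "D s \<le> (1 - t) * D (1/2) + t * D (3/2)"
    proof -
      have "D ((1-t) *\<^sub>R (1/2) + t *\<^sub>R (3/2)) \<le> (1 - t) * D (1/2) + t * D (3/2)"
        using cD assms by (intro convex_onD) auto
      also have "(1-t) *\<^sub>R (1/2) + t *\<^sub>R (3/2) = s" unfolding s_def real_scaleR_def by argo
      finally show ?thesis .
    qed
    have b2: "D (3/2) \<le> t * D s + (1 - t) * D (s+1)"
    proof -
      have "D (t *\<^sub>R s + (1-t) *\<^sub>R (s+1)) \<le> t * D s + (1 - t) * D (s+1)"
        using cD assms unfolding convex_on_def s_def by auto
      also have "t *\<^sub>R s + (1-t) *\<^sub>R (s+1) = s + 1 - t" by (simp add: algebra_simps)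
      also have "\<dots> = 3/2" by (simp add: s_def)
      finally show ?thesis .
    qed
    define A where "A = ln (cmod (Complex (1/2) y))"
    define B where "B = ln (cmod (Complex s y))"
    define G where "G = ln (cmod (Gamma (Complex s y)))"
    define G0 where "G0 = ln (cmod (Gamma (Complex (1/2) y)))"
    have A: "l \<le> A" "A \<le> l + ln (1+1/2)" and B: "l \<le> B" "B \<le> l + ln (1 + s)"
      using ln_norm_Complex_bounds[OF y, of "1/2"] ln_norm_Complex_bounds[OF y, of s] assms
      by (simp_all add: A_def B_def l_def s_def)
    define g1 where "g1 = ln (Gamma (1/2::real))"
    define g2 where "g2 = ln (Gamma (3/2::real))"
    define g3 where "g3 = ln (Gamma (s::real))"
    define g4 where "g4 = ln (Gamma (s+1::real))"
    have b1': "g3 - G \<le> (1 - t) * (g1 - G0) + t * (g2 - (A + G0))"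
      using b1 unfolding D_def sh(1) g1_def g2_def g3_def g4_def A_def B_def G_def G0_def .
    have b2': "g2 - (A + G0) \<le> t * (g3 - G) + (1 - t) * (g4 - (B + G))"
      using b2 unfolding D_def sh g1_def g2_def g3_def g4_def A_def B_def G_def G0_def .
    have ab: "\<bar>t * x\<bar> \<le> \<bar>x\<bar>" "\<bar>(1 - t) * x\<bar> \<le> \<bar>x\<bar>" for x
      using assms by (auto simp: abs_mult mult_left_le_one_le)
    have tm: "t * l \<le> t * A" "t * A \<le> t * l + ln (1+1/2)"
      "(1-t) * l \<le> (1-t) * B" "(1-t) * B \<le> (1-t) * l + ln (1 + s)"
    proof -
      have "t * (A - l) \<le> 1 * (A - l)" "(1-t) * (B - l) \<le> 1 * (B-l)"
        using A B assms by (intro mult_right_mono; simp)+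
      then show "t * A \<le> t * l + ln (1+1/2)" "(1-t) * B \<le> (1-t) * l + ln (1 + s)"
        using A(2) B(2) by (simp_all add: algebra_simps)
      show "t * l \<le> t * A"  "(1-t) * l \<le> (1-t) * B"
        using A B assms by (intro mult_left_mono; simp)+
    qed
    have lower: "G \<ge> G0 + t * A - (1-t) * g1 - t * g2 + g3"
      using b1' by (simp add: algebra_simps)
    have upper: "G \<le> A + G0 - (1-t) * B + t * g3 + (1-t) * g4 - g2"
      using b2' by (simp add: algebra_simps)
    have lt: "(1 - t) * l = l - t * l" by (simp add: algebra_simps)
    define c1 c2 c3 c4 where "c1 = \<bar>g1\<bar>" and "c2 = \<bar>g2\<bar>" and "c3 = \<bar>g3\<bar>" and "c4 = \<bar>g4\<bar>"
    have "(1-t) * g1 \<le> c1" "t * g2 \<le> c2" "t * g3 \<le> c3" "(1-t) * g4 \<le> c4"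
      unfolding c1_def c2_def c3_def c4_def by (rule order_trans[OF abs_ge_self ab(1)] order_trans[OF abs_ge_self ab(2)])+
    moreover have "- c3 \<le> g3" "- g2 \<le> c2" unfolding c2_def c3_def by simp_all
    ultimately have tg: "(1-t) * g1 \<le> c1" "t * g2 \<le> c2" "t * g3 \<le> c3" "(1-t) * g4 \<le> c4" "- c3 \<le> g3" "- g2 \<le> c2"
      by blast+
    have c0: "c1 \<ge> 0" "c2 \<ge> 0" "c3 \<ge> 0" "c4 \<ge> 0" by (simp_all add: c1_def c2_def c3_def c4_def)
    have lo: "G \<ge> G0 + t * l - (c1 + c2 + c3)"
      using lower tm(1) tg by linarith
    have up: "G \<le> G0 + t * l + (c3 + c4 + c2 + ln (1+1/2))"
      using upper tm(3) A(2) tg lt by linarith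
    have G0: "- pi / 2 * \<bar>y\<bar> + ln pi / 2 \<le> G0" "G0 \<le> - pi / 2 * \<bar>y\<bar> + ln pi / 2 + ln 2 / 2"
      using ln_norm_Gamma_half_line_bounds[of y] unfolding G0_def .
    define p q v where "p = \<bar>ln pi\<bar>" and "q = \<bar>ln (2::real)\<bar>" and "v = pi / 2 * \<bar>y\<bar>"
    have pq: "ln pi \<le> p" "- p \<le> ln pi" "ln (2::real) \<le> q" "0 \<le> p" "0 \<le> q" by (auto simp: p_def q_def)
    have G0': "- v + ln pi / 2 \<le> G0" "G0 \<le> - v + ln pi / 2 + ln 2 / 2"
      using G0 by (simp_all add: v_def)
    have l1: "ln (1+1/2) \<ge> (0::real)" "ln (1+s) \<ge> 0" using assms by (auto simp: s_def)
    have C: "C = c3 + c1 + c2 + c4 + p + q + ln (1+1/2) + ln (1+s)"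
      by (simp only: C_def c1_def c2_def c3_def c4_def p_def q_def g1_def g2_def g3_def g4_def)
    have "(s - 1/2) * ln \<bar>y\<bar> = t * l" by (simp add: s_def l_def)
    moreover have "G - (t * l - v) \<le> C" using up G0' pq l1 c0 unfolding C by linarith
    moreover have "- C \<le> G - (t * l - v)" using lo G0' pq l1 c0 unfolding C by linarith
    ultimately show ?thesis unfolding G_def[symmetric] by (simp add: v_def abs_le_iff)
  qed
  then show ?thesis unfolding vertical_growth_def s_def[symmetric] by blast
qed

lemma vertical_growth_all: "vertical_growth s"
proof -
  have up: "vertical_growth (s + of_nat n) \<longleftrightarrow> vertical_growth s" for s n
  proof (induction n)
    case (Suc n)
    have "s + of_nat (Suc n) = (s + of_nat n) + 1" by simp
    then show ?case using Suc vertical_growth_plus1 by metis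
  qed simp
  define t where "t = frac (s - 1/2)"
  have t: "0 \<le> t" "t < 1" by (auto simp: t_def frac_lt_1)
  define k where "k = \<lfloor>s - 1/2\<rfloor>"
  have s: "s = 1/2 + t + of_int k" by (simp add: t_def k_def frac_def)
  show ?thesis
  proof (cases "k \<ge> 0")
    case True
    then have "s = (1/2 + t) + of_nat (nat k)" by (simp add: s)
    then show ?thesis using up vertical_growth_base[OF t] by metis
  next
    case False
    then have "1/2 + t = s + of_nat (nat (-k))" by (simp add: s)
    then show ?thesis using up vertical_growth_base[OF t] by metis
  qed
qed

lemma abs_diff_perturb:
  fixes g a b :: real
  assumes "\<bar>g - (a - b)\<bar> \<le> c" "\<bar>a - a'\<bar> \<le> c1" "\<bar>b - b'\<bar> \<le> c2"
  shows "\<bar>g - (a' - b')\<bar> \<le> c + c1 + c2"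
  using assms by linarith

lemma abs_diff_le_of_bounds:
  fixes x y :: real
  assumes "p + y \<le> x" "x \<le> q + y" shows "\<bar>x - y\<bar> \<le> \<bar>p\<bar> + \<bar>q\<bar>"
  using assms by linarith

text \<open>
  On the line \<open>c + \<i> d y\<close> the imaginary part is \<open>d y + Im c\<close>; passing from it to \<open>d y\<close> changes the logarithm and
  the linear term by bounded amounts only.
\<close>
lemma ln_norm_Gamma_line:
  assumes d: "d \<noteq> 0"
  shows "\<exists>C R. \<forall>y. \<bar>y\<bar> \<ge> R \<longrightarrow> c + of_real d * (\<i> * of_real y) \<notin> \<int>\<^sub>\<le>\<^sub>0 \<and>
     \<bar>ln (cmod (Gamma (c + of_real d * (\<i> * of_real y)))) - ((Re c - 1/2) * ln (1 + \<bar>y\<bar>) - pi / 2 * \<bar>d\<bar> * \<bar>y\<bar>)\<bar> \<le> C"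
proof -
  obtain C0 where C0: "\<And>y. \<bar>y\<bar> \<ge> 1 \<Longrightarrow>
      \<bar>ln (cmod (Gamma (Complex (Re c) y))) - ((Re c - 1/2) * ln \<bar>y\<bar> - pi / 2 * \<bar>y\<bar>)\<bar> \<le> C0"
    using vertical_growth_all[of "Re c"] unfolding vertical_growth_def by blast
  define K where "K = \<bar>ln (\<bar>d\<bar> / 4)\<bar> + \<bar>ln (\<bar>d\<bar> + \<bar>Im c\<bar>)\<bar>"
  define R where "R = max 1 ((2 * \<bar>Im c\<bar> + 2) / \<bar>d\<bar>)"
  have "c + of_real d * (\<i> * of_real y) \<notin> \<int>\<^sub>\<le>\<^sub>0 \<and>
     \<bar>ln (cmod (Gamma (c + of_real d * (\<i> * of_real y)))) - ((Re c - 1/2) * ln (1 + \<bar>y\<bar>) - pi / 2 * \<bar>d\<bar> * \<bar>y\<bar>)\<bar>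
     \<le> C0 + \<bar>Re c - 1/2\<bar> * K + pi / 2 * \<bar>Im c\<bar>" if y: "\<bar>y\<bar> \<ge> R" for y
  proof -
    define Y where "Y = d * y + Im c"
    have e: "c + of_real d * (\<i> * of_real y) = Complex (Re c) Y" by (simp add: complex_eq_iff Y_def)
    have y1: "\<bar>y\<bar> \<ge> 1" using y by (simp add: R_def)
    have "\<bar>y\<bar> \<ge> (2 * \<bar>Im c\<bar> + 2) / \<bar>d\<bar>" using y by (simp add: R_def)
    then have dy: "\<bar>d\<bar> * \<bar>y\<bar> \<ge> 2 * \<bar>Im c\<bar> + 2" using d by (simp add: field_simps)
    have YY: "\<bar>\<bar>Y\<bar> - \<bar>d\<bar> * \<bar>y\<bar>\<bar> \<le> \<bar>Im c\<bar>" unfolding Y_def abs_mult[symmetric] by arith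
    then have Y1: "\<bar>Y\<bar> \<ge> 1" using dy by arith
    have "\<bar>Y\<bar> \<ge> \<bar>d\<bar> * \<bar>y\<bar> / 2" using YY dy by arith
    moreover have "\<bar>d\<bar> * \<bar>y\<bar> \<ge> \<bar>d\<bar> * 1" using y1 by (intro mult_left_mono) auto
    ultimately have l: "\<bar>Y\<bar> \<ge> \<bar>d\<bar> / 4 * (1 + \<bar>y\<bar>)" by (simp add: algebra_simps)
    have "\<bar>Im c\<bar> \<le> \<bar>Im c\<bar> * (1 + \<bar>y\<bar>)" by (simp add: algebra_simps)
    moreover have "\<bar>Y\<bar> \<le> \<bar>d\<bar> * \<bar>y\<bar> + \<bar>Im c\<bar>" using YY by arith
    moreover have "\<bar>d\<bar> * \<bar>y\<bar> \<le> \<bar>d\<bar> * (1 + \<bar>y\<bar>)" by (intro mult_left_mono) auto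
    ultimately have u: "\<bar>Y\<bar> \<le> (\<bar>d\<bar> + \<bar>Im c\<bar>) * (1 + \<bar>y\<bar>)" unfolding distrib_right by linarith
    have "ln (\<bar>d\<bar> / 4 * (1 + \<bar>y\<bar>)) \<le> ln \<bar>Y\<bar>" "ln \<bar>Y\<bar> \<le> ln ((\<bar>d\<bar> + \<bar>Im c\<bar>) * (1 + \<bar>y\<bar>))"
      using l u d Y1 by (auto simp: ln_le_cancel_iff add_pos_nonneg)
    then have "ln (\<bar>d\<bar> / 4) + ln (1 + \<bar>y\<bar>) \<le> ln \<bar>Y\<bar>" "ln \<bar>Y\<bar> \<le> ln (\<bar>d\<bar> + \<bar>Im c\<bar>) + ln (1 + \<bar>y\<bar>)"
      using d ln_mult_pos[of "\<bar>d\<bar> / 4" "1 + \<bar>y\<bar>"] ln_mult_pos[of "\<bar>d\<bar> + \<bar>Im c\<bar>" "1 + \<bar>y\<bar>"]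
      by (simp_all add: add_pos_nonneg)
    then have "\<bar>ln \<bar>Y\<bar> - ln (1 + \<bar>y\<bar>)\<bar> \<le> K" unfolding K_def by (rule abs_diff_le_of_bounds)
    then have "\<bar>(Re c - 1/2) * ln \<bar>Y\<bar> - (Re c - 1/2) * ln (1 + \<bar>y\<bar>)\<bar> \<le> \<bar>Re c - 1/2\<bar> * K"
      unfolding right_diff_distrib[symmetric] abs_mult by (intro mult_left_mono) auto
    moreover have "\<bar>pi / 2 * \<bar>Y\<bar> - pi / 2 * (\<bar>d\<bar> * \<bar>y\<bar>)\<bar> \<le> pi / 2 * \<bar>Im c\<bar>"
      unfolding right_diff_distrib[symmetric] abs_mult using YY by simp
    ultimately have "\<bar>ln (cmod (Gamma (Complex (Re c) Y))) - ((Re c - 1/2) * ln (1 + \<bar>y\<bar>) - pi / 2 * \<bar>d\<bar> * \<bar>y\<bar>)\<bar>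
     \<le> C0 + \<bar>Re c - 1/2\<bar> * K + pi / 2 * \<bar>Im c\<bar>"
      using abs_diff_perturb[OF C0[OF Y1]] unfolding mult.assoc by blast
    then show ?thesis unfolding e using Y1 Complex_not_nonpos_Int[of Y "Re c"] by auto
  qed
  then show ?thesis by blast
qed

lemma bounded_by_compact_and_tail:
  fixes r :: "real \<Rightarrow> real"
  assumes "continuous_on UNIV r" "\<And>y. \<bar>y\<bar> \<ge> R \<Longrightarrow> r y \<le> C"
  shows "\<exists>C'. \<forall>y. r y \<le> C'"
proof -
  have "compact (r ` {-R..R})" by (intro compact_continuous_image continuous_on_subset[OF assms(1)]) auto
  then obtain B where B: "\<And>y. y \<in> {-R..R} \<Longrightarrow> r y \<le> B"
    by (metis bounded_imp_bdd_above bdd_above.E compact_imp_bounded imageI)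
  have "r y \<le> max B C" for y
  proof (cases "\<bar>y\<bar> \<ge> R")
    case False
    then have "y \<in> {-R..R}" by auto
    then show ?thesis using B[of y] by simp
  qed (use assms(2)[of y] in simp)
  then show ?thesis by blast
qed

lemma powr_exp_bound_of_tail:
  fixes g :: "real \<Rightarrow> real"
  assumes g: "continuous_on UNIV g"
    and tail: "\<And>y. \<bar>y\<bar> \<ge> R \<Longrightarrow> g y \<le> exp (C + p * ln (1 + \<bar>y\<bar>) + q * \<bar>y\<bar>)"
  shows "\<exists>C. \<forall>y. g y \<le> C * ((1 + \<bar>y\<bar>) powr p * exp (q * \<bar>y\<bar>))"
proof -
  define w where "w = (\<lambda>y::real. (1 + \<bar>y\<bar>) powr p * exp (q * \<bar>y\<bar>))"
  have w0: "w y > 0" for y by (simp add: w_def add_pos_nonneg)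
  have "\<exists>C'. \<forall>y. g y / w y \<le> C'"
  proof (rule bounded_by_compact_and_tail)
    show "continuous_on UNIV (\<lambda>y. g y / w y)"
      unfolding w_def by (intro continuous_on_divide g continuous_on_mult continuous_on_powr)
        (auto intro!: continuous_intros simp: add_nonneg_eq_0_iff)
    fix y assume y: "\<bar>y\<bar> \<ge> R"
    have "exp (C + p * ln (1 + \<bar>y\<bar>) + q * \<bar>y\<bar>) = exp C * w y"
      by (simp only: w_def powr_def exp_add mult.assoc) (simp add: add_nonneg_eq_0_iff)
    then show "g y / w y \<le> exp C" using tail[OF y] w0[of y] by (simp add: field_simps)
  qed
  then obtain C' where "\<And>y. g y / w y \<le> C'" by blast
  then have "g y \<le> C' * w y" for y using w0[of y] pos_divide_le_eq by blast
  then show ?thesis unfolding w_def by blast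
qed

text \<open>
  The reciprocal is bounded on the whole line, also if the line passes through a pole of \<open>\<Gamma>\<close>. This
  serves the factors in the denominator of \<open>\<chi>\<close>.
\<close>
lemma rGamma_line_bound:
  assumes d: "d \<noteq> 0"
  shows "\<exists>C. \<forall>y. cmod (rGamma (c + of_real d * (\<i> * of_real y))) \<le>
     C * ((1 + \<bar>y\<bar>) powr (1/2 - Re c) * exp (pi / 2 * \<bar>d\<bar> * \<bar>y\<bar>))"
proof -
  let ?z = "\<lambda>y. c + of_real d * (\<i> * of_real y)"
  obtain C R where CR: "\<And>y. \<bar>y\<bar> \<ge> R \<Longrightarrow> ?z y \<notin> \<int>\<^sub>\<le>\<^sub>0"
     "\<And>y. \<bar>y\<bar> \<ge> R \<Longrightarrow> \<bar>ln (cmod (Gamma (?z y))) - ((Re c - 1/2) * ln (1 + \<bar>y\<bar>) - pi / 2 * \<bar>d\<bar> * \<bar>y\<bar>)\<bar> \<le> C"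
    using ln_norm_Gamma_line[OF d, of c] by blast
  have "continuous_on UNIV (\<lambda>y. rGamma (?z y))"
    by (rule continuous_on_compose2[OF continuous_on_rGamma[of UNIV]]) (auto intro!: continuous_intros)
  then show ?thesis
  proof (rule powr_exp_bound_of_tail[OF continuous_on_norm])
    fix y assume y: "\<bar>y\<bar> \<ge> R"
    have "cmod (Gamma (?z y)) > 0" using CR(1)[OF y] by (simp add: Gamma_eq_zero_iff)
    then have "cmod (rGamma (?z y)) = exp (- ln (cmod (Gamma (?z y))))"
      by (simp add: rGamma_inverse_Gamma norm_inverse exp_minus)
    also have "\<dots> \<le> exp (C + (1/2 - Re c) * ln (1 + \<bar>y\<bar>) + pi / 2 * \<bar>d\<bar> * \<bar>y\<bar>)"
      using abs_le_D2[OF CR(2)[OF y]] by (simp add: algebra_simps)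
    finally show "cmod (rGamma (?z y)) \<le> exp (C + (1/2 - Re c) * ln (1 + \<bar>y\<bar>) + pi / 2 * \<bar>d\<bar> * \<bar>y\<bar>)" .
  qed
qed

lemma Gamma_line_bound:
  assumes d: "d \<noteq> 0" and np: "\<And>y. c + of_real d * (\<i> * of_real y) \<notin> \<int>\<^sub>\<le>\<^sub>0"
  shows "\<exists>C. \<forall>y. cmod (Gamma (c + of_real d * (\<i> * of_real y))) \<le>
     C * ((1 + \<bar>y\<bar>) powr (Re c - 1/2) * exp (- (pi / 2 * \<bar>d\<bar>) * \<bar>y\<bar>))"
proof -
  let ?z = "\<lambda>y. c + of_real d * (\<i> * of_real y)"
  obtain C R where CR:
     "\<And>y. \<bar>y\<bar> \<ge> R \<Longrightarrow> \<bar>ln (cmod (Gamma (?z y))) - ((Re c - 1/2) * ln (1 + \<bar>y\<bar>) - pi / 2 * \<bar>d\<bar> * \<bar>y\<bar>)\<bar> \<le> C"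
    using ln_norm_Gamma_line[OF d, of c] by blast
  have GG: "continuous_on (- \<int>\<^sub>\<le>\<^sub>0) (Gamma :: complex \<Rightarrow> complex)" by (rule continuous_on_Gamma) auto
  have "continuous_on UNIV ?z" by (intro continuous_intros)
  moreover have "range ?z \<subseteq> - \<int>\<^sub>\<le>\<^sub>0" using np by blast
  ultimately have "continuous_on UNIV (\<lambda>y. Gamma (?z y))" by (rule continuous_on_compose2[OF GG])
  then show ?thesis
  proof (rule powr_exp_bound_of_tail[OF continuous_on_norm])
    fix y assume y: "\<bar>y\<bar> \<ge> R"
    have "cmod (Gamma (?z y)) = exp (ln (cmod (Gamma (?z y))))" using np[of y] by (simp add: Gamma_eq_zero_iff)
    also have "\<dots> \<le> exp (C + (Re c - 1/2) * ln (1 + \<bar>y\<bar>) + - (pi / 2 * \<bar>d\<bar>) * \<bar>y\<bar>)"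
      using abs_le_D1[OF CR[OF y]] by (simp add: algebra_simps)
    finally show "cmod (Gamma (?z y)) \<le> exp (C + (Re c - 1/2) * ln (1 + \<bar>y\<bar>) + - (pi / 2 * \<bar>d\<bar>) * \<bar>y\<bar>)" .
  qed
qed

section \<open>Gauss's summation theorem\<close>

lemma pochhammer_nonzero: "z \<notin> \<int>\<^sub>\<le>\<^sub>0 \<Longrightarrow> pochhammer z n \<noteq> (0::complex)"
  by (auto simp: pochhammer_eq_0_iff)

text \<open>Euler's limit for \<open>1 / \<Gamma>\<close>, with the index shifted so that it covers \<open>n = 0\<close>.\<close>
lemma norm_pochhammer_asymp:
  fixes z :: complex
  shows "(\<lambda>n. cmod (pochhammer z n) / (fact n * real (n+1) powr (Re z - 1))) \<longlonglongrightarrow> cmod (rGamma z)"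
proof -
  define f where "f = (\<lambda>n. cmod (pochhammer z n) / (fact n * real (n+1) powr (Re z - 1)))"
  have 1: "(\<lambda>n. cmod (rGamma_series z n)) \<longlonglongrightarrow> cmod (rGamma z)"
    by (intro tendsto_intros)
  have 2: "(\<lambda>n. real n powr Re z / (real (n+1) * real (n+2) powr (Re z - 1))) \<longlonglongrightarrow> 1"
    by real_asymp
  have "(\<lambda>n. cmod (rGamma_series z n) * (real n powr Re z / (real (n+1) * real (n+2) powr (Re z - 1)))) \<longlonglongrightarrow> cmod (rGamma z) * 1"
    by (intro tendsto_mult 1 2)
  moreover have "\<forall>\<^sub>F n in sequentially. cmod (rGamma_series z n) * (real n powr Re z / (real (n+1) * real (n+2) powr (Re z - 1))) = f (Suc n)"
    using eventually_gt_at_top[of 0]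
  proof eventually_elim
    case (elim n)
    have "cmod (rGamma_series z n) = cmod (pochhammer z (Suc n)) / (fact n * real n powr Re z)"
      using elim by (simp add: rGamma_series_def norm_divide norm_mult powr_def)
    moreover have "f (Suc n) = cmod (pochhammer z (Suc n)) / (real (n+1) * fact n * real (n+2) powr (Re z - 1))"
      by (simp add: f_def add_ac)
    ultimately show ?case using elim by (simp add: times_divide_times_eq mult_ac)
  qed
  ultimately have "(\<lambda>n. f (Suc n)) \<longlonglongrightarrow> cmod (rGamma z) * 1"
    by (rule Lim_transform_eventually)
  then have "(\<lambda>n. f (Suc n)) \<longlonglongrightarrow> cmod (rGamma z)" by simp
  then show ?thesis unfolding f_def[symmetric] by (rule LIMSEQ_imp_Suc)
qed

lemma norm_pochhammer_le:
  fixes z :: complex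
  shows "\<exists>C\<ge>0. \<forall>n. cmod (pochhammer z n) \<le> C * (fact n * real (n+1) powr (Re z - 1))"
proof -
  have "Bseq (\<lambda>n. cmod (pochhammer z n) / (fact n * real (n+1) powr (Re z - 1)))"
    using norm_pochhammer_asymp[of z] by (intro convergent_imp_Bseq) (auto simp: convergent_def)
  then obtain K where K: "K > 0" "\<And>n. norm (cmod (pochhammer z n) / (fact n * real (n+1) powr (Re z - 1))) \<le> K"
    by (auto elim: BseqE)
  have "cmod (pochhammer z n) \<le> K * (fact n * real (n+1) powr (Re z - 1))" for n
  proof -
    have p: "fact n * real (n+1) powr (Re z - 1) > 0" by simp
    have "cmod (pochhammer z n) / (fact n * real (n+1) powr (Re z - 1)) \<le> K"
      using abs_le_D1[OF K(2)[of n, unfolded real_norm_def]] .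
    then show ?thesis using p pos_divide_le_eq by blast
  qed
  then show ?thesis using K(1) less_imp_le by blast
qed

lemma norm_pochhammer_ge:
  fixes z :: complex
  assumes z: "z \<notin> \<int>\<^sub>\<le>\<^sub>0"
  shows "\<exists>C\<ge>0. \<forall>n. fact n * real (n+1) powr (Re z - 1) \<le> C * cmod (pochhammer z n)"
proof -
  have nz: "cmod (pochhammer z n) > 0" for n using z by (auto simp: pochhammer_eq_0_iff)
  have "(\<lambda>n. inverse (cmod (pochhammer z n) / (fact n * real (n+1) powr (Re z - 1)))) \<longlonglongrightarrow> inverse (cmod (rGamma z))"
    using z by (intro tendsto_inverse norm_pochhammer_asymp) (simp add: rGamma_eq_zero_iff)
  then have "Bseq (\<lambda>n. inverse (cmod (pochhammer z n) / (fact n * real (n+1) powr (Re z - 1))))"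
    by (intro convergent_imp_Bseq) (auto simp: convergent_def)
  then obtain K where K: "K > 0" "\<And>n. norm (inverse (cmod (pochhammer z n) / (fact n * real (n+1) powr (Re z - 1)))) \<le> K"
    by (auto elim: BseqE)
  have "fact n * real (n+1) powr (Re z - 1) \<le> K * cmod (pochhammer z n)" for n
  proof -
    have "fact n * real (n+1) powr (Re z - 1) / cmod (pochhammer z n) \<le> K"
      using abs_le_D1[OF K(2)[of n, unfolded real_norm_def]] by simp
    then show ?thesis using nz[of n] pos_divide_le_eq by blast
  qed
  then show ?thesis using K(1) less_imp_le by blast
qed

lemma summable_Suc_powr: "p < -1 \<Longrightarrow> summable (\<lambda>n. real (n+1) powr p)"
  using summable_real_powr_iff[of p] summable_Suc_iff[of "\<lambda>n. real n powr p"] by simp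

definition hyp_coeff :: "complex \<Rightarrow> complex \<Rightarrow> complex \<Rightarrow> nat \<Rightarrow> complex" where
  "hyp_coeff a b c k = pochhammer a k * pochhammer b k / (pochhammer c k * fact k)"

lemma norm_hyp_coeff_le:
  assumes c: "c \<notin> \<int>\<^sub>\<le>\<^sub>0"
  shows "\<exists>C\<ge>0. \<forall>n. cmod (hyp_coeff a b c n) \<le> C * real (n+1) powr (Re (a + b - c) - 1)"
proof -
  obtain A where A: "A \<ge> 0" "\<And>n. cmod (pochhammer a n) \<le> A * (fact n * real (n+1) powr (Re a - 1))"
    using norm_pochhammer_le by blast
  obtain B where B: "B \<ge> 0" "\<And>n. cmod (pochhammer b n) \<le> B * (fact n * real (n+1) powr (Re b - 1))"
    using norm_pochhammer_le by blast
  obtain D where D: "D \<ge> 0" "\<And>n. fact n * real (n+1) powr (Re c - 1) \<le> D * cmod (pochhammer c n)"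
    using norm_pochhammer_ge[OF c] by blast
  have "cmod (hyp_coeff a b c n) \<le> (A * B * D) * real (n+1) powr (Re (a + b - c) - 1)" for n
  proof -
    define F :: real where "F = fact n"
    define x where "x = real (n+1)"
    have F: "F > 0" and x: "x > 0" by (auto simp: F_def x_def)
    have nz: "cmod (pochhammer c n) > 0" using c by (auto simp: pochhammer_eq_0_iff)
    have hyp: "cmod (hyp_coeff a b c n) = cmod (pochhammer a n) * cmod (pochhammer b n) * (1 / cmod (pochhammer c n)) / F"
      by (simp add: hyp_coeff_def norm_divide norm_mult F_def)
    have "1 / cmod (pochhammer c n) \<le> D / (F * x powr (Re c - 1))"
      using D(2)[of n] nz F x unfolding F_def[symmetric] x_def[symmetric]
      by (simp add: divide_simps mult.commute)
    then have "cmod (pochhammer a n) * cmod (pochhammer b n) * (1 / cmod (pochhammer c n)) \<le>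
        (A * (F * x powr (Re a - 1))) * (B * (F * x powr (Re b - 1))) * (D / (F * x powr (Re c - 1)))"
      using A B(1) B(2) F x unfolding F_def x_def
      by (intro mult_mono) (auto intro!: mult_nonneg_nonneg)
    then have "cmod (hyp_coeff a b c n) \<le>
        (A * (F * x powr (Re a - 1))) * (B * (F * x powr (Re b - 1))) * (D / (F * x powr (Re c - 1))) / F"
      using F unfolding hyp by (intro divide_right_mono) auto
    also have "\<dots> = A * B * D * (x powr (Re a - 1) * x powr (Re b - 1) / x powr (Re c - 1))"
      using F x by simp
    also have "x powr (Re a - 1) * x powr (Re b - 1) / x powr (Re c - 1) = x powr (Re (a + b - c) - 1)"
      by (simp add: powr_add[symmetric] powr_diff[symmetric] algebra_simps)
    finally show ?thesis unfolding x_def .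
  qed
  then show ?thesis using A B D by (meson mult_nonneg_nonneg)
qed

lemma summable_hyp_coeff:
  assumes c: "c \<notin> \<int>\<^sub>\<le>\<^sub>0" and "Re (c - a - b) > 0"
  shows "summable (\<lambda>n. cmod (hyp_coeff a b c n))"
proof -
  obtain C where C: "\<And>n. cmod (hyp_coeff a b c n) \<le> C * real (n+1) powr (Re (a + b - c) - 1)"
    using norm_hyp_coeff_le[OF c] by blast
  have "summable (\<lambda>n. C * real (n+1) powr (Re (a + b - c) - 1))"
    using assms by (intro summable_mult summable_Suc_powr) simp
  then show ?thesis by (rule summable_comparison_test'[where N=0]) (simp only: real_norm_def abs_norm_cancel C)
qed

lemma hyp_coeff_Suc:
  assumes c: "c \<notin> \<int>\<^sub>\<le>\<^sub>0"
  shows "of_nat (Suc n) * hyp_coeff a b c (Suc n) = hyp_coeff a b c n * ((a + of_nat n) * (b + of_nat n) / (c + of_nat n))"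
proof -
  have "c + of_nat n \<noteq> 0" using c by (metis add_eq_0_iff2 minus_of_nat_in_nonpos_Ints)
  then show ?thesis unfolding hyp_coeff_def pochhammer_Suc fact_Suc
    by (simp add: divide_simps del: of_nat_Suc)
qed

lemma hyp_coeff_shift:
  assumes c: "c \<notin> \<int>\<^sub>\<le>\<^sub>0"
  shows "hyp_coeff a b (c + 1) n = hyp_coeff a b c n * (c / (c + of_nat n))"
proof -
  have nz: "c + of_nat k \<noteq> 0" for k using c by (metis add_eq_0_iff2 minus_of_nat_in_nonpos_Ints)
  have "c * pochhammer (c + 1) n = pochhammer c n * (c + of_nat n)"
    by (metis pochhammer_Suc pochhammer_rec)
  moreover have "pochhammer (c + 1) n \<noteq> 0"  "pochhammer c n \<noteq> 0"
    using c plus_one_in_nonpos_Ints_imp[of c] by (metis pochhammer_nonzero)+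
  ultimately show ?thesis unfolding hyp_coeff_def using nz[of n]
    by (simp add: divide_simps)
qed

text \<open>
  Gauss's contiguity relation at the point 1. The termwise difference of the two sides is
  \<open>c (n A\<^sub>n - (n + 1) A\<^sub>n\<^sub>+\<^sub>1)\<close>, where \<open>A\<^sub>n\<close> is the \<open>n\<close>-th coefficient, so it telescopes to 0.
\<close>
lemma hyp_sum_recurrence:
  assumes c: "c \<notin> \<int>\<^sub>\<le>\<^sub>0" and s: "Re (c - a - b) > 0"
  shows "c * (c - a - b) * (\<Sum>n. hyp_coeff a b c n) = (c - a) * (c - b) * (\<Sum>n. hyp_coeff a b (c+1) n)"
proof -
  have nz: "c + of_nat k \<noteq> 0" for k using c by (metis add_eq_0_iff2 minus_of_nat_in_nonpos_Ints)
  have c1: "c + 1 \<notin> \<int>\<^sub>\<le>\<^sub>0" using c by (meson plus_one_in_nonpos_Ints_imp)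
  have sA: "summable (hyp_coeff a b c)" using summable_hyp_coeff[OF c s] by (rule summable_norm_cancel)
  have sB: "summable (hyp_coeff a b (c+1))" using summable_hyp_coeff[OF c1, of a b] s
    by (auto dest: summable_norm_cancel)
  \<comment> \<open>the telescoping terms\<close>
  define X where "X = (\<lambda>n. c * (of_nat n * hyp_coeff a b c n))"
  have step: "c * (c - a - b) * hyp_coeff a b c n - (c - a) * (c - b) * hyp_coeff a b (c+1) n = X n - X (Suc n)" for n
    unfolding X_def hyp_coeff_Suc[OF c] hyp_coeff_shift[OF c] using nz[of n]
    by (simp add: divide_simps) (simp add: algebra_simps)
  have "X \<longlonglongrightarrow> 0"
  proof -
    obtain C where C: "\<And>n. cmod (hyp_coeff a b c n) \<le> C * real (n+1) powr (Re (a + b - c) - 1)"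
      using norm_hyp_coeff_le[OF c] by blast
    have "(\<lambda>n. of_nat n * hyp_coeff a b c n) \<longlonglongrightarrow> 0"
    proof (rule Lim_null_comparison)
      show "\<forall>\<^sub>F n in sequentially. norm (of_nat n * hyp_coeff a b c n) \<le> C * (real n * real (n+1) powr (Re (a + b - c) - 1))"
        using C by (intro always_eventually allI) (simp add: norm_mult mult.left_commute[of C] mult_left_mono)
      have "Re (a + b - c) < 0" using s by simp
      then have "(\<lambda>n. real n * real (n+1) powr (Re (a + b - c) - 1)) \<longlonglongrightarrow> 0" by real_asymp
      then show "(\<lambda>n. C * (real n * real (n+1) powr (Re (a + b - c) - 1))) \<longlonglongrightarrow> 0"
        by (rule tendsto_mult_right_zero)
    qed
    then show ?thesis unfolding X_def by (rule tendsto_mult_right_zero)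
  qed
  then have "(\<lambda>n. X n - X (Suc n)) sums (X 0 - 0)" by (rule telescope_sums')
  then have "(\<lambda>n. c * (c - a - b) * hyp_coeff a b c n - (c - a) * (c - b) * hyp_coeff a b (c+1) n) sums 0"
    unfolding step by (simp only: X_def of_nat_0 mult_zero_left mult_zero_right diff_zero)
  moreover have "(\<lambda>n. c * (c - a - b) * hyp_coeff a b c n - (c - a) * (c - b) * hyp_coeff a b (c+1) n) sums
     (c * (c - a - b) * (\<Sum>n. hyp_coeff a b c n) - (c - a) * (c - b) * (\<Sum>n. hyp_coeff a b (c+1) n))"
    by (intro sums_diff sums_mult summable_sums sA sB)
  ultimately have "0 = c * (c - a - b) * (\<Sum>n. hyp_coeff a b c n) - (c - a) * (c - b) * (\<Sum>n. hyp_coeff a b (c+1) n)"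
    by (rule sums_unique2)
  then show ?thesis by (metis eq_iff_diff_eq_0)
qed

lemma hyp_sum_iterate:
  assumes c: "Re c > 0" and s: "Re (c - a - b) > 0"
  shows "(\<Sum>n. hyp_coeff a b c n) =
     pochhammer (c - a) m * pochhammer (c - b) m / (pochhammer c m * pochhammer (c - a - b) m) * (\<Sum>n. hyp_coeff a b (c + of_nat m) n)"
proof (induction m)
  case (Suc m)
  have c': "c + of_nat m \<notin> \<int>\<^sub>\<le>\<^sub>0" using c by (auto elim!: nonpos_Ints_cases simp: complex_eq_iff)
  have s': "Re (c + of_nat m - a - b) > 0" using s by simp
  have nz: "c + of_nat m \<noteq> 0" "c + of_nat m - a - b \<noteq> 0" using c s' by (auto simp: complex_eq_iff)
  have "(\<Sum>n. hyp_coeff a b (c + of_nat m) n) = (c - a + of_nat m) * (c - b + of_nat m) / ((c + of_nat m) * (c - a - b + of_nat m)) *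
      (\<Sum>n. hyp_coeff a b (c + of_nat (Suc m)) n)"
  proof -
    have *: "S = U / W * S'" if "W * S = U * S'" "W \<noteq> 0" for S U W S' :: complex
      using that by (simp add: field_simps)
    have e: "c - a + of_nat m = c + of_nat m - a" "c - b + of_nat m = c + of_nat m - b"
      "c - a - b + of_nat m = c + of_nat m - a - b" "c + of_nat (Suc m) = c + of_nat m + 1"
      by simp_all
    show ?thesis unfolding e by (rule *[OF hyp_sum_recurrence[OF c' s']]) (use nz in simp)
  qed
  then show ?case using Suc.IH unfolding pochhammer_Suc by (simp add: mult_ac)
qed simp

lemma norm_pochhammer_shift_mono:
  assumes "Re c > 0"
  shows "cmod (pochhammer c k) \<le> cmod (pochhammer (c + of_nat m) k)"
proof -
  have "cmod (c + of_nat i) \<le> cmod (c + of_nat m + of_nat i)" for i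
  proof -
    have "(Re c + i)\<^sup>2 \<le> (Re c + m + i)\<^sup>2" using assms by (intro power_mono) auto
    then show ?thesis by (simp add: cmod_def)
  qed
  then show ?thesis unfolding pochhammer_prod prod_norm[symmetric] by (intro prod_mono) auto
qed

text \<open>
  Iterating the relation moves the parameter \<open>c\<close> to infinity, where the sum tends to its first term 1,
  and the accumulated factors tend to the Gamma quotient by Euler's limit. The passage to the limit
  is dominated by the original series, because \<open>|(c)\<^sub>n|\<close> increases when \<open>c\<close> is shifted to the right.
\<close>
theorem Gauss_hypergeometric_sum:
  assumes c: "Re c > 0" and s: "Re (c - a - b) > 0"
  shows "hyp_coeff a b c sums (Gamma c * Gamma (c - a - b) * rGamma (c - a) * rGamma (c - b))"
proof -
  note np = Re_pos_not_nonpos_Int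
  have pos: "cmod (pochhammer z k) > 0" if "Re z > 0" for z k using np[OF that] by (auto simp: pochhammer_eq_0_iff)
  have sA: "summable (hyp_coeff a b c)" using summable_hyp_coeff[OF np[OF c] s] by (rule summable_norm_cancel)
  have lim1: "(\<lambda>m. \<Sum>n. hyp_coeff a b (c + of_nat m) n) \<longlonglongrightarrow> (\<Sum>n. if n = 0 then 1 else 0)"
  proof (rule conjunct2[OF conjunct2[OF tannerys_theorem[where M = "\<lambda>n. cmod (hyp_coeff a b c n)"]]])
    show "summable (\<lambda>n. cmod (hyp_coeff a b c n))" by (rule summable_hyp_coeff[OF np[OF c] s])
    fix k :: nat
    show "(\<lambda>m. hyp_coeff a b (c + of_nat m) k) \<longlonglongrightarrow> (if k = 0 then 1 else 0)"
    proof (cases k)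
      case (Suc j)
      define K where "K = cmod (pochhammer a k * pochhammer b k / fact k) / cmod (pochhammer (c+1) j)"
      have "(\<lambda>m. hyp_coeff a b (c + of_nat m) k) \<longlonglongrightarrow> 0"
      proof (rule Lim_null_comparison)
        show "\<forall>\<^sub>F m in sequentially. norm (hyp_coeff a b (c + of_nat m) k) \<le> K * inverse (real m)"
          using eventually_gt_at_top[of 0]
        proof eventually_elim
          case (elim m)
          have "real m * cmod (pochhammer (c+1) j) \<le> cmod (c + of_nat m) * cmod (pochhammer (c + 1 + of_nat m) j)"
          proof (intro mult_mono norm_pochhammer_shift_mono)
            show "real m \<le> cmod (c + of_nat m)" using c complex_Re_le_cmod[of "c + of_nat m"] by simp
          qed (use c in auto)
          also have "\<dots> = cmod (pochhammer (c + of_nat m) k)"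
            by (simp add: Suc pochhammer_rec norm_mult add_ac)
          finally have "inverse (cmod (pochhammer (c + of_nat m) k)) \<le> inverse (real m * cmod (pochhammer (c+1) j))"
            using elim c by (intro le_imp_inverse_le mult_pos_pos pos) auto
          then have "cmod (pochhammer a k * pochhammer b k / fact k) * inverse (cmod (pochhammer (c + of_nat m) k)) \<le>
             cmod (pochhammer a k * pochhammer b k / fact k) * inverse (real m * cmod (pochhammer (c+1) j))"
            by (intro mult_left_mono) auto
          then show ?case by (simp add: hyp_coeff_def K_def norm_mult norm_divide norm_inverse divide_inverse mult_ac)
        qed
        show "(\<lambda>m. K * inverse (real m)) \<longlonglongrightarrow> 0" by real_asymp
      qed
      then show ?thesis using Suc by simp
    qed (simp add: hyp_coeff_def)
  next
    have "cmod (hyp_coeff a b (c + of_nat m) k) \<le> cmod (hyp_coeff a b c k)" for k m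
      unfolding hyp_coeff_def norm_divide norm_mult
      using c by (intro divide_left_mono mult_right_mono norm_pochhammer_shift_mono mult_nonneg_nonneg mult_pos_pos pos) auto
    then show "\<forall>\<^sub>F x in at_top \<times>\<^sub>F sequentially. case x of (k, m) \<Rightarrow> cmod (hyp_coeff a b (c + of_nat m) k) \<le> cmod (hyp_coeff a b c k)"
      by (intro always_eventually) auto
  qed auto
  have "(\<Sum>n. if n = 0 then 1 else 0) = (1::complex)"
    using suminf_finite[of "{0::nat}" "\<lambda>n. if n = 0 then 1 else (0::complex)"] by simp
  then have lim1: "(\<lambda>m. \<Sum>n. hyp_coeff a b (c + of_nat (Suc m)) n) \<longlonglongrightarrow> 1"
    using LIMSEQ_Suc[OF lim1] by simp
  define Q where "Q = (\<lambda>m. pochhammer (c - a) m * pochhammer (c - b) m / (pochhammer c m * pochhammer (c - a - b) m))"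
  have "(\<lambda>m. rGamma_series (c - a) m * rGamma_series (c - b) m / (rGamma_series c m * rGamma_series (c - a - b) m))
      \<longlonglongrightarrow> rGamma (c - a) * rGamma (c - b) / (rGamma c * rGamma (c - a - b))"
    using np[OF c] np[OF s] by (intro tendsto_intros) (simp add: rGamma_eq_zero_iff)
  moreover have "rGamma_series (c - a) m * rGamma_series (c - b) m / (rGamma_series c m * rGamma_series (c - a - b) m) = Q (Suc m)" for m
  proof -
    define l :: complex where "l = of_real (ln (of_nat m))"
    have "exp ((c - a) * l) * exp ((c - b) * l) = exp (c * l) * exp ((c - a - b) * l)"
      unfolding exp_add[symmetric] by (simp add: algebra_simps)
    moreover have "exp (c * l) \<noteq> 0" "exp ((c - a - b) * l) \<noteq> 0" "exp ((c - a) * l) \<noteq> 0" "exp ((c - b) * l) \<noteq> 0" by auto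
    moreover have "x1 / (f * e1) * (x2 / (f * e2)) / (x3 / (f * e3) * (x4 / (f * e4))) = x1 * x2 / (x3 * x4)"
      if "e1 * e2 = e3 * e4" "e1 \<noteq> 0" "e2 \<noteq> 0" "e3 \<noteq> 0" "e4 \<noteq> 0" "f \<noteq> 0" for x1 x2 x3 x4 e1 e2 e3 e4 f :: complex
    proof -
      have "x1 / (f * e1) * (x2 / (f * e2)) / (x3 / (f * e3) * (x4 / (f * e4))) = (x1 * x2 / (x3 * x4)) * ((e3 * e4) / (e1 * e2))"
        using that(2-) by (simp add: field_simps)
      then show ?thesis using that by simp
    qed
    ultimately show ?thesis unfolding rGamma_series_def Q_def Suc_eq_plus1 l_def by simp
  qed
  ultimately have "(\<lambda>m. Q (Suc m)) \<longlonglongrightarrow> rGamma (c - a) * rGamma (c - b) / (rGamma c * rGamma (c - a - b))" by simp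
  then have "(\<lambda>m. Q (Suc m) * (\<Sum>n. hyp_coeff a b (c + of_nat (Suc m)) n)) \<longlonglongrightarrow> rGamma (c - a) * rGamma (c - b) / (rGamma c * rGamma (c - a - b)) * 1"
    by (intro tendsto_mult lim1)
  moreover have "Q (Suc m) * (\<Sum>n. hyp_coeff a b (c + of_nat (Suc m)) n) = (\<Sum>n. hyp_coeff a b c n)" for m
    unfolding Q_def by (rule hyp_sum_iterate[OF c s, symmetric])
  ultimately have "(\<Sum>n. hyp_coeff a b c n) = rGamma (c - a) * rGamma (c - b) / (rGamma c * rGamma (c - a - b))"
    by (simp add: LIMSEQ_const_iff)
  also have "\<dots> = Gamma c * Gamma (c - a - b) * rGamma (c - a) * rGamma (c - b)"
    by (simp add: Gamma_def divide_inverse)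
  finally show ?thesis using summable_sums[OF sA] by simp
qed

section \<open>Beta integrals with complex exponents\<close>

text \<open>The integrand of Euler's Beta integral.\<close>
definition beta_kernel :: "complex \<Rightarrow> complex \<Rightarrow> real \<Rightarrow> complex" where
  "beta_kernel p q v = of_real v powr (p - 1) * of_real (1 - v) powr (q - 1)"

abbreviation partial_Beta :: "complex \<Rightarrow> complex \<Rightarrow> real \<Rightarrow> complex" where
  "partial_Beta p q u \<equiv> (LINT v:{0<..<u}|lborel. beta_kernel p q v)"

lemma norm_beta_kernel:
  "0 < v \<Longrightarrow> v < 1 \<Longrightarrow> cmod (beta_kernel p q v) = v powr (Re p - 1) * (1 - v) powr (Re q - 1)"
  unfolding beta_kernel_def norm_mult by (subst (1 2) norm_powr_real_powr) auto

lemma continuous_on_beta_kernel: "continuous_on {0<..<1} (beta_kernel p q)"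
  unfolding beta_kernel_def by (intro continuous_intros) (auto simp: complex_nonpos_Reals_iff)

lemma beta_kernel_shift:
  "0 < v \<Longrightarrow> beta_kernel (p + of_nat k) q v = of_real v ^ k * beta_kernel p q v"
  unfolding beta_kernel_def by (simp add: powr_add powr_diff powr_nat')

lemma real_beta_kernel_integrable:
  assumes "p > 0" "q > 0" "u \<le> 1"
  shows "set_integrable lborel {0<..<u} (\<lambda>v. v powr (p - 1) * (1 - v) powr (q - 1) :: real)"
  by (rule set_integrable_subset[OF integrable_Beta[OF assms(1,2)]]) (use assms in auto)

lemma real_beta_kernel_integral:
  assumes "p > 0" "q > 0"
  shows "(LINT v:{0<..<1}|lborel. v powr (p - 1) * (1 - v) powr (q - 1) :: real) = Beta p q"
proof -
  have "((\<lambda>v. v powr (p - 1) * (1 - v) powr (q - 1)) has_integral Beta p q) {0<..<1}"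
    using has_integral_Beta_real[OF assms] by (simp add: has_integral_Icc_iff_Ioo)
  then show ?thesis
    using set_borel_integral_eq_integral(2)[OF real_beta_kernel_integrable[OF assms order_refl]]
    by (simp add: integral_unique)
qed

lemma real_beta_kernel_integral_le:
  assumes "p > 0" "q > 0" "u \<le> 1"
  shows "(LINT v:{0<..<u}|lborel. v powr (p - 1) * (1 - v) powr (q - 1) :: real) \<le> Beta p q"
proof -
  have "(LINT v:{0<..<u}|lborel. v powr (p - 1) * (1 - v) powr (q - 1)) \<le> (LINT v:{0<..<1}|lborel. v powr (p - 1) * (1 - v) powr (q - 1) :: real)"
    using real_beta_kernel_integrable[OF assms(1,2) order_refl] real_beta_kernel_integrable[OF assms] assms(3)
    unfolding set_lebesgue_integral_def set_integrable_def
    by (intro integral_mono) (auto simp: indicator_def)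
  then show ?thesis using real_beta_kernel_integral[OF assms(1,2)] by simp
qed

lemma set_borel_measurable_Ioo:
  fixes f :: "real \<Rightarrow> 'a::real_normed_vector"
  assumes "continuous_on {0<..<1} f" "u \<le> 1"
  shows "set_borel_measurable lborel {0<..<u} f"
proof -
  have "continuous_on {0<..<u} f" by (rule continuous_on_subset[OF assms(1)]) (use assms(2) in auto)
  then have "(\<lambda>x. indicator {0<..<u} x *\<^sub>R f x) \<in> borel_measurable borel"
    by (intro borel_measurable_continuous_on_indicator) auto
  then show ?thesis unfolding set_borel_measurable_def by simp
qed

lemma beta_kernel_integrable:
  assumes "Re p > 0" "Re q > 0" "u \<le> 1"
  shows "set_integrable lborel {0<..<u} (beta_kernel p q)"
  by (rule set_integrable_bound[OF real_beta_kernel_integrable[OF assms]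
        set_borel_measurable_Ioo[OF continuous_on_beta_kernel assms(3)]])
    (use assms in \<open>auto intro!: AE_I2 simp: norm_beta_kernel\<close>)

lemma set_integral_norm_le:
  fixes f :: "real \<Rightarrow> complex"
  assumes "set_integrable lborel S f" "set_integrable lborel S g" "\<And>x. x \<in> S \<Longrightarrow> cmod (f x) \<le> g x"
  shows "cmod (LINT x:S|lborel. f x) \<le> (LINT x:S|lborel. g x)"
proof -
  have "cmod (LINT x:S|lborel. f x) \<le> (LINT x:S|lborel. cmod (f x))"
    by (rule set_integral_norm_bound[OF assms(1)])
  also have "\<dots> \<le> (LINT x:S|lborel. g x)"
    by (intro set_integral_mono set_integrable_norm assms)
  finally show ?thesis .
qed

lemma norm_beta_kernel_integral_le:
  assumes "Re p > 0" "Re q > 0" "u \<le> 1"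
  shows "cmod (partial_Beta p q u) \<le> Beta (Re p) (Re q)"
proof -
  have "cmod (partial_Beta p q u) \<le> (LINT v:{0<..<u}|lborel. v powr (Re p - 1) * (1 - v) powr (Re q - 1))"
    by (rule set_integral_norm_le[OF beta_kernel_integrable[OF assms] real_beta_kernel_integrable[OF assms]])
      (use assms in \<open>auto simp: norm_beta_kernel\<close>)
  also have "\<dots> \<le> Beta (Re p) (Re q)" by (rule real_beta_kernel_integral_le[OF assms])
  finally show ?thesis .
qed

text \<open>
  Termwise integration. The first summability hypothesis is absolute convergence after integration;
  the second one makes the power series converge inside the interval.
\<close>
lemma
  fixes A :: "nat \<Rightarrow> complex"
  assumes p: "Re p > 0" and q: "Re q > 0" and u: "u \<le> 1"
    and sA: "summable (\<lambda>k. cmod (A k) * Beta (Re p + real k) (Re q))"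
    and sv: "\<And>v. 0 < v \<Longrightarrow> v < 1 \<Longrightarrow> summable (\<lambda>k. cmod (A k) * v ^ k)"
  shows power_series_beta_kernel_integrable:
      "set_integrable lborel {0<..<u} (\<lambda>v. (\<Sum>k. A k * of_real v ^ k) * beta_kernel p q v)" (is ?th1)
    and power_series_beta_kernel_sums:
      "(\<lambda>k. A k * (partial_Beta (p + of_nat k) q u)) sums
       (LINT v:{0<..<u}|lborel. (\<Sum>k. A k * of_real v ^ k) * beta_kernel p q v)" (is ?th2)
proof -
  define f where "f = (\<lambda>k v. indicator {0<..<u} v *\<^sub>R (A k * beta_kernel (p + of_nat k) q v))"
  have int: "integrable lborel (f k)" for k
  proof -
    have "set_integrable lborel {0<..<u} (\<lambda>v. A k * beta_kernel (p + of_nat k) q v)"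
      using p q u by (intro set_integrable_mult_right beta_kernel_integrable) auto
    then show ?thesis unfolding f_def set_integrable_def .
  qed
  have fv: "f k v = (A k * of_real v ^ k) * beta_kernel p q v" if "v \<in> {0<..<u}" for k v
    using that by (simp add: f_def beta_kernel_shift)
  have f0: "f k v = 0" if "v \<notin> {0<..<u}" for k v
    using that by (simp add: f_def indicator_def)
  have sumf: "summable (\<lambda>k. norm (f k v))" for v
  proof (cases "v \<in> {0<..<u}")
    case True
    then have "summable (\<lambda>k. cmod (A k) * v ^ k * cmod (beta_kernel p q v))"
      using u by (intro summable_mult2 sv) auto
    then show ?thesis using True by (simp add: fv norm_mult norm_power)
  qed (simp add: f0)
  have "norm (LINT v|lborel. norm (f k v)) \<le> cmod (A k) * Beta (Re p + real k) (Re q)" for k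
  proof -
    have "(LINT v|lborel. norm (f k v)) =
        (LINT v:{0<..<u}|lborel. cmod (A k) * (v powr (Re p + real k - 1) * (1 - v) powr (Re q - 1)))"
      unfolding set_lebesgue_integral_def
      by (intro Bochner_Integration.integral_cong) (use u in \<open>auto simp: f_def indicator_def norm_mult norm_beta_kernel\<close>)
    also have "\<dots> \<le> cmod (A k) * Beta (Re p + real k) (Re q)"
      unfolding set_integral_mult_right
      by (intro mult_left_mono real_beta_kernel_integral_le) (use p q u in auto)
    finally show ?thesis by simp
  qed
  then have sumI: "summable (\<lambda>k. LINT v|lborel. norm (f k v))"
    by (intro summable_comparison_test'[OF sA, of 0]) auto
  have suminf: "(\<Sum>k. f k v) = indicator {0<..<u} v *\<^sub>R ((\<Sum>k. A k * of_real v ^ k) * beta_kernel p q v)" for v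
  proof (cases "v \<in> {0<..<u}")
    case True
    then have "summable (\<lambda>k. cmod (A k) * v ^ k)" using u by (intro sv) auto
    then have "summable (\<lambda>k. A k * of_real v ^ k)"
      using True by (intro summable_norm_cancel[of "\<lambda>k. A k * of_real v ^ k"]) (simp add: norm_mult norm_power)
    then show ?thesis using True by (simp add: fv suminf_mult2)
  qed (simp add: f0)
  show ?th1 unfolding set_integrable_def suminf[symmetric]
    by (rule integrable_suminf) (auto intro: int sumf sumI)
  have "(\<lambda>k. integral\<^sup>L lborel (f k)) sums (LINT v|lborel. (\<Sum>k. f k v))"
    by (rule sums_integral) (auto intro: int sumf sumI)
  moreover have "integral\<^sup>L lborel (f k) = A k * (partial_Beta (p + of_nat k) q u)" for k
    unfolding set_integral_mult_right[symmetric] unfolding f_def set_lebesgue_integral_def ..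
  ultimately show ?th2 unfolding suminf set_lebesgue_integral_def by simp
qed

text \<open>
  The antiderivatives below are products of complex powers, for which the only difficulty is the
  endpoint 0; the bound by a positive power of \<open>v\<close> gives continuity there.
\<close>
lemma fundamental_theorem_vanishing_at_0:
  fixes W w :: "real \<Rightarrow> 'a::euclidean_space"
  assumes u: "0 < u" and r: "r > 0"
    and der: "\<And>v. 0 < v \<Longrightarrow> v \<le> u \<Longrightarrow> (W has_vector_derivative w v) (at v)"
    and bd: "\<And>v. 0 < v \<Longrightarrow> v \<le> u \<Longrightarrow> norm (W v) \<le> C * v powr r"
    and int: "set_integrable lborel {0<..<u} w"
  shows "(LINT v:{0<..<u}|lborel. w v) = W u"
proof -
  \<comment> \<open>the value of \<open>W\<close> at 0 is replaced by its limit\<close>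
  define V where "V = (\<lambda>v. if v \<le> 0 then 0 else W v)"
  have derV: "(V has_vector_derivative w v) (at v)" if "0 < v" "v \<le> u" for v
    by (rule has_vector_derivative_transform_within_open[OF der[OF that], of "{0<..}"])
      (use that in \<open>auto simp: V_def\<close>)
  have "continuous_on {0..u} V" unfolding continuous_on_eq_continuous_within
  proof
    fix v assume v: "v \<in> {0..u}"
    show "continuous (at v within {0..u}) V"
    proof (cases "v = 0")
      case True
      have "(V \<longlongrightarrow> 0) (at 0 within {0..u})"
      proof (rule Lim_null_comparison)
        show "\<forall>\<^sub>F x in at 0 within {0..u}. norm (V x) \<le> C * x powr r"
          using bd by (auto simp: eventually_at_filter V_def)
        have "((\<lambda>x. C * x powr r) \<longlongrightarrow> C * 0 powr r) (at_right (0::real))"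
          using r by (intro tendsto_intros) (auto simp: eventually_at_filter)
        then have "((\<lambda>x. C * x powr r) \<longlongrightarrow> 0) (at_right (0::real))" by simp
        then show "((\<lambda>x. C * x powr r) \<longlongrightarrow> 0) (at 0 within {0..u})"
          using u by (simp add: at_within_Icc_at_right)
      qed
      then show ?thesis using True by (simp add: continuous_within V_def)
    next
      case False
      then show ?thesis using v derV[of v] has_vector_derivative_continuous continuous_at_imp_continuous_within by fastforce
    qed
  qed
  then have "(w has_integral (V u - V 0)) {0..u}"
    using u derV by (intro fundamental_theorem_of_calculus_interior) auto
  then have "(w has_integral W u) {0<..<u}" using u by (simp add: V_def has_integral_Icc_iff_Ioo)
  then show ?thesis using set_borel_integral_eq_integral(2)[OF int] by (simp add: integral_unique)
qed

lemma powr_has_vector_derivative: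
  "0 < v \<Longrightarrow> ((\<lambda>v. complex_of_real v powr p) has_vector_derivative p * of_real v powr (p - 1)) (at v)"
  by (intro has_vector_derivative_real_field has_field_derivative_powr) (auto simp: complex_nonpos_Reals_iff)

lemma one_minus_powr_has_vector_derivative:
  "v < 1 \<Longrightarrow> ((\<lambda>v. complex_of_real (1 - v) powr p) has_vector_derivative - p * of_real (1 - v) powr (p - 1)) (at v)"
proof -
  assume v: "v < 1"
  have d: "((\<lambda>v::real. 1 - v) has_vector_derivative -1) (at v)"
    by (auto intro!: derivative_eq_intros)
  have "((\<lambda>v. complex_of_real v powr p) has_vector_derivative p * of_real (1 - v) powr (p - 1)) (at (1 - v))"
    using v by (intro powr_has_vector_derivative) simp
  from vector_diff_chain_at[OF d this] show ?thesis by (simp add: o_def)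
qed

lemma Beta_nonneg: "P > 0 \<Longrightarrow> E > 0 \<Longrightarrow> Beta P E \<ge> (0::real)"
  using Gamma_real_pos[of P] Gamma_real_pos[of E] Gamma_real_pos[of "P + E"] by (simp add: Beta_def)

text \<open>The quotient of Pochhammer symbols in \<open>B(d + k, E)\<close> behaves like \<open>k\<^sup>-\<^sup>E\<close>.\<close>
lemma Beta_shift_le:
  assumes "d > 0" "E > (0::real)"
  shows "\<exists>C\<ge>0. \<forall>k. Beta (d + real k) E \<le> C * real (k+1) powr (- E)"
proof -
  have np: "complex_of_real (d + E) \<notin> \<int>\<^sub>\<le>\<^sub>0" using assms by (intro Re_pos_not_nonpos_Int) simp
  obtain A where A: "A \<ge> 0" "\<And>n. cmod (pochhammer (of_real d) n) \<le> A * (fact n * real (n+1) powr (Re (of_real d) - 1))"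
    using norm_pochhammer_le by blast
  obtain D where D: "D \<ge> 0" "\<And>n. fact n * real (n+1) powr (Re (of_real (d + E)) - 1) \<le> D * cmod (pochhammer (of_real (d + E)) n)"
    using norm_pochhammer_ge[OF np] by blast
  have "Beta (d + real k) E \<le> (Beta d E * (A * D)) * real (k+1) powr (- E)" for k
  proof -
    define F :: real where "F = fact k"
    define z where "z = real (k+1)"
    have F: "F > 0" and z: "z > 0" by (auto simp: F_def z_def)
    have nd: "d \<notin> \<int>\<^sub>\<le>\<^sub>0" "d + E \<notin> \<int>\<^sub>\<le>\<^sub>0" using assms by (auto elim!: nonpos_Ints_cases)
    have pd: "pochhammer d k > 0" "pochhammer (d + E) k > 0" using assms by (auto intro!: pochhammer_pos)
    have "Beta (d + real k) E = Beta d E * (pochhammer d k / pochhammer (d + E) k)"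
      using pochhammer_Gamma[OF nd(1), of k] pochhammer_Gamma[OF nd(2), of k] assms
        Gamma_real_pos[of d, THEN less_imp_neq] Gamma_real_pos[of "d + E", THEN less_imp_neq]
      by (simp add: Beta_def add_ac)
    also have "\<dots> \<le> Beta d E * ((A * (F * z powr (d - 1))) / (F * z powr (d + E - 1) / D))"
    proof -
      have a: "pochhammer d k \<le> A * (F * z powr (d - 1))"
        using A(2)[of k] pd by (simp add: pochhammer_of_real F_def z_def)
      have b: "F * z powr (d + E - 1) \<le> D * pochhammer (d + E) k"
        using D(2)[of k] pd unfolding pochhammer_of_real by (simp add: F_def z_def)
      have "F * z powr (d + E - 1) > 0" using F z by simp
      then have D0: "D > 0" using b pd D(1) by (metis less_le mult_zero_left not_less)
      have "F * z powr (d + E - 1) / D \<le> pochhammer (d + E) k" using b D0 by (simp add: field_simps)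
      moreover have "F * z powr (d + E - 1) / D > 0" using F z D0 by simp
      ultimately show ?thesis using a pd A(1) assms
        by (intro mult_left_mono frac_le Beta_nonneg) auto
    qed
    also have "\<dots> = Beta d E * (A * D) * (z powr (d - 1) / z powr (d + E - 1))" using F by simp
    also have "z powr (d - 1) / z powr (d + E - 1) = z powr (- E)" by (simp add: powr_diff[symmetric])
    finally show ?thesis unfolding z_def .
  qed
  moreover have "Beta d E * (A * D) \<ge> 0" using A(1) D(1) assms by (simp add: Beta_nonneg)
  ultimately show ?thesis by blast
qed

lemma summable_hyp_coeff_Beta:
  assumes c: "Re c > 0" and E: "E > 0" and s: "Re (c - a - b) + E > 0"
  shows "summable (\<lambda>k. cmod (hyp_coeff a b c k) * Beta (Re c + real k) E)"
proof -
  obtain A where A: "A \<ge> 0" "\<And>n. cmod (hyp_coeff a b c n) \<le> A * real (n+1) powr (Re (a + b - c) - 1)"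
    using norm_hyp_coeff_le[OF Re_pos_not_nonpos_Int[OF c]] by blast
  obtain B where B: "B \<ge> 0" "\<And>k. Beta (Re c + real k) E \<le> B * real (k+1) powr (- E)"
    using Beta_shift_le[OF c E] by blast
  have "summable (\<lambda>k. A * B * real (k+1) powr (Re (a + b - c) - 1 - E))"
    using s by (intro summable_mult summable_Suc_powr) simp
  then show ?thesis
  proof (rule summable_comparison_test'[where N = 0])
    fix k :: nat
    have b0: "Beta (Re c + real k) E \<ge> 0" using c E by (intro Beta_nonneg) auto
    have "cmod (hyp_coeff a b c k) * Beta (Re c + real k) E \<le> (A * real (k+1) powr (Re (a + b - c) - 1)) * (B * real (k+1) powr (- E))"
      using A B b0 by (intro mult_mono) auto
    also have "\<dots> = A * B * (real (k+1) powr (Re (a + b - c) - 1) * real (k+1) powr (- E))" by simp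
    also have "real (k+1) powr (Re (a + b - c) - 1) * real (k+1) powr (- E) = real (k+1) powr (Re (a + b - c) - 1 - E)"
      by (simp only: powr_add[symmetric] diff_conv_add_uminus)
    finally show "norm (cmod (hyp_coeff a b c k) * Beta (Re c + real k) E) \<le> A * B * real (k+1) powr (Re (a + b - c) - 1 - E)"
      using b0 by (simp add: abs_mult)
  qed
qed

lemma summable_hyp_coeff_power:
  assumes c: "c \<notin> \<int>\<^sub>\<le>\<^sub>0" and v: "0 < v" "v < 1"
  shows "summable (\<lambda>k. cmod (hyp_coeff a b c k) * v ^ k)"
proof -
  obtain A where A: "A \<ge> 0" "\<And>n. cmod (hyp_coeff a b c n) \<le> A * real (n+1) powr (Re (a + b - c) - 1)"
    using norm_hyp_coeff_le[OF c] by blast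
  \<comment> \<open>one factor \<open>w\<^sup>k\<close> absorbs the polynomial growth, the other one gives a geometric series\<close>
  define w where "w = sqrt v"
  have w: "0 < w" "w < 1" "w * w = v" using v by (auto simp: w_def)
  define s where "s = Re (a + b - c) - 1"
  have "(\<lambda>n. real (n+1) powr s * w ^ n) \<longlonglongrightarrow> 0" using w(1,2) by real_asymp
  then have "Bseq (\<lambda>n. real (n+1) powr s * w ^ n)" by (intro convergent_imp_Bseq) (auto simp: convergent_def)
  then obtain B where B: "B > 0" "\<And>n. norm (real (n+1) powr s * w ^ n) \<le> B" by (auto elim: BseqE)
  have "summable (\<lambda>k. A * B * w ^ k)" using w by (intro summable_mult summable_geometric) auto
  then show ?thesis
  proof (rule summable_comparison_test'[where N = 0])
    fix k :: nat
    have "cmod (hyp_coeff a b c k) * v ^ k \<le> A * real (k+1) powr s * v ^ k"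
      using A(2)[of k] v by (intro mult_right_mono) (auto simp: s_def)
    also have "\<dots> = A * (real (k+1) powr s * w ^ k) * w ^ k"
      by (simp add: w(3)[symmetric] power_mult_distrib)
    also have "\<dots> \<le> A * B * w ^ k"
      using B(2)[of k] A(1) w by (intro mult_right_mono mult_left_mono) auto
    finally show "norm (cmod (hyp_coeff a b c k) * v ^ k) \<le> A * B * w ^ k" using v by (simp add: abs_mult)
  qed
qed

text \<open>
  The binomial series of \<open>(1 - v)\<^sup>q\<^sup>-\<^sup>1\<close>, integrated termwise, is the hypergeometric series with parameters
  \<open>1 - q\<close>, \<open>p\<close>, \<open>p + 1\<close> at the point 1, up to the factor \<open>1 / p\<close>. So Gauss's theorem gives the value.
\<close>
lemma complex_Beta_integral:
  assumes p: "Re p > 0" and q: "Re q > 0"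
  shows "(partial_Beta p q 1) = Gamma p * Gamma q * rGamma (p + q)"
proof -
  have np: "p \<notin> \<int>\<^sub>\<le>\<^sub>0" "p + 1 \<notin> \<int>\<^sub>\<le>\<^sub>0" using p by (auto intro!: Re_pos_not_nonpos_Int)
  \<comment> \<open>the binomial coefficients, as hypergeometric coefficients with two equal parameters\<close>
  define A where "A = hyp_coeff (1 - q) p p"
  have A: "A k = pochhammer (1 - q) k / fact k" for k
    using pochhammer_nonzero[OF np(1), of k] by (simp add: A_def hyp_coeff_def)
  have ser: "(\<lambda>k. A k * of_real v ^ k) sums (of_real (1 - v) powr (q - 1))" if "0 < v" "v < 1" for v
  proof -
    have "(\<lambda>k. ((q - 1) gchoose k) * (- of_real v) ^ k) sums (1 + - of_real v) powr (q - 1)"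
      using that by (intro gen_binomial_complex) simp
    moreover have "((q - 1) gchoose k) * (- of_real v) ^ k = A k * of_real v ^ k" for k
    proof -
      have sq: "(-1) ^ k * (-1) ^ k = (1::complex)" by (simp flip: power_mult_distrib)
      have "((q - 1) gchoose k) * (- of_real v) ^ k = ((-1) ^ k * (-1) ^ k) * (pochhammer (- (q - 1)) k / fact k * of_real v ^ k)"
        unfolding gbinomial_pochhammer power_minus[of "of_real v"] by (simp only: divide_inverse mult_ac)
      then show ?thesis unfolding sq A by simp
    qed
    ultimately show ?thesis by simp
  qed
  have sA: "summable (\<lambda>k. cmod (A k) * Beta (Re p + real k) (Re (1::complex)))"
    using summable_hyp_coeff_Beta[of p 1 "1 - q" p] p q by (simp add: A_def)
  have sv: "summable (\<lambda>k. cmod (A k) * v ^ k)" if "0 < v" "v < 1" for v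
    unfolding A_def by (rule summable_hyp_coeff_power[OF np(1) that])
  have lhs: "(LINT v:{0<..<1}|lborel. (\<Sum>k. A k * of_real v ^ k) * beta_kernel p 1 v) = (partial_Beta p q 1)"
  proof (rule set_lebesgue_integral_cong)
    show "\<forall>v. v \<in> {0<..<1} \<longrightarrow> (\<Sum>k. A k * of_real v ^ k) * beta_kernel p 1 v = beta_kernel p q v"
      by (auto simp: beta_kernel_def sums_unique[OF ser, symmetric] complex_eq_iff)
  qed simp
  have one: "(partial_Beta (p + of_nat k) 1 1) = 1 / (p + of_nat k)" for k
  proof -
    have nz: "p + of_nat k \<noteq> 0" using p by (auto simp: complex_eq_iff)
    have bk: "beta_kernel (p + of_nat k) 1 v = of_real v powr (p + of_nat k - 1)" if "v < 1" for v
      using that by (simp add: beta_kernel_def)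
    have "set_integrable lborel {0<..<1} (beta_kernel (p + of_nat k) 1)"
      using p by (intro beta_kernel_integrable) auto
    then have int: "set_integrable lborel {0<..<1} (\<lambda>v. complex_of_real v powr (p + of_nat k - 1))"
      by (rule set_integrable_cong[THEN iffD1, rotated -1]) (auto simp: bk)
    have "(partial_Beta (p + of_nat k) 1 1) = (LINT v:{0<..<1}|lborel. of_real v powr (p + of_nat k - 1))"
      by (rule set_lebesgue_integral_cong) (auto simp: bk)
    also have "\<dots> = (\<lambda>v. of_real v powr (p + of_nat k) / (p + of_nat k)) 1"
    proof (rule fundamental_theorem_vanishing_at_0[where r = "Re p + real k" and C = "1 / cmod (p + of_nat k)"])
      fix v :: real assume v: "0 < v" "v \<le> 1"
      have "((\<lambda>v. of_real v powr (p + of_nat k) / (p + of_nat k)) has_vector_derivative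
         (p + of_nat k) * of_real v powr (p + of_nat k - 1) / (p + of_nat k)) (at v)"
        using v by (intro has_vector_derivative_divide powr_has_vector_derivative)
      then show "((\<lambda>v. of_real v powr (p + of_nat k) / (p + of_nat k)) has_vector_derivative
         of_real v powr (p + of_nat k - 1)) (at v)"
        using nz v by simp
      show "norm (of_real v powr (p + of_nat k) / (p + of_nat k)) \<le> 1 / cmod (p + of_nat k) * v powr (Re p + real k)"
        using v by (simp add: norm_divide norm_powr_real_powr)
    qed (use p int in auto)
    finally show ?thesis by simp
  qed
  have "(\<lambda>k. A k * (1 / (p + of_nat k))) sums (partial_Beta p q 1)"
    using power_series_beta_kernel_sums[of p 1 1 A] p sA sv unfolding lhs one by simp
  moreover have "A k * (1 / (p + of_nat k)) = hyp_coeff (1 - q) p (p + 1) k / p" for k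
  proof -
    have nz: "p \<noteq> 0" "p + of_nat k \<noteq> 0" using p by (auto simp: complex_eq_iff)
    have "p * pochhammer (p + 1) k = pochhammer p k * (p + of_nat k)"
      by (metis pochhammer_Suc pochhammer_rec)
    then have e: "pochhammer p k = p * pochhammer (p + 1) k / (p + of_nat k)" using nz by (simp add: field_simps)
    show ?thesis unfolding A unfolding hyp_coeff_def e using nz pochhammer_nonzero[OF np(2), of k] by (simp add: divide_simps)
  qed
  moreover have "(\<lambda>k. hyp_coeff (1 - q) p (p + 1) k / p) sums
      (Gamma (p + 1) * Gamma (p + 1 - (1 - q) - p) * rGamma (p + 1 - (1 - q)) * rGamma (p + 1 - p) / p)"
    using p q by (intro sums_divide Gauss_hypergeometric_sum) auto
  ultimately have "(partial_Beta p q 1) =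
     Gamma (p + 1) * Gamma (p + 1 - (1 - q) - p) * rGamma (p + 1 - (1 - q)) * rGamma (p + 1 - p) / p"
    by (metis (no_types, lifting) ext sums_unique2)
  also have "\<dots> = Gamma p * Gamma q * rGamma (p + q)"
  proof -
    have "p \<noteq> 0" "Gamma (p + 1) = p * Gamma p" using p Re_pos_not_nonpos_Int[OF p] by (auto simp: Gamma_plus1 complex_eq_iff)
    moreover have "p + 1 - (1 - q) - p = q" "p + 1 - (1 - q) = p + q" "p + 1 - p = 1" by simp_all
    ultimately show ?thesis by simp
  qed
  finally show ?thesis .
qed

section \<open>Partial integrals of the hypergeometric kernel\<close>

lemma Beta_raise_exponents:
  assumes "P > 0" "E > (0::real)"
  shows "P * Beta P (E + 1) = E * Beta (P + 1) E"
proof -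
  have "Gamma (P + 1) = P * Gamma P" "Gamma (E + 1) = E * Gamma E"
    using assms by (intro Gamma_plus1; auto elim!: nonpos_Ints_cases)+
  then show ?thesis by (simp add: Beta_def add_ac)
qed

text \<open>
  The left side is the integral of the derivative of \<open>v\<^sup>P (1 - v)\<^sup>E\<close>. Its positive part contributes at most the
  Beta integral.
\<close>
lemma powr_boundary_le_Beta:
  fixes P E u :: real
  assumes "P > 0" "E > 0" "0 < u" "u < 1"
  shows "u powr P * (1 - u) powr E \<le> P * Beta P (E + 1)"
proof -
  have i1: "set_integrable lborel {0<..<u} (\<lambda>v. P * (v powr (P - 1) * (1 - v) powr (E + 1 - 1)))"
    using assms by (intro set_integrable_mult_right real_beta_kernel_integrable) auto
  have i2: "set_integrable lborel {0<..<u} (\<lambda>v. E * (v powr (P + 1 - 1) * (1 - v) powr (E - 1)))"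
    using assms by (intro set_integrable_mult_right real_beta_kernel_integrable) auto
  have "(LINT v:{0<..<u}|lborel. P * (v powr (P - 1) * (1 - v) powr (E + 1 - 1)) - E * (v powr (P + 1 - 1) * (1 - v) powr (E - 1)))
     = (\<lambda>v. v powr P * (1 - v) powr E) u"
  proof (rule fundamental_theorem_vanishing_at_0[where r = P and C = 1])
    fix v :: real assume v: "0 < v" "v \<le> u"
    have "((\<lambda>v. v powr P * (1 - v) powr E) has_real_derivative
        P * (v powr (P - 1) * (1 - v) powr (E + 1 - 1)) - E * (v powr (P + 1 - 1) * (1 - v) powr (E - 1))) (at v)"
      using v assms by (auto intro!: derivative_eq_intros)
    then show "((\<lambda>v. v powr P * (1 - v) powr E) has_vector_derivative
        P * (v powr (P - 1) * (1 - v) powr (E + 1 - 1)) - E * (v powr (P + 1 - 1) * (1 - v) powr (E - 1))) (at v)"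
      by (simp add: has_real_derivative_iff_has_vector_derivative)
    have "(1 - v) powr E \<le> 1 powr E" using v assms by (intro powr_mono2) auto
    then show "norm (v powr P * (1 - v) powr E) \<le> 1 * v powr P"
      by (simp add: abs_mult mult_left_le)
  qed (use assms i1 i2 in auto)
  then have "u powr P * (1 - u) powr E = P * (LINT v:{0<..<u}|lborel. v powr (P - 1) * (1 - v) powr (E + 1 - 1))
     - E * (LINT v:{0<..<u}|lborel. v powr (P + 1 - 1) * (1 - v) powr (E - 1))"
    unfolding set_integral_diff(2)[OF i1 i2] set_integral_mult_right by simp
  also have "\<dots> \<le> P * (LINT v:{0<..<u}|lborel. v powr (P - 1) * (1 - v) powr (E + 1 - 1))"
    using assms by (simp add: set_lebesgue_integral_def integral_nonneg_AE)
  also have "\<dots> \<le> P * Beta P (E + 1)"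
    using assms by (intro mult_left_mono real_beta_kernel_integral_le) auto
  finally show ?thesis .
qed

text \<open>
  Integration by parts moves the factor \<open>q\<close>, the derivative of \<open>(1 - v)\<^sup>q\<close>, onto the power of \<open>v\<close>, so that the
  bound depends on \<open>q\<close> through its real part only. This treats every term of the hypergeometric series
  except the first one, where \<open>v\<close> has an exponent with possibly negative real part.
\<close>
lemma beta_kernel_partial_integral_bound:
  assumes p: "Re p > 0" and q: "Re q > 0" and u: "0 < u" "u < 1"
  shows "cmod (q * (partial_Beta (p + 1) q u)) \<le> (1 + cmod p / Re p) * (Re q * Beta (Re p + 1) (Re q))"
proof -
  have i1: "set_integrable lborel {0<..<u} (\<lambda>v. p * beta_kernel p (q + 1) v)"
    using assms by (intro set_integrable_mult_right beta_kernel_integrable) auto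
  have i2: "set_integrable lborel {0<..<u} (\<lambda>v. q * beta_kernel (p + 1) q v)"
    using assms by (intro set_integrable_mult_right beta_kernel_integrable) auto
  have "(LINT v:{0<..<u}|lborel. p * beta_kernel p (q + 1) v - q * beta_kernel (p + 1) q v)
     = (\<lambda>v. of_real v powr p * of_real (1 - v) powr q) u"
  proof (rule fundamental_theorem_vanishing_at_0[where r = "Re p" and C = 1])
    fix v :: real assume v: "0 < v" "v \<le> u"
    have "((\<lambda>v. of_real v powr p * of_real (1 - v) powr q) has_vector_derivative
        of_real v powr p * (- q * of_real (1 - v) powr (q - 1)) + (p * of_real v powr (p - 1)) * of_real (1 - v) powr q) (at v)"
      using v u by (intro has_vector_derivative_mult powr_has_vector_derivative one_minus_powr_has_vector_derivative) auto
    then show "((\<lambda>v. of_real v powr p * of_real (1 - v) powr q) has_vector_derivative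
        p * beta_kernel p (q + 1) v - q * beta_kernel (p + 1) q v) (at v)"
      by (simp add: beta_kernel_def algebra_simps)
    have "(1 - v) powr Re q \<le> 1 powr Re q" using v u q by (intro powr_mono2) auto
    moreover have "norm (of_real v powr p * of_real (1 - v) powr q) = v powr Re p * (1 - v) powr Re q"
      using v u unfolding norm_mult by (subst (1 2) norm_powr_real_powr) auto
    ultimately show "norm (of_real v powr p * of_real (1 - v) powr q) \<le> 1 * v powr Re p"
      by (simp add: mult_left_le)
  qed (use assms i1 i2 in auto)
  then have "q * (partial_Beta (p + 1) q u) = p * (partial_Beta p (q + 1) u)
     - of_real u powr p * of_real (1 - u) powr q"
    unfolding set_integral_diff(2)[OF i1 i2] set_integral_mult_right by (simp add: algebra_simps)
  then have "cmod (q * (partial_Beta (p + 1) q u)) =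
      cmod (p * (partial_Beta p (q + 1) u) - of_real u powr p * of_real (1 - u) powr q)"
    by (rule arg_cong)
  also have "\<dots> \<le> cmod (p * (partial_Beta p (q + 1) u)) + cmod (of_real u powr p * of_real (1 - u) powr q)"
    by (rule norm_triangle_ineq4)
  finally have main: "cmod (q * (partial_Beta (p + 1) q u)) \<le>
      cmod (p * (partial_Beta p (q + 1) u)) + cmod (of_real u powr p * of_real (1 - u) powr q)" .
  have "cmod (of_real u powr p * of_real (1 - u) powr q) = u powr Re p * (1 - u) powr Re q"
    using u unfolding norm_mult by (subst (1 2) norm_powr_real_powr) auto
  then have b2: "cmod (of_real u powr p * of_real (1 - u) powr q) \<le> Re p * Beta (Re p) (Re q + 1)"
    using powr_boundary_le_Beta[OF p q u] by simp
  have b1: "cmod (p * (partial_Beta p (q + 1) u)) \<le> cmod p * Beta (Re p) (Re q + 1)"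
    using norm_beta_kernel_integral_le[of p "q + 1" u] assms unfolding norm_mult by (intro mult_left_mono) auto
  have "cmod p * Beta (Re p) (Re q + 1) + Re p * Beta (Re p) (Re q + 1) = (1 + cmod p / Re p) * (Re p * Beta (Re p) (Re q + 1))"
    using p by (simp add: field_simps)
  then show ?thesis unfolding Beta_raise_exponents[OF p q, symmetric] using main b1 b2 by linarith
qed

lemma norm_diff_le_of_vector_derivative_bound:
  fixes f :: "real \<Rightarrow> 'a::real_normed_vector"
  assumes "convex S" "\<And>x. x \<in> S \<Longrightarrow> (f has_vector_derivative f' x) (at x within S)"
    and "\<And>x. x \<in> S \<Longrightarrow> norm (f' x) \<le> B" "x \<in> S" "y \<in> S"
  shows "norm (f x - f y) \<le> B * norm (x - y)"
proof (rule differentiable_bound[where f' = "\<lambda>x h. h *\<^sub>R f' x" and S = S])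
  fix s assume "s \<in> S"
  then show "(f has_derivative (\<lambda>h. h *\<^sub>R f' s)) (at s within S)" "onorm (\<lambda>h. h *\<^sub>R f' s) \<le> B"
    using assms(2,3) by (auto simp: has_vector_derivative_def mult.commute[of B] intro!: onorm_le mult_left_mono)
qed (use assms in auto)

text \<open>
  Interpolation between the trivial bound 2 and the bound by \<open>|q| v\<close> that the derivative gives. For
  \<open>v > 1/2\<close> the derivative may be unbounded, but there \<open>|q| v \<ge> Re q / 2\<close>, and the trivial bound suffices.
\<close>
lemma one_minus_powr_minus_1_bound:
  assumes q: "Re q > 0" and k: "0 \<le> \<kappa>" "\<kappa> \<le> 1" and v: "0 < v" "v < 1"
  shows "cmod (of_real (1 - v) powr q - 1) \<le> (2 * 2 powr \<bar>Re q - 1\<bar> + 2 * (2 / Re q) powr \<kappa>) * (cmod q * v) powr \<kappa>"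
proof (cases "v \<le> 1/2")
  case True
  define M where "M = 2 powr \<bar>Re q - 1\<bar>"
  have M1: "M \<ge> 1" unfolding M_def by (simp add: ge_one_powr_ge_zero)
  have two: "cmod (of_real (1 - v) powr q - 1) \<le> 2"
  proof -
    have "(1 - v) powr Re q \<le> 1 powr Re q" using v q by (intro powr_mono2) auto
    then have "cmod (of_real (1 - v) powr q) \<le> 1" using v by (subst norm_powr_real_powr) auto
    then show ?thesis using norm_triangle_ineq4[of "of_real (1 - v) powr q" 1] by simp
  qed
  have "norm ((of_real (1 - v) powr q) - (of_real (1 - 0) powr q)) \<le> (cmod q * M) * norm (v - 0)"
  proof (rule norm_diff_le_of_vector_derivative_bound[of "{0..v}" "\<lambda>v. of_real (1 - v) powr q" "\<lambda>v. - q * of_real (1 - v) powr (q - 1)"])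
    fix s assume s: "s \<in> {0..v}"
    then show "((\<lambda>v. complex_of_real (1 - v) powr q) has_vector_derivative - q * of_real (1 - s) powr (q - 1)) (at s within {0..v})"
      using v True by (intro has_vector_derivative_at_within[OF one_minus_powr_has_vector_derivative]) simp
    have s2: "1/2 \<le> 1 - s" "1 - s \<le> 1" using s True by auto
    have "(1 - s) powr (Re q - 1) \<le> M"
    proof (cases "Re q \<ge> 1")
      case True
      then have "(1 - s) powr (Re q - 1) \<le> 1 powr (Re q - 1)" using s2 by (intro powr_mono2) auto
      then show ?thesis using M1 by simp
    next
      case False
      then have "(1 - s) powr (Re q - 1) \<le> (1/2) powr (Re q - 1)" using s2 by (intro powr_mono2') auto
      also have "\<dots> = 2 powr (- (Re q - 1))" unfolding powr_minus_divide by (simp only: powr_divide powr_one_eq_one)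
      also have "- (Re q - 1) = \<bar>Re q - 1\<bar>" using False by simp
      finally have "(1 - s) powr (Re q - 1) \<le> 2 powr \<bar>Re q - 1\<bar>" .
      then show ?thesis unfolding M_def .
    qed
    then show "norm (- q * of_real (1 - s) powr (q - 1)) \<le> cmod q * M"
      using s2 unfolding norm_mult norm_minus_cancel by (subst norm_powr_real_powr) (auto intro!: mult_left_mono)
  qed (use v in auto)
  then have one: "cmod (of_real (1 - v) powr q - 1) \<le> M * (cmod q * v)" using v by (simp add: mult_ac)
  define x where "x = cmod q * v"
  have x: "x > 0" using q v unfolding x_def by (intro mult_pos_pos) auto
  have "cmod (of_real (1 - v) powr q - 1) \<le> 2 * M * x powr \<kappa>"
  proof (cases "x \<le> 1")
    case True
    then have "x powr 1 \<le> x powr \<kappa>" using x k by (intro powr_mono') auto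
    then have "M * x \<le> M * x powr \<kappa>" using x M1 by simp
    moreover have "0 \<le> M * x powr \<kappa>" using M1 by simp
    ultimately show ?thesis using one unfolding x_def[symmetric] by linarith
  next
    case False
    then have "1 \<le> x powr \<kappa>" using k by (simp add: ge_one_powr_ge_zero)
    then have "1 * 1 \<le> M * x powr \<kappa>" using M1 by (intro mult_mono) auto
    then show ?thesis using two by simp
  qed
  also have "\<dots> \<le> (2 * M + 2 * (2 / Re q) powr \<kappa>) * x powr \<kappa>" by (intro mult_right_mono) auto
  finally show ?thesis unfolding M_def x_def .
next
  case False
  have "(1 - v) powr Re q \<le> 1 powr Re q" using v q by (intro powr_mono2) auto
  then have "cmod (of_real (1 - v) powr q) \<le> 1" using v by (subst norm_powr_real_powr) auto
  then have two: "cmod (of_real (1 - v) powr q - 1) \<le> 2" using norm_triangle_ineq4[of "of_real (1 - v) powr q" 1] by simp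
  have "Re q / 2 = Re q * (1/2)" by simp
  also have "\<dots> \<le> cmod q * v" using False q complex_Re_le_cmod[of q] by (intro mult_mono) auto
  finally have "1 \<le> 2 / Re q * (cmod q * v)" using q by (simp add: field_simps)
  then have "1 \<le> (2 / Re q * (cmod q * v)) powr \<kappa>" using k by (simp add: ge_one_powr_ge_zero)
  also have "\<dots> = (2 / Re q) powr \<kappa> * (cmod q * v) powr \<kappa>" using q v by (subst powr_mult) auto
  finally have "2 \<le> 2 * (2 / Re q) powr \<kappa> * (cmod q * v) powr \<kappa>" by simp
  also have "\<dots> \<le> (2 * 2 powr \<bar>Re q - 1\<bar> + 2 * (2 / Re q) powr \<kappa>) * (cmod q * v) powr \<kappa>" by (intro mult_right_mono) auto
  finally show ?thesis using two by linarith
qed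

text \<open>
  The first term of the series. Here one integrates by parts with \<open>(1 - v)\<^sup>q - 1\<close>, which vanishes at 0, in place
  of \<open>(1 - v)\<^sup>q\<close>; its Hoelder bound of order \<open>\<kappa>\<close> compensates the singularity \<open>v\<^sup>p\<^sup>-\<^sup>2\<close> at the price of \<open>|q|\<^sup>\<kappa>\<close>.
\<close>
lemma beta_kernel_singular_integral_bound:
  assumes p: "Re p > 0" and E: "E > 0" and k: "0 \<le> \<kappa>" "\<kappa> \<le> 1" "Re p + \<kappa> > 1"
  shows "\<exists>K\<ge>0. \<forall>q u. Re q = E \<longrightarrow> 0 < u \<longrightarrow> u < 1 \<longrightarrow>
     cmod (q * (partial_Beta p q u)) \<le> K * cmod q powr \<kappa>"
proof -
  define K0 where "K0 = 2 * 2 powr \<bar>E - 1\<bar> + 2 * (2 / E) powr \<kappa>"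
  have K0: "K0 \<ge> 0" by (simp add: K0_def)
  define r where "r = Re p + \<kappa> - 1"
  have r: "r > 0" using k by (simp add: r_def)
  have "cmod (q * (partial_Beta p q u)) \<le> (cmod (p - 1) * K0 * Beta r 1 + K0) * cmod q powr \<kappa>"
    if q: "Re q = E" and u: "0 < u" "u < 1" for q u
  proof -
    define Q where "Q = cmod q powr \<kappa>"
    define \<phi> where "\<phi> = (\<lambda>v. complex_of_real (1 - v) powr q - 1)"
    have \<phi>: "cmod (\<phi> v) \<le> K0 * Q * v powr \<kappa>" if "0 < v" "v < 1" for v
      using one_minus_powr_minus_1_bound[of q \<kappa> v] q E k that
      by (simp add: \<phi>_def K0_def Q_def powr_mult mult.assoc)
    have nv: "cmod (of_real v powr z * \<phi> v) \<le> K0 * Q * v powr (Re z + \<kappa>)" if "0 < v" "v < 1" for v z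
    proof -
      have "cmod (of_real v powr z * \<phi> v) = v powr Re z * cmod (\<phi> v)"
        unfolding norm_mult using that by (subst norm_powr_real_powr) auto
      also have "\<dots> \<le> v powr Re z * (K0 * Q * v powr \<kappa>)" using \<phi>[OF that] by (intro mult_left_mono) auto
      finally show ?thesis by (simp add: powr_add mult_ac)
    qed
    have ir: "set_integrable lborel {0<..<u} (\<lambda>v. K0 * Q * (v powr (r - 1) * (1 - v) powr (1 - 1)))"
      using r u by (intro set_integrable_mult_right real_beta_kernel_integrable) auto
    have i1: "set_integrable lborel {0<..<u} (\<lambda>v. of_real v powr (p - 2) * \<phi> v)"
    proof (rule set_integrable_bound[OF ir set_borel_measurable_Ioo])
      show "continuous_on {0<..<1} (\<lambda>v. complex_of_real v powr (p - 2) * \<phi> v)"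
        unfolding \<phi>_def by (intro continuous_intros) (auto simp: complex_nonpos_Reals_iff)
      show "AE v in lborel. v \<in> {0<..<u} \<longrightarrow> norm (of_real v powr (p - 2) * \<phi> v) \<le> norm (K0 * Q * (v powr (r - 1) * (1 - v) powr (1 - 1)))"
      proof (intro AE_I2 impI)
        fix v assume v: "v \<in> {0<..<u}"
        then have "norm (of_real v powr (p - 2) * \<phi> v) \<le> K0 * Q * v powr (r - 1)"
          using nv[of v "p - 2"] u by (simp add: r_def algebra_simps)
        also have "\<dots> \<le> norm (K0 * Q * (v powr (r - 1) * (1 - v) powr (1 - 1)))" using v u by simp
        finally show "norm (of_real v powr (p - 2) * \<phi> v) \<le> norm (K0 * Q * (v powr (r - 1) * (1 - v) powr (1 - 1)))" .
      qed
    qed (use u in auto)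
    have i1': "set_integrable lborel {0<..<u} (\<lambda>v. (p - 1) * (of_real v powr (p - 2) * \<phi> v))"
      using i1 by (intro set_integrable_mult_right)
    have i2: "set_integrable lborel {0<..<u} (\<lambda>v. q * beta_kernel p q v)"
      using p q E u by (intro set_integrable_mult_right beta_kernel_integrable) auto
    have "(LINT v:{0<..<u}|lborel. (p - 1) * (of_real v powr (p - 2) * \<phi> v) - q * beta_kernel p q v)
       = (\<lambda>v. of_real v powr (p - 1) * \<phi> v) u"
    proof (rule fundamental_theorem_vanishing_at_0[where r = r and C = "K0 * Q"])
      fix v :: real assume v: "0 < v" "v \<le> u"
      have "((\<lambda>v. of_real v powr (p - 1) * \<phi> v) has_vector_derivative
          of_real v powr (p - 1) * (- q * of_real (1 - v) powr (q - 1) - 0) + ((p - 1) * of_real v powr (p - 1 - 1)) * \<phi> v) (at v)"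
        unfolding \<phi>_def using v u
        by (intro has_vector_derivative_mult powr_has_vector_derivative has_vector_derivative_diff
            one_minus_powr_has_vector_derivative has_vector_derivative_const) auto
      then show "((\<lambda>v. of_real v powr (p - 1) * \<phi> v) has_vector_derivative
          (p - 1) * (of_real v powr (p - 2) * \<phi> v) - q * beta_kernel p q v) (at v)"
        by (simp add: beta_kernel_def algebra_simps)
      show "norm (of_real v powr (p - 1) * \<phi> v) \<le> K0 * Q * v powr r"
        using nv[of v "p - 1"] v u by (simp add: r_def algebra_simps)
    qed (use u r i1' i2 in auto)
    then have "q * (partial_Beta p q u) = (p - 1) * (LINT v:{0<..<u}|lborel. of_real v powr (p - 2) * \<phi> v)
        - of_real u powr (p - 1) * \<phi> u"
      unfolding set_integral_diff(2)[OF i1' i2] set_integral_mult_right by (simp add: algebra_simps)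
    then have "cmod (q * (partial_Beta p q u)) =
        cmod ((p - 1) * (LINT v:{0<..<u}|lborel. of_real v powr (p - 2) * \<phi> v) - of_real u powr (p - 1) * \<phi> u)"
      by (rule arg_cong)
    also have "\<dots> \<le> cmod (p - 1) * cmod (LINT v:{0<..<u}|lborel. of_real v powr (p - 2) * \<phi> v) + cmod (of_real u powr (p - 1) * \<phi> u)"
      unfolding norm_mult[of "p - 1", symmetric] by (rule norm_triangle_ineq4)
    finally have main: "cmod (q * (partial_Beta p q u)) \<le>
      cmod (p - 1) * cmod (LINT v:{0<..<u}|lborel. of_real v powr (p - 2) * \<phi> v) + cmod (of_real u powr (p - 1) * \<phi> u)" .
    have b2: "cmod (of_real u powr (p - 1) * \<phi> u) \<le> K0 * Q"
    proof -
      have "u powr r \<le> 1 powr r" using u r by (intro powr_mono2) auto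
      then have "K0 * Q * u powr r \<le> K0 * Q * 1" using K0 by (intro mult_left_mono) (auto simp: Q_def)
      then show ?thesis using nv[of u "p - 1"] u by (simp add: r_def algebra_simps)
    qed
    have b1: "cmod (LINT v:{0<..<u}|lborel. of_real v powr (p - 2) * \<phi> v) \<le> K0 * Q * Beta r 1"
    proof -
      have "cmod (LINT v:{0<..<u}|lborel. of_real v powr (p - 2) * \<phi> v) \<le> (LINT v:{0<..<u}|lborel. K0 * Q * (v powr (r - 1) * (1 - v) powr (1 - 1)))"
        by (rule set_integral_norm_le[OF i1 ir]) (use nv[of _ "p - 2"] u in \<open>simp add: r_def algebra_simps\<close>)
      also have "\<dots> \<le> K0 * Q * Beta r 1"
        unfolding set_integral_mult_right using K0 u r by (intro mult_left_mono real_beta_kernel_integral_le) (auto simp: Q_def)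
      finally show ?thesis .
    qed
    have "cmod (p - 1) * cmod (LINT v:{0<..<u}|lborel. of_real v powr (p - 2) * \<phi> v) \<le> cmod (p - 1) * (K0 * Q * Beta r 1)"
      using b1 by (rule mult_left_mono) simp
    moreover have "cmod (p - 1) * (K0 * Q * Beta r 1) + K0 * Q = (cmod (p - 1) * K0 * Beta r 1 + K0) * Q"
      by (simp add: algebra_simps)
    ultimately show ?thesis using main b2 unfolding Q_def by linarith
  qed
  moreover have "cmod (p - 1) * K0 * Beta r 1 + K0 \<ge> 0" using K0 r by (simp add: Beta_nonneg)
  ultimately show ?thesis by blast
qed

definition hyp_series :: "complex \<Rightarrow> complex \<Rightarrow> complex \<Rightarrow> complex \<Rightarrow> complex" where
  "hyp_series a b c z = (\<Sum>k. hyp_coeff a b c k * z ^ k)"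

lemma hyp_series_holomorphic:
  assumes c: "c \<notin> \<int>\<^sub>\<le>\<^sub>0"
  shows "hyp_series a b c holomorphic_on ball 0 1"
proof (rule power_series_holomorphic[where a = "hyp_coeff a b c"])
  fix w :: complex assume w: "w \<in> ball 0 1"
  define v where "v = (1 + cmod w) / 2"
  have v: "0 < v" "v < 1" "cmod w < v" using w by (auto simp: v_def intro: add_pos_nonneg)
  have "summable (\<lambda>k. cmod (hyp_coeff a b c k * w ^ k))"
    by (rule summable_comparison_test'[where N = 0, OF summable_hyp_coeff_power[OF c v(1,2), of a b]])
      (use v in \<open>auto simp: norm_mult norm_power intro!: mult_left_mono power_mono\<close>)
  then show "(\<lambda>n. hyp_coeff a b c n * (w - 0) ^ n) sums hyp_series a b c w"
    using summable_norm_cancel unfolding hyp_series_def by (auto intro!: summable_sums)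
qed

text \<open>
  The integrand of the Saigo integral of a power in the variable \<open>v = 1 - x / t\<close>, up to a power of \<open>x\<close>;
  see \<open>saigo_kernel_substitution\<close> below.
\<close>
definition hyp_kernel :: "complex \<Rightarrow> complex \<Rightarrow> complex \<Rightarrow> complex \<Rightarrow> real \<Rightarrow> complex" where
  "hyp_kernel a b c q v = hyp_series a b c (of_real v) * beta_kernel c q v"

abbreviation hyp_integral :: "complex \<Rightarrow> complex \<Rightarrow> complex \<Rightarrow> complex \<Rightarrow> real \<Rightarrow> complex" where
  "hyp_integral a b c q u \<equiv> (LINT v:{0<..<u}|lborel. hyp_kernel a b c q v)"

lemma continuous_on_hyp_series_of_real:
  assumes c: "c \<notin> \<int>\<^sub>\<le>\<^sub>0"
  shows "continuous_on {0<..<1} (\<lambda>v. hyp_series a b c (of_real v))"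
  by (rule continuous_on_compose2[OF holomorphic_on_imp_continuous_on[OF hyp_series_holomorphic[OF c]]])
    (auto intro!: continuous_intros)

lemma continuous_on_hyp_kernel:
  assumes c: "c \<notin> \<int>\<^sub>\<le>\<^sub>0"
  shows "continuous_on {0<..<1} (hyp_kernel a b c q)"
  unfolding hyp_kernel_def
  by (intro continuous_on_mult continuous_on_hyp_series_of_real[OF c] continuous_on_beta_kernel)

context
  fixes a b c :: complex and E :: real
  assumes c: "Re c > 0" and E: "E > 0" and s: "Re (c - a - b) + E > 0"
begin

lemma hyp_kernel_integrable:
  assumes "Re q = E" "u \<le> 1"
  shows "set_integrable lborel {0<..<u} (hyp_kernel a b c q)"
  unfolding hyp_kernel_def hyp_series_def
  by (rule power_series_beta_kernel_integrable)
    (use assms c E s summable_hyp_coeff_Beta[OF c E s] summable_hyp_coeff_power[OF Re_pos_not_nonpos_Int[OF c]] in auto)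

lemma hyp_kernel_sums:
  assumes "Re q = E" "u \<le> 1"
  shows "(\<lambda>k. hyp_coeff a b c k * (partial_Beta (c + of_nat k) q u)) sums
       (hyp_integral a b c q u)"
  unfolding hyp_kernel_def hyp_series_def
  by (rule power_series_beta_kernel_sums)
    (use assms c E s summable_hyp_coeff_Beta[OF c E s] summable_hyp_coeff_power[OF Re_pos_not_nonpos_Int[OF c]] in auto)

text \<open>
  Termwise integration replaces \<open>(c)\<^sub>k\<close> by \<open>(c + q)\<^sub>k\<close> in the denominators, which leaves a hypergeometric series
  at the point 1.
\<close>
lemma hyp_kernel_integral:
  assumes q: "Re q = E"
  shows "(hyp_integral a b c q 1) =
     Gamma c * Gamma q * Gamma (c + q - a - b) * rGamma (c + q - a) * rGamma (c + q - b)"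
proof -
  have np: "c \<notin> \<int>\<^sub>\<le>\<^sub>0" "c + q \<notin> \<int>\<^sub>\<le>\<^sub>0" using c q E by (auto intro!: Re_pos_not_nonpos_Int)
  have "hyp_coeff a b c k * (partial_Beta (c + of_nat k) q 1) =
     Gamma c * Gamma q * rGamma (c + q) * hyp_coeff a b (c + q) k" for k
  proof -
    have "(partial_Beta (c + of_nat k) q 1) = Gamma (c + of_nat k) * Gamma q * rGamma (c + q + of_nat k)"
      using c q E by (subst complex_Beta_integral) (auto simp: add_ac)
    also have "Gamma (c + of_nat k) = pochhammer c k * Gamma c"
      using pochhammer_Gamma[OF np(1), of k] np by (simp add: Gamma_eq_zero_iff)
    also have "rGamma (c + q + of_nat k) = rGamma (c + q) / pochhammer (c + q) k"
      using pochhammer_rGamma[of "c + q" k] pochhammer_nonzero[OF np(2), of k] by (simp add: field_simps)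
    finally show ?thesis using pochhammer_nonzero[OF np(1), of k]
      by (simp add: hyp_coeff_def divide_simps)
  qed
  then have "(\<lambda>k. Gamma c * Gamma q * rGamma (c + q) * hyp_coeff a b (c + q) k) sums (hyp_integral a b c q 1)"
    using hyp_kernel_sums[OF q order_refl] by simp
  moreover have "(\<lambda>k. Gamma c * Gamma q * rGamma (c + q) * hyp_coeff a b (c + q) k) sums
     (Gamma c * Gamma q * rGamma (c + q) * (Gamma (c + q) * Gamma (c + q - a - b) * rGamma (c + q - a) * rGamma (c + q - b)))"
    using c q E s by (intro sums_mult Gauss_hypergeometric_sum) auto
  ultimately have "(hyp_integral a b c q 1) =
    Gamma c * Gamma q * rGamma (c + q) * (Gamma (c + q) * Gamma (c + q - a - b) * rGamma (c + q - a) * rGamma (c + q - b))"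
    by (rule sums_unique2)
  also have "\<dots> = Gamma c * Gamma q * (rGamma (c + q) * Gamma (c + q)) * Gamma (c + q - a - b) * rGamma (c + q - a) * rGamma (c + q - b)"
    by (simp only: mult_ac)
  also have "rGamma (c + q) * Gamma (c + q) = 1" using np by (simp add: rGamma_inverse_Gamma Gamma_eq_zero_iff)
  finally show ?thesis by simp
qed

text \<open>
  This uniform bound is what makes dominated convergence possible. Only the first term of the series
  contributes the growth \<open>|q|\<^sup>\<kappa>\<close>; the remaining terms are bounded independently of \<open>Im q\<close>, with a sum that
  converges like the one for the absolute integral.
\<close>
lemma hyp_kernel_partial_integral_bound:
  assumes k: "0 \<le> \<kappa>" "\<kappa> \<le> 1" "Re c + \<kappa> > 1"
  shows "\<exists>K\<ge>0. \<forall>q u. Re q = E \<longrightarrow> 0 < u \<longrightarrow> u < 1 \<longrightarrow>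
     cmod (q * (hyp_integral a b c q u)) \<le> K * (1 + cmod q powr \<kappa>)"
proof -
  obtain K where K: "K \<ge> 0" "\<And>q u. Re q = E \<Longrightarrow> 0 < u \<Longrightarrow> u < 1 \<Longrightarrow>
     cmod (q * (partial_Beta c q u)) \<le> K * cmod q powr \<kappa>"
    using beta_kernel_singular_integral_bound[OF c E k] by blast
  define D where "D = 2 + \<bar>Im c\<bar> / Re c"
  have D: "D \<ge> 0" using c by (simp add: D_def)
  define S where "S = (\<Sum>k. cmod (hyp_coeff a b c k) * Beta (Re c + real k) E)"
  have S: "S \<ge> 0" unfolding S_def using c E
    by (intro suminf_nonneg summable_hyp_coeff_Beta c E s mult_nonneg_nonneg Beta_nonneg) auto
  have "cmod (q * (hyp_integral a b c q u)) \<le> (D * E * S + K) * (1 + cmod q powr \<kappa>)"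
    if q: "Re q = E" and u: "0 < u" "u < 1" for q u
  proof -
    define R where "R = (\<lambda>k. partial_Beta (c + of_nat k) q u)"
    define M where "M = (\<lambda>k. D * E * (cmod (hyp_coeff a b c k) * Beta (Re c + real k) E) + (if k = 0 then K * cmod q powr \<kappa> else 0))"
    have Ms: "M sums (D * E * S + K * cmod q powr \<kappa>)"
      unfolding M_def S_def using sums_If_finite_set[of "{0::nat}" "\<lambda>_. K * cmod q powr \<kappa>"]
      by (intro sums_add sums_mult summable_sums summable_hyp_coeff_Beta c E s) simp
    have "(\<lambda>k. q * (hyp_coeff a b c k * R k)) sums (q * (hyp_integral a b c q u))"
      unfolding R_def using q u by (intro sums_mult hyp_kernel_sums) auto
    moreover have "cmod (q * (hyp_coeff a b c k * R k)) \<le> M k" for k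
    proof (cases k)
      case 0
      have "cmod (q * R 0) \<le> K * cmod q powr \<kappa>" using K(2)[OF q u] by (simp add: R_def)
      moreover have "0 \<le> D * E * (cmod (hyp_coeff a b c 0) * Beta (Re c + real 0) E)"
        using D E c by (intro mult_nonneg_nonneg Beta_nonneg) auto
      ultimately show ?thesis using 0 by (simp add: M_def hyp_coeff_def)
    next
      case (Suc j)
      have p: "Re (c + of_nat j) > 0" using c by simp
      have "cmod (q * (partial_Beta (c + of_nat j + 1) q u)) \<le>
          (1 + cmod (c + of_nat j) / Re (c + of_nat j)) * (Re q * Beta (Re (c + of_nat j) + 1) (Re q))"
        using q E u by (intro beta_kernel_partial_integral_bound p) auto
      also have "\<dots> \<le> D * (E * Beta (Re c + real k) E)"
      proof -
        have "cmod (c + of_nat j) \<le> Re (c + of_nat j) + \<bar>Im c\<bar>"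
          using cmod_le[of "c + of_nat j"] p by simp
        then have "cmod (c + of_nat j) / Re (c + of_nat j) \<le> 1 + \<bar>Im c\<bar> / Re (c + of_nat j)"
          using p divide_right_mono[of "cmod (c + of_nat j)" "Re (c + of_nat j) + \<bar>Im c\<bar>" "Re (c + of_nat j)"]
          by (simp add: add_divide_distrib)
        also have "\<bar>Im c\<bar> / Re (c + of_nat j) \<le> \<bar>Im c\<bar> / Re c"
          using c by (intro divide_left_mono) auto
        finally have "1 + cmod (c + of_nat j) / Re (c + of_nat j) \<le> D" by (simp add: D_def)
        then show ?thesis using q E c
          by (intro mult_mono) (auto simp: Suc add_ac intro!: Beta_nonneg mult_nonneg_nonneg D)
      qed
      finally have "cmod (q * R k) \<le> D * (E * Beta (Re c + real k) E)" by (simp add: R_def Suc add_ac)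
      then have "cmod (hyp_coeff a b c k) * cmod (q * R k) \<le> cmod (hyp_coeff a b c k) * (D * (E * Beta (Re c + real k) E))"
        by (rule mult_left_mono) simp
      then show ?thesis using Suc by (simp add: M_def norm_mult mult_ac)
    qed
    ultimately have "cmod (q * (hyp_integral a b c q u)) \<le> D * E * S + K * cmod q powr \<kappa>"
      by (rule norm_sums_le[OF _ Ms])
    also have "\<dots> \<le> (D * E * S + K) * (1 + cmod q powr \<kappa>)"
      using D E S K(1) by (simp add: algebra_simps)
    finally show ?thesis .
  qed
  moreover have "D * E * S + K \<ge> 0" using D E S K(1) by simp
  ultimately show ?thesis by blast
qed

end

section \<open>Differentiation under the integral sign and improper integrals\<close>

text \<open>Written with difference quotients, the derivative is accessible to dominated convergence.\<close>
lemma has_vector_derivative_iff_quotient: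
  fixes F :: "real \<Rightarrow> 'a::real_normed_vector"
  shows "(F has_vector_derivative F') (at t0) \<longleftrightarrow> ((\<lambda>t. (F t - F t0) /\<^sub>R (t - t0)) \<longlongrightarrow> F') (at t0)"
proof -
  have ev: "\<forall>\<^sub>F t in at t0. norm ((F t - F t0 - (t - t0) *\<^sub>R F') /\<^sub>R norm (t - t0)) = norm ((F t - F t0) /\<^sub>R (t - t0) - F')"
    unfolding eventually_at_filter
  proof (intro always_eventually allI impI)
    fix t :: real assume t: "t \<noteq> t0"
    have "F t - F t0 - (t - t0) *\<^sub>R F' = (t - t0) *\<^sub>R ((F t - F t0) /\<^sub>R (t - t0) - F')"
      using t by (simp add: scaleR_diff_right)
    then show "norm ((F t - F t0 - (t - t0) *\<^sub>R F') /\<^sub>R norm (t - t0)) = norm ((F t - F t0) /\<^sub>R (t - t0) - F')"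
      using t by (simp add: abs_mult)
  qed
  have "(F has_vector_derivative F') (at t0) \<longleftrightarrow> ((\<lambda>t. (F t - F t0 - (t - t0) *\<^sub>R F') /\<^sub>R norm (t - t0)) \<longlongrightarrow> 0) (at t0)"
    unfolding has_vector_derivative_def has_derivative_def by (simp add: bounded_linear_scaleR_left Lim_ident_at)
  also have "\<dots> \<longleftrightarrow> ((\<lambda>t. norm ((F t - F t0 - (t - t0) *\<^sub>R F') /\<^sub>R norm (t - t0))) \<longlongrightarrow> 0) (at t0)"
    by (rule tendsto_norm_zero_iff[symmetric])
  also have "\<dots> \<longleftrightarrow> ((\<lambda>t. norm ((F t - F t0) /\<^sub>R (t - t0) - F')) \<longlongrightarrow> 0) (at t0)"
    by (rule tendsto_cong[OF ev])
  also have "\<dots> \<longleftrightarrow> ((\<lambda>t. (F t - F t0) /\<^sub>R (t - t0)) \<longlongrightarrow> F') (at t0)"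
    unfolding tendsto_norm_zero_iff by (rule LIM_zero_iff)
  finally show ?thesis .
qed

text \<open>Leibniz's rule; the mean value inequality dominates the difference quotients by \<open>w\<close>.\<close>
lemma has_vector_derivative_lebesgue_integral:
  fixes f f' :: "real \<Rightarrow> 'b \<Rightarrow> complex"
  assumes S: "open S" "t0 \<in> S"
    and int: "\<And>t. t \<in> S \<Longrightarrow> integrable M (f t)"
    and der: "\<And>t y. t \<in> S \<Longrightarrow> ((\<lambda>t. f t y) has_vector_derivative f' t y) (at t)"
    and bd: "\<And>t y. t \<in> S \<Longrightarrow> cmod (f' t y) \<le> w y"
    and w: "integrable M w"
  shows "((\<lambda>t. LINT y|M. f t y) has_vector_derivative (LINT y|M. f' t0 y)) (at t0)"
proof -
  obtain e where e: "e > 0" "ball t0 e \<subseteq> S" using S open_contains_ball by blast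
  define D where "D = (\<lambda>t y. (f t y - f t0 y) /\<^sub>R (t - t0))"
  have Dint: "integrable M (D t)" if "t \<in> S" for t
    unfolding D_def by (intro integrable_scaleR_right Bochner_Integration.integrable_diff int that S)
  have Dlim: "((\<lambda>t. D t y) \<longlongrightarrow> f' t0 y) (at t0)" for y
    using der[OF S(2), of y] unfolding has_vector_derivative_iff_quotient D_def .
  have Dbd: "cmod (D t y) \<le> w y" if t: "t \<in> ball t0 e" "t \<noteq> t0" for t y
  proof -
    have "norm (f t y - f t0 y) \<le> w y * norm (t - t0)"
    proof (rule norm_diff_le_of_vector_derivative_bound[of "ball t0 e"])
      fix s assume s: "s \<in> ball t0 e"
      then have "s \<in> S" using e by blast
      then show "((\<lambda>t. f t y) has_vector_derivative f' s y) (at s within ball t0 e)" "norm (f' s y) \<le> w y"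
        using der bd by (auto intro: has_vector_derivative_at_within)
    qed (use e t in auto)
    then show ?thesis using t(2) by (simp add: D_def divide_inverse[symmetric] pos_divide_le_eq mult.commute[of "inverse _"])
  qed
  have lim: "(\<lambda>n. LINT y|M. D (X n) y) \<longlonglongrightarrow> (LINT y|M. f' t0 y)"
    if X: "\<And>n. X n \<in> ball t0 e - {t0}" "X \<longlonglongrightarrow> t0" for X
  proof -
    have X': "filterlim X (at t0) sequentially" using X by (auto simp: filterlim_at intro: always_eventually)
    have meas: "D (X n) \<in> borel_measurable M" for n
      using X(1)[of n] e(2) by (intro borel_measurable_integrable Dint) auto
    have ptw: "(\<lambda>n. D (X n) y) \<longlonglongrightarrow> f' t0 y" for y
      using filterlim_compose[OF Dlim X'] .
    have mf: "f' t0 \<in> borel_measurable M"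
      by (rule borel_measurable_LIMSEQ_metric[OF meas]) (rule ptw)
    have bd: "AE y in M. norm (D (X n) y) \<le> w y" for n
      using Dbd[of "X n"] X(1)[of n] by (intro AE_I2) auto
    show ?thesis
      by (rule integral_dominated_convergence[where s = "\<lambda>n. D (X n)" and w = w, OF mf meas w AE_I2 bd]) (rule ptw)
  qed
  show ?thesis
  proof (rule has_vector_derivative_iff_quotient[THEN iffD2])
    have "((\<lambda>t. LINT y|M. D t y) \<longlongrightarrow> (LINT y|M. f' t0 y)) (at t0 within ball t0 e)"
      unfolding tendsto_at_iff_sequentially using lim by (auto simp: o_def)
    then have "((\<lambda>t. LINT y|M. D t y) \<longlongrightarrow> (LINT y|M. f' t0 y)) (at t0)"
      using at_within_open[of t0 "ball t0 e"] e(1) by auto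
    moreover have "\<forall>\<^sub>F t in at t0. (LINT y|M. D t y) = ((LINT y|M. f t y) - (LINT y|M. f t0 y)) /\<^sub>R (t - t0)"
      using eventually_at_in_open'[OF S]
    proof eventually_elim
      case (elim t)
      show ?case
        by (simp only: D_def integral_scaleR_right Bochner_Integration.integral_diff[OF int[OF elim] int[OF S(2)]])
    qed
    ultimately show "((\<lambda>t. ((LINT y|M. f t y) - (LINT y|M. f t0 y)) /\<^sub>R (t - t0)) \<longlongrightarrow> (LINT y|M. f' t0 y)) (at t0)"
      by (rule Lim_transform_eventually)
  qed
qed

text \<open>
  An improper integral at infinity is a Henstock-Kurzweil integral, also if it converges only
  conditionally.
\<close>
lemma has_integral_greaterThan:
  fixes f :: "real \<Rightarrow> 'a::euclidean_space"
  assumes I: "\<And>T. T > x \<Longrightarrow> (f has_integral P T) {x..T}" and L: "(P \<longlongrightarrow> L) at_top"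
  shows "(f has_integral L) {x<..}"
  unfolding has_integral_alt'[of f]
proof (intro conjI allI impI)
  have fin: "((\<lambda>s. if s \<in> {x<..} then f s else 0) has_integral (if b > x then P b else 0)) {a..b}" if "a \<le> x" for a b
  proof (cases "b > x")
    case True
    have "((\<lambda>s. if s \<in> {x<..} then f s else 0) has_integral P b) {x..b}"
      by (rule has_integral_spike[OF negligible_sing[of x] _ I[OF True]]) auto
    then have "((\<lambda>s. if s \<in> {x..b} then (if s \<in> {x<..} then f s else 0) else 0) has_integral P b) {a..b}"
      using that True by (subst has_integral_restrict) auto
    then have "((\<lambda>s. if s \<in> {x<..} then f s else 0) has_integral P b) {a..b}"
      by (rule has_integral_eq[rotated]) auto
    then show ?thesis using True by simp
  next
    case False
    have "((\<lambda>s. if s \<in> {x<..} then f s else 0) has_integral 0) {a..b}"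
      by (rule has_integral_eq[OF _ has_integral_0]) (use False in auto)
    then show ?thesis using False by simp
  qed
  show "(\<lambda>s. if s \<in> {x<..} then f s else 0) integrable_on cbox a b" for a b
  proof -
    have "(\<lambda>s. if s \<in> {x<..} then f s else 0) integrable_on {min a x..b}"
      using fin[of "min a x" b] by (auto simp: integrable_on_def)
    then show ?thesis by (rule integrable_on_subcbox) auto
  qed
  fix e :: real assume e: "e > 0"
  obtain B where B: "\<And>T. T \<ge> B \<Longrightarrow> norm (P T - L) < e"
    using tendstoD[OF L e] by (auto simp: eventually_at_top_linorder dist_norm)
  show "\<exists>B>0. \<forall>a b. ball 0 B \<subseteq> cbox a b \<longrightarrow> norm (integral (cbox a b) (\<lambda>s. if s \<in> {x<..} then f s else 0) - L) < e"
  proof (intro exI[of _ "max \<bar>B\<bar> \<bar>x\<bar> + 1"] conjI allI impI)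
    fix a b :: real assume "ball 0 (max \<bar>B\<bar> \<bar>x\<bar> + 1) \<subseteq> cbox a b"
    moreover have "x \<in> ball 0 (max \<bar>B\<bar> \<bar>x\<bar> + 1)" by auto
    moreover have "max \<bar>B\<bar> \<bar>x\<bar> + 1/2 \<in> ball 0 (max \<bar>B\<bar> \<bar>x\<bar> + 1)" by (auto simp: dist_real_def)
    ultimately have "x \<in> cbox a b" "max \<bar>B\<bar> \<bar>x\<bar> + 1/2 \<in> cbox a b" by blast+
    then have "a \<le> x" "b > x" "b \<ge> B" by auto
    then show "norm (integral (cbox a b) (\<lambda>s. if s \<in> {x<..} then f s else 0) - L) < e"
      using integral_unique[OF fin[of a b]] B[of b] by simp
  qed auto
qed

context
  fixes a b c :: complex and E :: real
  assumes c: "Re c > 0" and E: "E > 0" and s: "Re (c - a - b) + E > 0"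
begin

lemma hyp_kernel_partial_integral_HK:
  assumes "Re q = E"
  shows "hyp_kernel a b c q integrable_on {0..1}"
    and "0 \<le> u \<Longrightarrow> u \<le> 1 \<Longrightarrow> (hyp_integral a b c q u) = integral {0..u} (hyp_kernel a b c q)"
  using set_borel_integral_eq_integral[OF hyp_kernel_integrable[OF c E s assms]]
  by (auto simp: integrable_on_Icc_iff_Ioo integral_open_interval_real)

lemma continuous_on_hyp_kernel_partial_integral:
  assumes "Re q = E"
  shows "continuous_on {0..1} (\<lambda>u. hyp_integral a b c q u)"
  using indefinite_integral_continuous_1[OF hyp_kernel_partial_integral_HK(1)[OF assms]]
  by (rule continuous_on_eq) (simp add: hyp_kernel_partial_integral_HK(2)[OF assms])

lemma hyp_kernel_partial_integral_has_derivative: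
  assumes "Re q = E" and u: "0 < u" "u < 1"
  shows "((\<lambda>u. hyp_integral a b c q u) has_vector_derivative hyp_kernel a b c q u) (at u)"
proof -
  have "isCont (hyp_kernel a b c q) u"
    using continuous_on_hyp_kernel[OF Re_pos_not_nonpos_Int[OF c], of a b q] u
    by (simp add: continuous_on_eq_continuous_at)
  then have "((\<lambda>u. integral {0..u} (hyp_kernel a b c q)) has_vector_derivative hyp_kernel a b c q u) (at u within ({0..1} - {}))"
    using hyp_kernel_partial_integral_HK(1)[OF assms(1)] u
    by (intro integral_has_vector_derivative_continuous_at) (auto intro: continuous_at_imp_continuous_within)
  then have "((\<lambda>u. integral {0..u} (hyp_kernel a b c q)) has_vector_derivative hyp_kernel a b c q u) (at u)"
    using at_within_Icc_at[of 0 u 1] u by (simp only: Diff_empty)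
  then show ?thesis
    by (rule has_vector_derivative_transform_within_open[where S = "{0<..<1}"])
      (use u in \<open>auto simp: hyp_kernel_partial_integral_HK(2)[OF assms(1)]\<close>)
qed

end

text \<open>
  Measurability of a parameter integral needs joint measurability of the integrand. The exponent
  enters through \<open>exp ((q - 1) ln (1 - v))\<close> alone.
\<close>
lemma hyp_kernel_partial_integral_measurable:
  assumes c: "c \<notin> \<int>\<^sub>\<le>\<^sub>0" and u: "u \<le> 1" and q: "q \<in> borel_measurable borel"
  shows "(\<lambda>y::real. hyp_integral a b c (q y) u) \<in> borel_measurable borel"
proof -
  define h where "h = (\<lambda>v. indicator {0<..<u} v *\<^sub>R (hyp_series a b c (of_real v) * of_real v powr (c - 1)))"
  have "set_borel_measurable lborel {0<..<u} (\<lambda>v. hyp_series a b c (of_real v) * of_real v powr (c - 1))"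
    using u by (intro set_borel_measurable_Ioo continuous_on_mult continuous_on_hyp_series_of_real[OF c] continuous_intros)
      (auto simp: complex_nonpos_Reals_iff)
  then have h: "h \<in> borel_measurable borel" unfolding set_borel_measurable_def h_def by simp
  have "(\<lambda>y. LINT v|lborel. h v * exp ((q y - 1) * of_real (ln (1 - v)))) \<in> borel_measurable borel"
    using h q by measurable
  also have "(\<lambda>y. LINT v|lborel. h v * exp ((q y - 1) * of_real (ln (1 - v)))) = (\<lambda>y. hyp_integral a b c (q y) u)"
    unfolding set_lebesgue_integral_def
    by (intro ext Bochner_Integration.integral_cong)
      (use u in \<open>auto simp: h_def indicator_def hyp_kernel_def beta_kernel_def powr_def Ln_of_real[symmetric]\<close>)
  finally show ?thesis .
qed

section \<open>The Saigo integral of a derivative\<close>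

lemma powr_of_real_exp: "r > 0 \<Longrightarrow> complex_of_real r powr z = exp (z * of_real (ln r))"
  by (simp add: powr_def Ln_of_real)

lemma norm_of_real_powr: "r > 0 \<Longrightarrow> cmod (of_real r powr z) = r powr Re z"
  by (subst norm_powr_real_powr) auto

text \<open>
  The kernel of the Saigo operator, with a complex integration variable. Holomorphy in \<open>z\<close>
  yields that its derivative on the half-line is continuous.
\<close>
definition saigo_kernel :: "complex \<Rightarrow> complex \<Rightarrow> complex \<Rightarrow> complex \<Rightarrow> complex \<Rightarrow> complex" where
  "saigo_kernel \<alpha> \<beta> \<gamma> x z =
     (z - x) powr (\<alpha> - 1) * z powr (- \<alpha> - \<beta>) * hyp_series (\<alpha> + \<beta>) (- \<gamma>) \<alpha> (1 - x / z)"

text \<open>The argument \<open>1 - x / z\<close> lies in the unit disc because \<open>z\<close> is closer to \<open>x\<close> than to 0.\<close>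
lemma saigo_kernel_holomorphic:
  assumes a: "Re \<alpha> > 0" and x: "x > (0::real)"
  shows "saigo_kernel \<alpha> \<beta> \<gamma> (of_real x) holomorphic_on {z. Re z > x}"
proof -
  have "(\<lambda>z. hyp_series (\<alpha> + \<beta>) (- \<gamma>) \<alpha> (1 - of_real x / z)) holomorphic_on {z. Re z > x}"
  proof (rule holomorphic_on_compose_gen[where g = "hyp_series (\<alpha> + \<beta>) (- \<gamma>) \<alpha>" and f = "\<lambda>z. 1 - of_real x / z", unfolded o_def])
    show "hyp_series (\<alpha> + \<beta>) (- \<gamma>) \<alpha> holomorphic_on ball 0 1"
      by (rule hyp_series_holomorphic[OF Re_pos_not_nonpos_Int[OF a]])
    show "(\<lambda>z. 1 - complex_of_real x / z) holomorphic_on {z. Re z > x}"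
      using x by (intro holomorphic_intros) auto
    have "cmod (1 - of_real x / z) < 1" if z: "Re z > x" for z
    proof -
      have z0: "z \<noteq> 0" using z x by auto
      have "(Re z - x)\<^sup>2 < (Re z)\<^sup>2" using z x by (intro power_strict_mono) auto
      then have "cmod (z - of_real x) < cmod z" by (simp add: cmod_def)
      moreover have "1 - of_real x / z = (z - of_real x) / z" using z0 by (simp add: field_simps)
      ultimately show ?thesis using z0 by (simp add: norm_divide)
    qed
    then show "(\<lambda>z. 1 - complex_of_real x / z) ` {z. Re z > x} \<subseteq> ball 0 1" by auto
  qed
  then show ?thesis unfolding saigo_kernel_def using x
    by (intro holomorphic_on_mult holomorphic_on_powr_right holomorphic_intros)
      (auto simp: complex_nonpos_Reals_iff)
qed

lemma
  assumes a: "Re \<alpha> > 0" and x: "x > (0::real)"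
  shows saigo_kernel_has_derivative: "t > x \<Longrightarrow> ((\<lambda>t. saigo_kernel \<alpha> \<beta> \<gamma> (of_real x) (of_real t))
      has_vector_derivative deriv (saigo_kernel \<alpha> \<beta> \<gamma> (of_real x)) (of_real t)) (at t)"
    and saigo_kernel_deriv_continuous:
      "continuous_on {x<..} (\<lambda>t. deriv (saigo_kernel \<alpha> \<beta> \<gamma> (of_real x)) (of_real t))"
proof -
  have op: "open {z. Re z > x}" by (rule open_halfspace_Re_gt)
  note hol = saigo_kernel_holomorphic[OF a x, of \<beta> \<gamma>]
  show "((\<lambda>t. saigo_kernel \<alpha> \<beta> \<gamma> (of_real x) (of_real t))
      has_vector_derivative deriv (saigo_kernel \<alpha> \<beta> \<gamma> (of_real x)) (of_real t)) (at t)" if "t > x"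
    using that by (intro has_vector_derivative_real_field holomorphic_derivI[OF hol op]) auto
  show "continuous_on {x<..} (\<lambda>t. deriv (saigo_kernel \<alpha> \<beta> \<gamma> (of_real x)) (of_real t))"
    by (rule continuous_on_compose2[OF holomorphic_on_imp_continuous_on[OF holomorphic_deriv[OF hol op]]])
      (auto intro!: continuous_intros)
qed

text \<open>
  The change of variables \<open>v = 1 - x / t\<close> with \<open>dv = x / t\<^sup>2 dt\<close>. All bases are positive, so writing the
  powers as exponentials reduces the claim to an identity between the exponents.
\<close>
lemma saigo_kernel_substitution:
  assumes x: "0 < x" "x < t"
  shows "of_real x powr (- 1 - \<beta> - \<nu>) * ((of_real (x / t\<^sup>2)) * hyp_kernel (\<alpha> + \<beta>) (- \<gamma>) \<alpha> (1 + \<beta> + \<nu>) (1 - x / t))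
     = saigo_kernel \<alpha> \<beta> \<gamma> (of_real x) (of_real t) * of_real t powr (- \<nu> - 1)"
proof -
  define X T D where "X = complex_of_real (ln x)" and "T = complex_of_real (ln t)" and "D = complex_of_real (ln (t - x))"
  have t: "t > 0" using x by simp
  have e1: "complex_of_real (1 - x / t) powr z = exp (z * (D - T))" for z
  proof -
    have "1 - x / t = (t - x) / t" using t by (simp add: field_simps)
    moreover have "ln ((t - x) / t) = ln (t - x) - ln t" using x t by (subst ln_div) auto
    ultimately show ?thesis using x t by (subst powr_of_real_exp) (auto simp: D_def T_def)
  qed
  have e2: "complex_of_real (1 - (1 - x / t)) powr z = exp (z * (X - T))" for z
    using x t by (subst powr_of_real_exp) (auto simp: X_def T_def ln_div)
  have e3: "complex_of_real x powr z = exp (z * X)" for z unfolding X_def by (rule powr_of_real_exp[OF x(1)])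
  have e4: "complex_of_real t powr z = exp (z * T)" for z unfolding T_def by (rule powr_of_real_exp[OF t])
  have e5: "(complex_of_real t - complex_of_real x) powr z = exp (z * D)" for z
    using powr_of_real_exp[of "t - x" z] x by (simp add: D_def)
  have "ln (x / t\<^sup>2) = ln x - 2 * ln t" using x t by (simp add: ln_div ln_realpow)
  then have "x / t\<^sup>2 = exp (ln x - 2 * ln t)" using x t by (metis divide_pos_pos exp_ln zero_less_power)
  then have e6: "complex_of_real (x / t\<^sup>2) = exp (X - 2 * T)" by (simp add: X_def T_def exp_of_real[symmetric])
  have arg: "complex_of_real (1 - x / t) = 1 - complex_of_real x / complex_of_real t" by simp
  have "(- 1 - \<beta> - \<nu>) * X + (X - 2 * T) + (\<alpha> - 1) * (D - T) + (1 + \<beta> + \<nu> - 1) * (X - T)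
      = (\<alpha> - 1) * D + (- \<alpha> - \<beta>) * T + (- \<nu> - 1) * T" by (simp add: algebra_simps)
  then have "exp ((- 1 - \<beta> - \<nu>) * X) * exp (X - 2 * T) * exp ((\<alpha> - 1) * (D - T)) * exp ((1 + \<beta> + \<nu> - 1) * (X - T))
      = exp ((\<alpha> - 1) * D) * exp ((- \<alpha> - \<beta>) * T) * exp ((- \<nu> - 1) * T)"
    unfolding exp_add[symmetric] by (rule arg_cong)
  then show ?thesis
    unfolding saigo_kernel_def hyp_kernel_def beta_kernel_def e1 e2 e3 e4 e5 e6 unfolding arg
    by (simp add: mult_ac)
qed

lemma weighted_density_measurable:
  fixes H :: "real \<Rightarrow> complex"
  assumes H: "integrable lborel (\<lambda>y. H y * of_real ((1 + \<bar>y\<bar>) powr \<kappa>))"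
  shows "H \<in> borel_measurable borel"
proof -
  have "(\<lambda>y. (H y * of_real ((1 + \<bar>y\<bar>) powr \<kappa>)) * of_real ((1 + \<bar>y\<bar>) powr (- \<kappa>))) \<in> borel_measurable borel"
    using borel_measurable_integrable[OF H] by measurable
  also have "(\<lambda>y. (H y * of_real ((1 + \<bar>y\<bar>) powr \<kappa>)) * of_real ((1 + \<bar>y\<bar>) powr (- \<kappa>))) = H"
  proof
    fix y :: real
    have "(1 + \<bar>y\<bar>) powr \<kappa> * (1 + \<bar>y\<bar>) powr (- \<kappa>) = 1" by (simp add: powr_add[symmetric])
    then show "(H y * of_real ((1 + \<bar>y\<bar>) powr \<kappa>)) * of_real ((1 + \<bar>y\<bar>) powr (- \<kappa>)) = H y"
      by (simp only: mult.assoc of_real_mult[symmetric]) simp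
  qed
  finally show ?thesis .
qed

lemma weighted_density_times_integrable:
  fixes H f :: "real \<Rightarrow> complex"
  assumes H: "integrable lborel (\<lambda>y. H y * of_real ((1 + \<bar>y\<bar>) powr \<kappa>))"
    and "f \<in> borel_measurable borel" "\<And>y. cmod (f y) \<le> C * (1 + \<bar>y\<bar>) powr \<kappa>"
  shows "integrable lborel (\<lambda>y. H y * f y)"
proof (rule Bochner_Integration.integrable_bound[OF integrable_mult_right[OF integrable_norm[OF H], of C]])
  show "(\<lambda>y. H y * f y) \<in> borel_measurable lborel" using weighted_density_measurable[OF H] assms(2) by simp
  have "cmod (H y * f y) \<le> C * norm (H y * of_real ((1 + \<bar>y\<bar>) powr \<kappa>))" for y
    using mult_left_mono[OF assms(3)[of y], of "cmod (H y)"] by (simp add: norm_mult mult_ac)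
  then show "AE y in lborel. norm (H y * f y) \<le> norm (C * norm (H y * of_real ((1 + \<bar>y\<bar>) powr \<kappa>)))"
    by (intro AE_I2) (metis abs_ge_self order_trans real_norm_def)
qed

text \<open>
  A density \<open>H\<close> for the powers \<open>t\<^sup>-\<^sup>\<nu>\<close> whose exponents run through a vertical line. The weight \<open>(1 + |y|)\<^sup>\<kappa>\<close> is less
  than the weight \<open>1 + |y|\<close> that differentiation under the integral sign would ask for, and it is tied
  to the singularity of the kernel by \<open>Re \<alpha> + \<kappa> > 1\<close>. The conditions on \<open>\<beta>\<close> and \<open>\<gamma>\<close> make the Saigo integral of
  \<open>t\<^sup>-\<^sup>\<nu>\<^sup>-\<^sup>1\<close> converge at infinity.
\<close>
locale mellin_density =
  fixes \<alpha> \<beta> \<gamma> l :: complex and \<mu> \<kappa> x :: real and H :: "real \<Rightarrow> complex" and \<nu> :: "real \<Rightarrow> complex"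
  assumes alpha: "Re \<alpha> > 0" and x: "x > 0"
    and beta: "Re (1 + \<beta> + l) > 0" and gamma: "Re (1 + \<gamma> + l) > 0"
    and kappa: "0 \<le> \<kappa>" "\<kappa> \<le> 1" "Re \<alpha> + \<kappa> > 1"
    and H: "integrable lborel (\<lambda>y. H y * of_real ((1 + \<bar>y\<bar>) powr \<kappa>))"
    and exponent: "\<And>y. \<nu> y = l - \<i> * of_real (\<mu> * y)"
begin

text \<open>
  The integral of \<open>K(s) (s\<^sup>-\<^sup>\<nu>)'\<close> over \<open>x < s < t\<close>, where \<open>K\<close> is the Saigo kernel, after the substitution
  \<open>v = 1 - x / s\<close>.
\<close>
definition primitive :: "real \<Rightarrow> real \<Rightarrow> complex" where
  "primitive y t = of_real x powr (- 1 - \<beta> - \<nu> y) * (- \<nu> y *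
     (hyp_integral (\<alpha> + \<beta>) (- \<gamma>) \<alpha> (1 + \<beta> + \<nu> y) (1 - x / t)))"

abbreviation "K t \<equiv> saigo_kernel \<alpha> \<beta> \<gamma> (of_real x) (of_real t)"
abbreviation "K' t \<equiv> deriv (saigo_kernel \<alpha> \<beta> \<gamma> (of_real x)) (of_real t)"

lemma excess: "Re (\<alpha> - (\<alpha> + \<beta>) - (- \<gamma>)) + Re (1 + \<beta> + l) > 0"
  using gamma by simp

lemma Re_exponent: "Re (\<nu> y) = Re l" by (simp add: exponent)

lemma Re_shifted_exponent: "Re (1 + \<beta> + \<nu> y) = Re (1 + \<beta> + l)" by (simp add: exponent)

lemma exponent_measurable: "\<nu> \<in> borel_measurable borel"
proof -
  have "\<nu> = (\<lambda>y. l - \<i> * of_real (\<mu> * y))" by (rule ext) (rule exponent)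
  then show ?thesis by simp
qed

lemma H_measurable: "H \<in> borel_measurable borel"
  by (rule weighted_density_measurable[OF H])

lemma one_le_weight: "1 \<le> (1 + \<bar>y\<bar>) powr \<kappa>" using kappa by (simp add: ge_one_powr_ge_zero)

lemma H_weight_integrable: "integrable lborel (\<lambda>y. C * (cmod (H y) * (1 + \<bar>y\<bar>) powr \<kappa>))"
  using integrable_norm[OF H] by (intro integrable_mult_right) (simp add: norm_mult)

lemmas dominated_integrable = weighted_density_times_integrable[OF H]

lemma primitive_measurable: "t > x \<Longrightarrow> (\<lambda>y. primitive y t) \<in> borel_measurable borel"
proof -
  assume t: "t > x"
  have 1: "(\<lambda>y. hyp_integral (\<alpha> + \<beta>) (- \<gamma>) \<alpha> (1 + \<beta> + \<nu> y) (1 - x / t)) \<in> borel_measurable borel"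
    using t x exponent_measurable by (intro hyp_kernel_partial_integral_measurable Re_pos_not_nonpos_Int alpha) auto
  have "(\<lambda>y. exp ((- 1 - \<beta> - \<nu> y) * of_real (ln x)) * (- \<nu> y *
     (hyp_integral (\<alpha> + \<beta>) (- \<gamma>) \<alpha> (1 + \<beta> + \<nu> y) (1 - x / t)))) \<in> borel_measurable borel"
    using 1 exponent_measurable by measurable
  then show ?thesis unfolding primitive_def using x by (simp add: powr_of_real_exp)
qed

lemma primitive_has_derivative:
  assumes t: "t > x"
  shows "(primitive y has_vector_derivative K t * (- \<nu> y * of_real t powr (- \<nu> y - 1))) (at t)"
proof -
  have u: "0 < 1 - x / t" "1 - x / t < 1" using x t by auto
  have d1: "((\<lambda>t. 1 - x / t) has_vector_derivative x / t\<^sup>2) (at t)"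
    unfolding has_real_derivative_iff_has_vector_derivative[symmetric]
    using x t by (auto intro!: derivative_eq_intros simp: power2_eq_square)
  have d2: "((\<lambda>u. hyp_integral (\<alpha> + \<beta>) (- \<gamma>) \<alpha> (1 + \<beta> + \<nu> y) u)
     has_vector_derivative hyp_kernel (\<alpha> + \<beta>) (- \<gamma>) \<alpha> (1 + \<beta> + \<nu> y) (1 - x / t)) (at (1 - x / t))"
    by (rule hyp_kernel_partial_integral_has_derivative[OF alpha beta excess Re_shifted_exponent u])
  have "((\<lambda>t. of_real x powr (- 1 - \<beta> - \<nu> y) * (- \<nu> y * ((\<lambda>u. hyp_integral (\<alpha> + \<beta>) (- \<gamma>) \<alpha> (1 + \<beta> + \<nu> y) u) \<circ> (\<lambda>t. 1 - x / t)) t))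
     has_vector_derivative of_real x powr (- 1 - \<beta> - \<nu> y) * (- \<nu> y * ((x / t\<^sup>2) *\<^sub>R hyp_kernel (\<alpha> + \<beta>) (- \<gamma>) \<alpha> (1 + \<beta> + \<nu> y) (1 - x / t)))) (at t)"
    by (intro has_vector_derivative_mult_right vector_diff_chain_at[OF d1 d2])
  moreover have "of_real x powr (- 1 - \<beta> - \<nu> y) * (- \<nu> y * ((x / t\<^sup>2) *\<^sub>R hyp_kernel (\<alpha> + \<beta>) (- \<gamma>) \<alpha> (1 + \<beta> + \<nu> y) (1 - x / t)))
     = K t * (- \<nu> y * of_real t powr (- \<nu> y - 1))"
    using saigo_kernel_substitution[OF x t, of \<beta> "\<nu> y" \<alpha> \<gamma>] unfolding scaleR_conv_of_real
    by (metis (no_types, lifting) mult.left_commute)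
  ultimately show ?thesis unfolding primitive_def[abs_def] o_def by simp
qed

text \<open>
  The factor \<open>\<nu>\<close> of the derivative is comparable to the exponent \<open>1 + \<beta> + \<nu>\<close> of the partial integral, and
  \<open>hyp_kernel_partial_integral_bound\<close> contains this exponent as a factor already.
\<close>
lemma primitive_bound: "\<exists>C\<ge>0. \<forall>y t. t > x \<longrightarrow> cmod (primitive y t) \<le> C * (1 + \<bar>y\<bar>) powr \<kappa>"
proof -
  define E where "E = Re (1 + \<beta> + l)"
  have E: "E > 0" using beta by (simp add: E_def)
  obtain B where B: "B \<ge> 0" "\<And>q u. Re q = E \<Longrightarrow> 0 < u \<Longrightarrow> u < 1 \<Longrightarrow>
     cmod (q * (hyp_integral (\<alpha> + \<beta>) (- \<gamma>) \<alpha> q u)) \<le> B * (1 + cmod q powr \<kappa>)"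
    using hyp_kernel_partial_integral_bound[OF alpha beta excess kappa] unfolding E_def by blast
  define A where "A = 1 + cmod (1 + \<beta>) / E"
  define M where "M = 1 + cmod (1 + \<beta> + l) + \<bar>\<mu>\<bar>"
  define W where "W = x powr (- 1 - Re \<beta> - Re l)"
  have A: "A \<ge> 0" and M: "M \<ge> 0" and W: "W \<ge> 0" using E by (auto simp: A_def M_def W_def)
  have "cmod (primitive y t) \<le> (W * A * B * (1 + M powr \<kappa>)) * (1 + \<bar>y\<bar>) powr \<kappa>" if t: "t > x" for y t
  proof -
    define q where "q = 1 + \<beta> + \<nu> y"
    define J where "J = (hyp_integral (\<alpha> + \<beta>) (- \<gamma>) \<alpha> q (1 - x / t))"
    have u: "0 < 1 - x / t" "1 - x / t < 1" using x t by auto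
    have Rq: "Re q = E" unfolding q_def E_def by (rule Re_shifted_exponent)
    have qE: "E \<le> cmod q" using Rq complex_Re_le_cmod[of q] by simp
    have "cmod (\<nu> y) \<le> cmod q + cmod (1 + \<beta>)"
      using norm_triangle_ineq4[of q "1 + \<beta>"] by (simp add: q_def)
    also have "cmod (1 + \<beta>) \<le> cmod (1 + \<beta>) / E * cmod q"
      using mult_left_mono[OF qE, of "cmod (1 + \<beta>) / E"] E by simp
    finally have lq: "cmod (\<nu> y) \<le> A * cmod q" by (simp add: A_def algebra_simps)
    have "cmod q \<le> cmod (1 + \<beta> + l) + \<bar>\<mu>\<bar> * \<bar>y\<bar>"
      using norm_triangle_ineq4[of "1 + \<beta> + l" "\<i> * of_real (\<mu> * y)"]
      by (simp add: q_def exponent norm_mult abs_mult add_diff_eq)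
    also have "\<dots> \<le> M * (1 + \<bar>y\<bar>)"
    proof -
      have "0 \<le> cmod (1 + \<beta> + l) * \<bar>y\<bar>" by simp
      then show ?thesis unfolding M_def by (simp add: distrib_left distrib_right)
    qed
    finally have "cmod q powr \<kappa> \<le> (M * (1 + \<bar>y\<bar>)) powr \<kappa>" using kappa by (intro powr_mono2) auto
    also have "\<dots> = M powr \<kappa> * (1 + \<bar>y\<bar>) powr \<kappa>" using M by (intro powr_mult)
    finally have qk: "1 + cmod q powr \<kappa> \<le> (1 + M powr \<kappa>) * (1 + \<bar>y\<bar>) powr \<kappa>"
      using one_le_weight[of y] by (simp add: distrib_right)
    have "cmod (of_real x powr (- 1 - \<beta> - \<nu> y)) = W" using x by (simp add: norm_of_real_powr W_def Re_exponent)
    then have "cmod (primitive y t) = W * (cmod (\<nu> y) * cmod J)"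
      unfolding primitive_def J_def q_def by (simp add: norm_mult)
    also have "\<dots> \<le> W * ((A * cmod q) * cmod J)"
      using lq W by (intro mult_left_mono mult_right_mono) auto
    also have "\<dots> = W * A * cmod (q * J)" by (simp add: norm_mult mult_ac)
    also have "\<dots> \<le> W * A * (B * ((1 + M powr \<kappa>) * (1 + \<bar>y\<bar>) powr \<kappa>))"
    proof (rule mult_left_mono)
      have "cmod (q * J) \<le> B * (1 + cmod q powr \<kappa>)" unfolding J_def by (rule B(2)[OF Rq u])
      also have "\<dots> \<le> B * ((1 + M powr \<kappa>) * (1 + \<bar>y\<bar>) powr \<kappa>)" using qk B(1) by (rule mult_left_mono)
      finally show "cmod (q * J) \<le> B * ((1 + M powr \<kappa>) * (1 + \<bar>y\<bar>) powr \<kappa>)" .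
    qed (use W A in simp)
    finally show ?thesis by (simp add: mult_ac)
  qed
  moreover have "W * A * B * (1 + M powr \<kappa>) \<ge> 0" using W A B(1) M by (intro mult_nonneg_nonneg add_nonneg_nonneg) auto
  ultimately show ?thesis by blast
qed

lemma norm_power_minus_exponent: "t > 0 \<Longrightarrow> cmod (of_real t powr (- \<nu> y)) = t powr (- Re l)"
  by (simp add: norm_of_real_powr Re_exponent)

lemma power_minus_exponent_measurable: "t > 0 \<Longrightarrow> (\<lambda>y. of_real t powr (- \<nu> y)) \<in> borel_measurable borel"
proof -
  assume t: "t > 0"
  have "(\<lambda>y. exp ((- \<nu> y) * of_real (ln t))) \<in> borel_measurable borel" using exponent_measurable by measurable
  then show ?thesis using t by (simp add: powr_of_real_exp)
qed

definition transform :: "real \<Rightarrow> complex" where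
  "transform t = (LINT y|lborel. H y * of_real t powr (- \<nu> y))"

definition transform_primitive :: "real \<Rightarrow> complex" where
  "transform_primitive t = (LINT y|lborel. H y * primitive y t)"

lemma transform_integrable: "t > 0 \<Longrightarrow> integrable lborel (\<lambda>y. H y * of_real t powr (- \<nu> y))"
proof (rule dominated_integrable[where C = "t powr (- Re l)"])
  assume t: "t > 0"
  show "cmod (of_real t powr (- \<nu> y)) \<le> t powr (- Re l) * (1 + \<bar>y\<bar>) powr \<kappa>" for y
    using mult_left_mono[OF one_le_weight[of y], of "t powr (- Re l)"] t by (simp add: norm_power_minus_exponent)
qed (rule power_minus_exponent_measurable)

lemma transform_primitive_integrable: "t > x \<Longrightarrow> integrable lborel (\<lambda>y. H y * primitive y t)"
proof -
  assume t: "t > x"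
  obtain C where C: "\<And>y t. t > x \<Longrightarrow> cmod (primitive y t) \<le> C * (1 + \<bar>y\<bar>) powr \<kappa>"
    using primitive_bound by blast
  show ?thesis by (rule dominated_integrable[OF primitive_measurable[OF t] C[OF t]])
qed

text \<open>
  Integration by parts in disguise. The derivative of each primitive is \<open>K (t\<^sup>-\<^sup>\<nu>)'\<close>, which is one power of \<open>y\<close> too
  large for domination; subtracting \<open>K t\<^sup>-\<^sup>\<nu>\<close> cancels it and leaves \<open>-K' t\<^sup>-\<^sup>\<nu>\<close>.
\<close>
lemma transform_primitive_minus_boundary_has_derivative:
  assumes t: "t > x"
  shows "((\<lambda>t. transform_primitive t - K t * transform t) has_vector_derivative - K' t * transform t) (at t)"
proof -
  define f where "f = (\<lambda>t y. H y * primitive y t - K t * (H y * of_real t powr (- \<nu> y)))"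
  define f' where "f' = (\<lambda>t y. - K' t * (H y * of_real t powr (- \<nu> y)))"
  define p q where "p = (x + t) / 2" and "q = t + 1"
  have pq: "x < p" "p < t" "t < q" using t by (auto simp: p_def q_def)
  have int: "integrable lborel (f s)" if "s > x" for s
    unfolding f_def using that x transform_integrable[of s] transform_primitive_integrable[of s] by auto
  have der: "((\<lambda>t. f t y) has_vector_derivative f' s y) (at s)" if s: "s > x" for s y
  proof -
    have s0: "s > 0" using s x by simp
    have "((\<lambda>t. f t y) has_vector_derivative
        H y * (K s * (- \<nu> y * of_real s powr (- \<nu> y - 1))) -
        (K s * (H y * (- \<nu> y * of_real s powr (- \<nu> y - 1))) + K' s * (H y * of_real s powr (- \<nu> y)))) (at s)"
      unfolding f_def using s s0 x
      by (intro has_vector_derivative_diff has_vector_derivative_mult has_vector_derivative_mult_right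
          primitive_has_derivative saigo_kernel_has_derivative alpha powr_has_vector_derivative)
    then show ?thesis by (simp add: f'_def algebra_simps)
  qed
  have cont: "continuous_on {p..q} (\<lambda>s. cmod (K' s) * s powr (- Re l))"
  proof (intro continuous_on_mult continuous_on_norm)
    show "continuous_on {p..q} (\<lambda>s. K' s)"
      by (rule continuous_on_subset[OF saigo_kernel_deriv_continuous[OF alpha x]]) (use pq in auto)
    show "continuous_on {p..q} (\<lambda>s. s powr (- Re l))" using pq x by (intro continuous_intros) auto
  qed
  obtain s0 where s0: "s0 \<in> {p..q}" "\<forall>s\<in>{p..q}. cmod (K' s) * s powr (- Re l) \<le> cmod (K' s0) * s0 powr (- Re l)"
    using continuous_attains_sup[OF _ _ cont] pq by fastforce
  define B where "B = cmod (K' s0) * s0 powr (- Re l)"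
  have B: "cmod (K' s) * s powr (- Re l) \<le> B" if "s \<in> {p..q}" for s
    using s0(2) that unfolding B_def by blast
  have B0: "0 \<le> B" by (simp add: B_def)
  have bd: "cmod (f' s y) \<le> B * (cmod (H y) * (1 + \<bar>y\<bar>) powr \<kappa>)" if s: "s \<in> {p<..<q}" for s y
  proof -
    have "cmod (f' s y) = (cmod (K' s) * s powr (- Re l)) * cmod (H y)"
      using s pq x by (simp add: f'_def norm_mult norm_power_minus_exponent mult_ac)
    also have "\<dots> \<le> B * cmod (H y)" using s by (intro mult_right_mono B) auto
    also have "\<dots> \<le> B * (cmod (H y) * (1 + \<bar>y\<bar>) powr \<kappa>)"
    proof (rule mult_left_mono)
      show "0 \<le> B" by (rule B0)
      show "cmod (H y) \<le> cmod (H y) * (1 + \<bar>y\<bar>) powr \<kappa>"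
        using mult_left_mono[OF one_le_weight[of y], of "cmod (H y)"] by simp
    qed
    finally show ?thesis .
  qed
  have "((\<lambda>t. LINT y|lborel. f t y) has_vector_derivative (LINT y|lborel. f' t y)) (at t)"
    by (rule has_vector_derivative_lebesgue_integral[OF _ _ int der bd H_weight_integrable, of "{p<..<q}"])
      (use pq in auto)
  moreover have "(LINT y|lborel. f' t y) = - K' t * transform t"
    unfolding f'_def transform_def by simp
  ultimately have "((\<lambda>t. LINT y|lborel. f t y) has_vector_derivative - K' t * transform t) (at t)" by simp
  then show ?thesis
  proof (rule has_vector_derivative_transform_within_open[where S = "{x<..}"])
    fix s assume s: "s \<in> {x<..}"
    then show "(LINT y|lborel. f s y) = transform_primitive s - K s * transform s"
      unfolding f_def transform_primitive_def transform_def
      using x transform_integrable[of s] transform_primitive_integrable[of s] by simp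
  qed (use t in auto)
qed

text \<open>Adding \<open>K\<close> times the transform again costs no more than differentiability of the transform at \<open>t\<close>.\<close>
lemma transform_primitive_has_derivative:
  assumes t: "t > x" and g: "(transform has_vector_derivative g') (at t)"
  shows "(transform_primitive has_vector_derivative K t * g') (at t)"
proof -
  have "((\<lambda>t. (transform_primitive t - K t * transform t) + K t * transform t) has_vector_derivative
     - K' t * transform t + (K t * g' + K' t * transform t)) (at t)"
    by (intro has_vector_derivative_add transform_primitive_minus_boundary_has_derivative t
        has_vector_derivative_mult saigo_kernel_has_derivative alpha x g)
  then show ?thesis by simp
qed

lemma primitive_tendsto:
  assumes "((\<lambda>t. 1 - x / t) \<longlongrightarrow> u) F" "\<forall>\<^sub>F t in F. t > x" "u \<in> {0..1}"
  shows "((\<lambda>t. primitive y t) \<longlongrightarrow> of_real x powr (- 1 - \<beta> - \<nu> y) * (- \<nu> y *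
     (hyp_integral (\<alpha> + \<beta>) (- \<gamma>) \<alpha> (1 + \<beta> + \<nu> y) u))) F"
proof -
  have "\<forall>\<^sub>F t in F. 1 - x / t \<in> {0..1}"
    using assms(2) by eventually_elim (use x in auto)
  with assms have "((\<lambda>t. hyp_integral (\<alpha> + \<beta>) (- \<gamma>) \<alpha> (1 + \<beta> + \<nu> y) (1 - x / t)) \<longlongrightarrow>
     (hyp_integral (\<alpha> + \<beta>) (- \<gamma>) \<alpha> (1 + \<beta> + \<nu> y) u)) F"
    by (intro continuous_on_tendsto_compose[OF continuous_on_hyp_kernel_partial_integral[OF alpha beta excess Re_shifted_exponent[of y]]])
  then show ?thesis unfolding primitive_def by (intro tendsto_intros)
qed

lemma transform_primitive_tendsto_sequentially:
  assumes X: "\<And>n. X n > x" and lim: "\<And>y. (\<lambda>n. primitive y (X n)) \<longlonglongrightarrow> \<sigma> y"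
  shows "(\<lambda>n. transform_primitive (X n)) \<longlonglongrightarrow> (LINT y|lborel. H y * \<sigma> y)"
proof -
  obtain C where C: "\<And>y t. t > x \<Longrightarrow> cmod (primitive y t) \<le> C * (1 + \<bar>y\<bar>) powr \<kappa>"
    using primitive_bound by blast
  have meas: "\<sigma> \<in> borel_measurable borel"
    by (rule borel_measurable_LIMSEQ_metric[OF primitive_measurable[OF X]]) (rule lim)
  show ?thesis unfolding transform_primitive_def
  proof (rule integral_dominated_convergence[where s = "\<lambda>n y. H y * primitive y (X n)" and f = "\<lambda>y. H y * \<sigma> y"
        and w = "\<lambda>y. C * (cmod (H y) * (1 + \<bar>y\<bar>) powr \<kappa>)"])
    show "(\<lambda>y. H y * \<sigma> y) \<in> borel_measurable lborel" using meas H_measurable by simp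
    show "(\<lambda>y. H y * primitive y (X n)) \<in> borel_measurable lborel" for n
      using transform_primitive_integrable[OF X[of n]] by auto
    show "AE y in lborel. (\<lambda>n. H y * primitive y (X n)) \<longlonglongrightarrow> H y * \<sigma> y"
      by (intro AE_I2 tendsto_mult tendsto_const lim)
    show "AE y in lborel. norm (H y * primitive y (X n)) \<le> C * (cmod (H y) * (1 + \<bar>y\<bar>) powr \<kappa>)" for n
    proof (rule AE_I2)
      fix y
      show "norm (H y * primitive y (X n)) \<le> C * (cmod (H y) * (1 + \<bar>y\<bar>) powr \<kappa>)"
        using mult_left_mono[OF C[OF X[of n], of y], of "cmod (H y)"] by (simp add: norm_mult mult_ac)
    qed
  qed (rule H_weight_integrable)
qed

lemma transform_primitive_tendsto_0: "(transform_primitive \<longlongrightarrow> 0) (at_right x)"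
proof -
  have lim: "((\<lambda>t. primitive y t) \<longlongrightarrow> 0) (at_right x)" for y
  proof -
    have "((\<lambda>t. 1 - x / t) \<longlongrightarrow> 1 - x / x) (at_right x)" using x by (intro tendsto_intros) auto
    then show ?thesis using primitive_tendsto[of 0 "at_right x" y] x by (simp add: eventually_at_right_less set_lebesgue_integral_def)
  qed
  show ?thesis unfolding tendsto_at_iff_sequentially
  proof (intro allI impI)
    fix X :: "nat \<Rightarrow> real" assume X: "\<forall>i. X i \<in> {x<..} - {x}" "X \<longlonglongrightarrow> x"
    then have "filterlim X (at_right x) sequentially" by (auto simp: filterlim_at intro: always_eventually)
    then have "(\<lambda>n. transform_primitive (X n)) \<longlonglongrightarrow> (LINT y|lborel. H y * 0)"
      using X(1) by (intro transform_primitive_tendsto_sequentially filterlim_compose[OF lim]) auto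
    then show "(transform_primitive \<circ> X) \<longlonglongrightarrow> 0" by (simp add: o_def)
  qed
qed

text \<open>
  The Saigo integral of \<open>(t\<^sup>-\<^sup>\<nu>)'\<close> over the whole half-line, by \<open>hyp_kernel_integral\<close>. The reciprocals are
  written with \<open>rGamma\<close>, so that poles give zeros.
\<close>
definition saigo_symbol :: "real \<Rightarrow> complex" where
  "saigo_symbol y = of_real x powr (- 1 - \<beta> - \<nu> y) * (- \<nu> y *
     (Gamma \<alpha> * Gamma (1 + \<beta> + \<nu> y) * Gamma (1 + \<gamma> + \<nu> y) * rGamma (1 + \<nu> y) * rGamma (1 + \<alpha> + \<beta> + \<gamma> + \<nu> y)))"

lemma transform_primitive_tendsto_at_top:
  "(transform_primitive \<longlongrightarrow> (LINT y|lborel. H y * saigo_symbol y)) at_top"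
proof -
  have lim: "((\<lambda>t. primitive y t) \<longlongrightarrow> saigo_symbol y) at_top" for y
  proof -
    have "((\<lambda>t. 1 - x / t) \<longlongrightarrow> 1) at_top" by real_asymp
    from primitive_tendsto[OF this eventually_gt_at_top, of y]
    show ?thesis unfolding hyp_kernel_integral[OF alpha beta excess Re_shifted_exponent]
      by (simp add: saigo_symbol_def algebra_simps)
  qed
  show ?thesis
  proof (rule tendsto_at_topI_sequentially)
    fix X :: "nat \<Rightarrow> real" assume X: "filterlim X at_top sequentially"
    obtain n0 where n0: "\<And>n. n \<ge> n0 \<Longrightarrow> X n > x"
      using X by (auto simp: filterlim_at_top_dense eventually_sequentially)
    have "filterlim (\<lambda>n. X (n + n0)) at_top sequentially"
      by (rule filterlim_compose[OF X filterlim_add_const_nat_at_top])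
    then have "(\<lambda>n. transform_primitive (X (n + n0))) \<longlonglongrightarrow> (LINT y|lborel. H y * saigo_symbol y)"
      using n0 by (intro transform_primitive_tendsto_sequentially filterlim_compose[OF lim]) auto
    then show "(\<lambda>n. transform_primitive (X n)) \<longlonglongrightarrow> (LINT y|lborel. H y * saigo_symbol y)"
      by (rule LIMSEQ_offset)
  qed
qed

text \<open>
  The fundamental theorem for the Henstock-Kurzweil integral asks only for a primitive that is
  differentiable in the interior and continuous at the endpoints, so \<open>g'\<close> may be any derivative.
\<close>
theorem saigo_integral_of_derivative:
  assumes g: "\<And>t. t > x \<Longrightarrow> (transform has_vector_derivative g' t) (at t)"
  shows "((\<lambda>t. K t * g' t) has_integral (LINT y|lborel. H y * saigo_symbol y)) {x<..}"
proof (rule has_integral_greaterThan[OF _ transform_primitive_tendsto_at_top])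
  fix T assume T: "T > x"
  \<comment> \<open>at \<open>x\<close> the primitive has to take its limit 0\<close>
  define P where "P = (\<lambda>t. if t \<le> x then 0 else transform_primitive t)"
  have derP: "(P has_vector_derivative K t * g' t) (at t)" if t: "t > x" for t
    by (rule has_vector_derivative_transform_within_open[OF transform_primitive_has_derivative[OF t g[OF t]], of "{x<..}"])
      (use t in \<open>auto simp: P_def\<close>)
  have "continuous_on {x..T} P" unfolding continuous_on_eq_continuous_within
  proof
    fix t assume t: "t \<in> {x..T}"
    show "continuous (at t within {x..T}) P"
    proof (cases "t = x")
      case True
      have "(P \<longlongrightarrow> 0) (at_right x)"
      proof (rule Lim_transform_eventually[OF transform_primitive_tendsto_0])
        show "\<forall>\<^sub>F t in at_right x. transform_primitive t = P t"
          using eventually_at_right_less[of x] by eventually_elim (simp add: P_def)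
      qed
      then show ?thesis using True T by (simp add: continuous_within P_def at_within_Icc_at_right)
    next
      case False
      then show ?thesis using t derP[of t] has_vector_derivative_continuous continuous_at_imp_continuous_within by fastforce
    qed
  qed
  then have "((\<lambda>t. K t * g' t) has_integral (P T - P x)) {x..T}"
    using T derP by (intro fundamental_theorem_of_calculus_interior) auto
  then show "((\<lambda>t. K t * g' t) has_integral transform_primitive T) {x..T}" using T by (simp add: P_def)
qed

end

section \<open>Decay of the integrand of the \<open>I\<close>-function\<close>

lemma integrable_one_plus_abs_powr:
  assumes p: "p < -1"
  shows "integrable lborel (\<lambda>y::real. (1 + \<bar>y\<bar>) powr p)"
proof -
  define f where "f = (\<lambda>x::real. indicator {1..} x * x powr p)"
  have f: "integrable lborel f"
  proof -
    have "((\<lambda>x. x powr p) has_integral - (1 powr (p + 1)) / (p + 1)) {1..}"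
      using p by (intro has_integral_powr_to_inf) auto
    then have "(\<lambda>x. x powr p) absolutely_integrable_on {1..}"
      by (intro nonnegative_absolutely_integrable_1) (auto simp: integrable_on_def)
    then have "integrable (completion lborel) f"
      unfolding set_integrable_def f_def by simp
    moreover have "f \<in> borel_measurable lborel" unfolding f_def by measurable
    ultimately show ?thesis by (simp add: integrable_completion)
  qed
  have "integrable lborel (\<lambda>y. f (1 + 1 * y) + f (1 + (-1) * y))"
    by (intro Bochner_Integration.integrable_add lborel_integrable_real_affine f) auto
  then show ?thesis
    by (rule Bochner_Integration.integrable_bound) (auto simp: f_def indicator_def intro!: AE_I2)
qed

text \<open>The exponential outweighs the factor \<open>(1 + |y|)\<^sup>p\<^sup>+\<^sup>2\<close>, which leaves the integrable \<open>(1 + |y|)\<^sup>-\<^sup>2\<close>.\<close>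
lemma integrable_one_plus_abs_powr_exp:
  assumes r: "r > 0"
  shows "integrable lborel (\<lambda>y::real. (1 + \<bar>y\<bar>) powr p * exp (- r * \<bar>y\<bar>))"
proof -
  have "((\<lambda>x. (1 + x) powr (p + 2) * exp (- r * x)) \<longlongrightarrow> 0) at_top" using r by real_asymp
  from tendstoD[OF this zero_less_one]
  have "\<forall>\<^sub>F x in at_top. norm ((1 + x) powr (p + 2) * exp (- r * x)) < 1"
    by (simp only: dist_norm diff_zero)
  then obtain R where R: "\<And>x. x \<ge> R \<Longrightarrow> norm ((1 + x) powr (p + 2) * exp (- r * x)) < 1"
    by (auto simp: eventually_at_top_linorder)
  have "\<exists>C. \<forall>y::real. (1 + \<bar>y\<bar>) powr (p + 2) * exp (- r * \<bar>y\<bar>) \<le> C"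
  proof (rule bounded_by_compact_and_tail[where R = R and C = 1])
    show "continuous_on UNIV (\<lambda>y::real. (1 + \<bar>y\<bar>) powr (p + 2) * exp (- r * \<bar>y\<bar>))"
      by (intro continuous_on_mult continuous_on_powr) (auto intro!: continuous_intros simp: add_nonneg_eq_0_iff)
    show "(1 + \<bar>y\<bar>) powr (p + 2) * exp (- r * \<bar>y\<bar>) \<le> 1" if "\<bar>y\<bar> \<ge> R" for y
      using R[OF that] by simp
  qed
  then obtain C where C: "\<And>y::real. (1 + \<bar>y\<bar>) powr (p + 2) * exp (- r * \<bar>y\<bar>) \<le> C" by blast
  have "integrable lborel (\<lambda>y::real. C * (1 + \<bar>y\<bar>) powr (-2))"
    by (intro integrable_mult_right integrable_one_plus_abs_powr) simp
  then show ?thesis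
  proof (rule Bochner_Integration.integrable_bound)
    have "(1 + \<bar>y\<bar>) powr p * exp (- r * \<bar>y\<bar>) \<le> C * (1 + \<bar>y\<bar>) powr (-2)" for y :: real
    proof -
      have "(1 + \<bar>y\<bar>) powr p = (1 + \<bar>y\<bar>) powr (p + 2) * (1 + \<bar>y\<bar>) powr (-2)"
        unfolding powr_add[symmetric] by simp
      then have "(1 + \<bar>y\<bar>) powr p * exp (- r * \<bar>y\<bar>) = ((1 + \<bar>y\<bar>) powr (p + 2) * exp (- r * \<bar>y\<bar>)) * (1 + \<bar>y\<bar>) powr (-2)"
        by (simp only: mult_ac)
      also have "\<dots> \<le> C * (1 + \<bar>y\<bar>) powr (-2)" by (intro mult_right_mono C) simp
      finally show ?thesis .
    qed
    then show "AE y in lborel. norm ((1 + \<bar>y\<bar>) powr p * exp (- r * \<bar>y\<bar>)) \<le> norm (C * (1 + \<bar>y\<bar>) powr (-2))"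
      by (intro AE_I2) (simp add: order_trans[OF _ abs_ge_self])
  qed measurable
qed

text \<open>
  Measurability is included, so that a single induction over the factors of \<open>\<chi>\<close> yields both.
\<close>
definition powr_exp_bounded :: "real \<Rightarrow> real \<Rightarrow> (real \<Rightarrow> complex) \<Rightarrow> bool" where
  "powr_exp_bounded p r g \<longleftrightarrow> g \<in> borel_measurable borel \<and>
     (\<exists>C\<ge>0. \<forall>y. cmod (g y) \<le> C * ((1 + \<bar>y\<bar>) powr p * exp (r * \<bar>y\<bar>)))"

lemma powr_exp_bounded_mult:
  assumes "powr_exp_bounded p r g" "powr_exp_bounded p' r' g'"
  shows "powr_exp_bounded (p + p') (r + r') (\<lambda>y. g y * g' y)"
proof -
  obtain C C' where C: "C \<ge> 0" "\<And>y. cmod (g y) \<le> C * ((1 + \<bar>y\<bar>) powr p * exp (r * \<bar>y\<bar>))"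
    and C': "C' \<ge> 0" "\<And>y. cmod (g' y) \<le> C' * ((1 + \<bar>y\<bar>) powr p' * exp (r' * \<bar>y\<bar>))"
    using assms unfolding powr_exp_bounded_def by blast
  have "cmod (g y * g' y) \<le> (C * C') * ((1 + \<bar>y\<bar>) powr (p + p') * exp ((r + r') * \<bar>y\<bar>))" for y
  proof -
    have "cmod (g y * g' y) \<le> (C * ((1 + \<bar>y\<bar>) powr p * exp (r * \<bar>y\<bar>))) * (C' * ((1 + \<bar>y\<bar>) powr p' * exp (r' * \<bar>y\<bar>)))"
      unfolding norm_mult using C C' by (intro mult_mono) auto
    also have "\<dots> = (C * C') * ((1 + \<bar>y\<bar>) powr (p + p') * exp ((r + r') * \<bar>y\<bar>))"
    proof -
      have e: "exp ((r + r') * \<bar>y\<bar>) = exp (r * \<bar>y\<bar>) * exp (r' * \<bar>y\<bar>)" by (simp only: distrib_right exp_add)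
      show ?thesis unfolding e powr_add by (simp only: mult_ac)
    qed
    finally show ?thesis .
  qed
  then show ?thesis using assms C(1) C'(1) unfolding powr_exp_bounded_def
    by (intro conjI borel_measurable_times exI[of _ "C * C'"]) auto
qed

lemma powr_exp_bounded_prod_list:
  assumes "\<And>t. t \<in> set ts \<Longrightarrow> powr_exp_bounded (P t) (R t) (G t)"
  shows "powr_exp_bounded (\<Sum>t\<leftarrow>ts. P t) (\<Sum>t\<leftarrow>ts. R t) (\<lambda>y. \<Prod>t\<leftarrow>ts. G t y)"
  using assms
proof (induction ts)
  case Nil
  show ?case by (auto simp: powr_exp_bounded_def add_nonneg_eq_0_iff intro!: exI[of _ 1])
next
  case (Cons t ts)
  then show ?case using powr_exp_bounded_mult[of "P t" "R t" "G t"] by simp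
qed

text \<open>
  The modulus does not depend on the branch. The formula also holds at a pole, where both sides are 0.
\<close>
lemma norm_Gamma_pow:
  assumes L: "Gamma_branch L" and s: "Re s = 0"
  shows "cmod (Gamma_pow L c d \<kappa> s) = cmod (Gamma (c + of_real d * s)) powr \<kappa>"
proof (cases "c + of_real d * s \<in> \<int>\<^sub>\<le>\<^sub>0")
  case True
  then show ?thesis by (simp add: Gamma_pow_def Gamma_eq_zero_iff)
next
  case False
  then have "exp (L c d \<kappa> s) = Gamma (c + of_real d * s)"
    using L s unfolding Gamma_branch_def Let_def by blast
  then have "cmod (Gamma (c + of_real d * s)) = exp (Re (L c d \<kappa> s))" by (metis norm_exp_eq_Re)
  then show ?thesis using False by (simp add: Gamma_pow_def powr_def)
qed

lemma norm_inverse_Gamma_pow: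
  assumes "Gamma_branch L" "Re s = 0"
  shows "cmod (inverse (Gamma_pow L c d \<kappa> s)) = cmod (rGamma (c + of_real d * s)) powr \<kappa>"
  unfolding norm_inverse norm_Gamma_pow[OF assms] rGamma_inverse_Gamma by (simp add: inverse_powr)

lemma Gamma_pow_1:
  assumes L: "Gamma_branch L" and s: "Re s = 0"
  shows "Gamma_pow L c d 1 s = Gamma (c + of_real d * s)"
proof (cases "c + of_real d * s \<in> \<int>\<^sub>\<le>\<^sub>0")
  case True
  then show ?thesis by (simp add: Gamma_pow_def Gamma_eq_zero_iff)
next
  case False
  then have "exp (L c d 1 s) = Gamma (c + of_real d * s)"
    using L s unfolding Gamma_branch_def Let_def by blast
  then show ?thesis using False by (simp add: Gamma_pow_def)
qed

text \<open>The contour meets at most one pole, and the branch is continuous away from it.\<close>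
lemma Gamma_pow_measurable:
  assumes L: "Gamma_branch L" and d: "d \<noteq> 0"
  shows "(\<lambda>y. Gamma_pow L c d \<kappa> (\<i> * of_real y)) \<in> borel_measurable borel"
proof -
  define T where "T = {y. c + of_real d * (\<i> * of_real y) \<notin> \<int>\<^sub>\<le>\<^sub>0}"
  define S where "S = {s. Re s = 0 \<and> c + of_real d * s \<notin> \<int>\<^sub>\<le>\<^sub>0}"
  have "- T \<subseteq> {- Im c / d}"
  proof
    fix y assume "y \<in> - T"
    then obtain k where "c + of_real d * (\<i> * of_real y) = of_int k" by (auto simp: T_def elim!: nonpos_Ints_cases)
    from arg_cong[OF this, of Im] have "Im c + d * y = 0" by simp
    then show "y \<in> {- Im c / d}" using d by (simp add: field_simps add_eq_0_iff)
  qed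
  then have "finite (- T)" by (rule finite_subset) simp
  then have "- (- T) \<in> sets borel" by (intro borel_closed[THEN borel_comp] finite_imp_closed)
  then have T: "T \<in> sets borel" by simp
  have "continuous_on S (L c d \<kappa>)" using L unfolding Gamma_branch_def Let_def S_def by blast
  then have "continuous_on T (\<lambda>y. L c d \<kappa> (\<i> * of_real y))"
    by (rule continuous_on_compose2) (auto simp: S_def T_def intro!: continuous_intros)
  then have "(\<lambda>y. indicator T y *\<^sub>R exp (of_real \<kappa> * L c d \<kappa> (\<i> * of_real y))) \<in> borel_measurable borel"
    by (intro borel_measurable_continuous_on_indicator T continuous_intros)
  also have "(\<lambda>y. indicator T y *\<^sub>R exp (of_real \<kappa> * L c d \<kappa> (\<i> * of_real y))) = (\<lambda>y. Gamma_pow L c d \<kappa> (\<i> * of_real y))"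
    by (auto simp: Gamma_pow_def T_def indicator_def)
  finally show ?thesis .
qed

lemma powr_exp_bounded_of_powr:
  assumes "g \<in> borel_measurable borel" "\<And>y. cmod (g y) = G y powr \<kappa>" "\<And>y. 0 \<le> G y"
    "\<And>y. G y \<le> C * ((1 + \<bar>y\<bar>) powr p * exp (r * \<bar>y\<bar>))" "\<kappa> > 0"
  shows "powr_exp_bounded (\<kappa> * p) (\<kappa> * r) g"
  unfolding powr_exp_bounded_def
proof (intro conjI exI[of _ "C powr \<kappa>"] allI assms(1))
  have "0 \<le> C * ((1 + \<bar>0\<bar>) powr p * exp (r * \<bar>0\<bar>))" using assms(3,4) order_trans by blast
  then have C: "C \<ge> 0" by simp
  fix y
  have "G y powr \<kappa> \<le> (C * ((1 + \<bar>y\<bar>) powr p * exp (r * \<bar>y\<bar>))) powr \<kappa>"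
    using assms by (intro powr_mono2) auto
  also have "\<dots> = C powr \<kappa> * (((1 + \<bar>y\<bar>) powr p) powr \<kappa> * (exp (r * \<bar>y\<bar>)) powr \<kappa>)"
    using C by (simp add: powr_mult)
  also have "((1 + \<bar>y\<bar>) powr p) powr \<kappa> = (1 + \<bar>y\<bar>) powr (\<kappa> * p)" by (simp add: powr_powr mult.commute)
  also have "(exp (r * \<bar>y\<bar>)) powr \<kappa> = exp (\<kappa> * r * \<bar>y\<bar>)" by (simp add: powr_def)
  finally show "cmod (g y) \<le> C powr \<kappa> * ((1 + \<bar>y\<bar>) powr (\<kappa> * p) * exp (\<kappa> * r * \<bar>y\<bar>))"
    unfolding assms(2) .
qed simp

lemma Gamma_pow_bounded:
  assumes L: "Gamma_branch L" and d: "d \<noteq> 0" and k: "\<kappa> > 0"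
    and np: "\<And>s. Re s = 0 \<Longrightarrow> c + of_real d * s \<notin> \<int>\<^sub>\<le>\<^sub>0"
  shows "powr_exp_bounded (\<kappa> * (Re c - 1/2)) (\<kappa> * (- (pi / 2 * \<bar>d\<bar>))) (\<lambda>y. Gamma_pow L c d \<kappa> (\<i> * of_real y))"
proof -
  obtain C where "\<And>y. cmod (Gamma (c + of_real d * (\<i> * of_real y))) \<le> C * ((1 + \<bar>y\<bar>) powr (Re c - 1/2) * exp (- (pi / 2 * \<bar>d\<bar>) * \<bar>y\<bar>))"
    using Gamma_line_bound[OF d np] by auto
  then show ?thesis
    by (intro powr_exp_bounded_of_powr[where G = "\<lambda>y. cmod (Gamma (c + of_real d * (\<i> * of_real y)))" and C = C]
        Gamma_pow_measurable norm_Gamma_pow L d k) auto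
qed

lemma inverse_Gamma_pow_bounded:
  assumes L: "Gamma_branch L" and d: "d \<noteq> 0" and k: "\<kappa> > 0"
  shows "powr_exp_bounded (\<kappa> * (1/2 - Re c)) (\<kappa> * (pi / 2 * \<bar>d\<bar>)) (\<lambda>y. inverse (Gamma_pow L c d \<kappa> (\<i> * of_real y)))"
proof -
  obtain C where "\<And>y. cmod (rGamma (c + of_real d * (\<i> * of_real y))) \<le> C * ((1 + \<bar>y\<bar>) powr (1/2 - Re c) * exp (pi / 2 * \<bar>d\<bar> * \<bar>y\<bar>))"
    using rGamma_line_bound[OF d] by blast
  then show ?thesis
    by (intro powr_exp_bounded_of_powr[where G = "\<lambda>y. cmod (rGamma (c + of_real d * (\<i> * of_real y)))" and C = C]
        borel_measurable_inverse Gamma_pow_measurable norm_inverse_Gamma_pow L d k) auto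
qed

lemma inverse_prod_list: "inverse (prod_list xs) = prod_list (map inverse xs)" for xs :: "complex list"
  by (induction xs) auto

text \<open>
  The exponents in the convergence conditions are exactly those of the Gamma estimates: \<open>\<Omega>\<close> collects
  the powers of \<open>|y|\<close> and \<open>\<Delta>\<close> the exponential rates. Separation keeps the poles of the numerator off the
  contour; in the denominator a pole is harmless, because only reciprocals enter.
\<close>
lemma I_chi_bounded:
  assumes L: "Gamma_branch L" and par: "I_params m n up lo" and sep: "I_separated m n up lo"
  shows "powr_exp_bounded (I_Omega up lo) (- (pi / 2 * I_Delta m n up lo)) (\<lambda>y. I_chi L m n up lo (\<i> * of_real y))"
proof -
  have up: "A > 0 \<and> \<alpha> > 0" if "(a, A, \<alpha>) \<in> set up" for a A \<alpha> using par that unfolding I_params_def by auto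
  have lo: "B > 0 \<and> \<beta> > 0" if "(b, B, \<beta>) \<in> set lo" for b B \<beta> using par that unfolding I_params_def by auto
  let ?G1 = "\<lambda>(b, B, \<beta>) y. Gamma_pow L b B \<beta> (\<i> * of_real y)"
  let ?G2 = "\<lambda>(a, A, \<alpha>) y. Gamma_pow L (1 - a) (- A) \<alpha> (\<i> * of_real y)"
  let ?G3 = "\<lambda>(b, B, \<beta>) y. inverse (Gamma_pow L (1 - b) (- B) \<beta> (\<i> * of_real y))"
  let ?G4 = "\<lambda>(a, A, \<alpha>) y. inverse (Gamma_pow L a A \<alpha> (\<i> * of_real y))"
  let ?O = "\<lambda>(a::complex, A::real, \<alpha>::real). (1/2 - Re a) * \<alpha>"
  let ?D = "\<lambda>(a::complex, A::real, \<alpha>::real). \<alpha> * A"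
  have b1: "powr_exp_bounded (\<Sum>t\<leftarrow>take m lo. (-1) * ?O t) (\<Sum>t\<leftarrow>take m lo. (- (pi / 2)) * ?D t) (\<lambda>y. \<Prod>t\<leftarrow>take m lo. ?G1 t y)"
  proof (rule powr_exp_bounded_prod_list)
    fix t assume t: "t \<in> set (take m lo)"
    obtain b B \<beta> where tt: "t = (b, B, \<beta>)" by (cases t)
    have np: "b + of_real B * s \<notin> \<int>\<^sub>\<le>\<^sub>0" if "Re s = 0" for s
      using sep t that unfolding I_separated_def tt by fastforce
    show "powr_exp_bounded ((-1) * ?O t) ((- (pi / 2)) * ?D t) (?G1 t)"
      using lo[of b B \<beta>] t in_set_takeD[OF t] Gamma_pow_bounded[OF L _ _ np, of \<beta>] by (simp add: tt algebra_simps)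
  qed
  have b2: "powr_exp_bounded (\<Sum>t\<leftarrow>take n up. 1 * ?O t) (\<Sum>t\<leftarrow>take n up. (- (pi / 2)) * ?D t) (\<lambda>y. \<Prod>t\<leftarrow>take n up. ?G2 t y)"
  proof (rule powr_exp_bounded_prod_list)
    fix t assume t: "t \<in> set (take n up)"
    obtain a A \<alpha> where tt: "t = (a, A, \<alpha>)" by (cases t)
    have np: "1 - a + of_real (- A) * s \<notin> \<int>\<^sub>\<le>\<^sub>0" if "Re s = 0" for s
      using sep t that unfolding I_separated_def tt by fastforce
    show "powr_exp_bounded (1 * ?O t) ((- (pi / 2)) * ?D t) (?G2 t)"
      using up[of a A \<alpha>] t in_set_takeD[OF t] Gamma_pow_bounded[OF L _ _ np, of \<alpha>] by (simp add: tt algebra_simps)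
  qed
  have b3: "powr_exp_bounded (\<Sum>t\<leftarrow>drop m lo. (-1) * ?O t) (\<Sum>t\<leftarrow>drop m lo. (pi / 2) * ?D t) (\<lambda>y. \<Prod>t\<leftarrow>drop m lo. ?G3 t y)"
  proof (rule powr_exp_bounded_prod_list)
    fix t assume t: "t \<in> set (drop m lo)"
    obtain b B \<beta> where tt: "t = (b, B, \<beta>)" by (cases t)
    show "powr_exp_bounded ((-1) * ?O t) ((pi / 2) * ?D t) (?G3 t)"
      using lo[of b B \<beta>] in_set_dropD[OF t] inverse_Gamma_pow_bounded[OF L, of "- B" \<beta> "1 - b"] by (simp add: tt algebra_simps)
  qed
  have b4: "powr_exp_bounded (\<Sum>t\<leftarrow>drop n up. 1 * ?O t) (\<Sum>t\<leftarrow>drop n up. (pi / 2) * ?D t) (\<lambda>y. \<Prod>t\<leftarrow>drop n up. ?G4 t y)"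
  proof (rule powr_exp_bounded_prod_list)
    fix t assume t: "t \<in> set (drop n up)"
    obtain a A \<alpha> where tt: "t = (a, A, \<alpha>)" by (cases t)
    show "powr_exp_bounded (1 * ?O t) ((pi / 2) * ?D t) (?G4 t)"
      using up[of a A \<alpha>] in_set_dropD[OF t] inverse_Gamma_pow_bounded[OF L, of A \<alpha> a] by (simp add: tt algebra_simps)
  qed
  have fun_eq: "I_chi L m n up lo (\<i> * of_real y) = ((\<Prod>t\<leftarrow>take m lo. ?G1 t y) * (\<Prod>t\<leftarrow>take n up. ?G2 t y)) * ((\<Prod>t\<leftarrow>drop m lo. ?G3 t y) * (\<Prod>t\<leftarrow>drop n up. ?G4 t y))" for y
    unfolding I_chi_def divide_inverse inverse_mult_distrib inverse_prod_list map_map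
    by (simp add: o_def case_prod_unfold)
  have split: "sum_list (map F xs) = sum_list (map F (take k xs)) + sum_list (map F (drop k xs))" for F :: "triple \<Rightarrow> real" and k xs
    by (metis append_take_drop_id map_append sum_list_append)
  have Om: "(-1) * (\<Sum>t\<leftarrow>take m lo. ?O t) + 1 * (\<Sum>t\<leftarrow>take n up. ?O t)
     + ((-1) * (\<Sum>t\<leftarrow>drop m lo. ?O t) + 1 * (\<Sum>t\<leftarrow>drop n up. ?O t)) = I_Omega up lo"
    unfolding I_Omega_def using split[of ?O lo m] split[of ?O up n] by linarith
  have De: "(- (pi / 2)) * (\<Sum>t\<leftarrow>take m lo. ?D t) + (- (pi / 2)) * (\<Sum>t\<leftarrow>take n up. ?D t)
     + ((pi / 2) * (\<Sum>t\<leftarrow>drop m lo. ?D t) + (pi / 2) * (\<Sum>t\<leftarrow>drop n up. ?D t)) = - (pi / 2 * I_Delta m n up lo)"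
    unfolding I_Delta_def by (simp add: algebra_simps)
  show ?thesis unfolding fun_eq Om[symmetric] De[symmetric]
    by (intro powr_exp_bounded_mult b1[unfolded sum_list_const_mult] b2[unfolded sum_list_const_mult]
        b3[unfolded sum_list_const_mult] b4[unfolded sum_list_const_mult])
qed

section \<open>The Caputo derivative of the \<open>I\<close>-function\<close>

text \<open>The density \<open>h\<close>: all factors of the integrand of the \<open>I\<close>-function except the power of the variable.\<close>
definition I_density ::
    "(complex \<Rightarrow> real \<Rightarrow> real \<Rightarrow> complex \<Rightarrow> complex) \<Rightarrow> nat \<Rightarrow> nat \<Rightarrow> triple list \<Rightarrow> triple list \<Rightarrow> real \<Rightarrow> complex \<Rightarrow> real \<Rightarrow> complex" where
  "I_density L m n up lo \<theta> a y =
     I_chi L m n up lo (\<i> * of_real y) * exp (of_real (\<theta> * y) - \<i> * of_real (y * ln (cmod a))) / (2 * of_real pi)"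

lemma powr_times_I_fun:
  assumes x: "x > 0" and a: "a \<noteq> 0"
  shows "of_real x powr e * I_fun L m n up lo \<theta> (a * of_real (x powr (- \<mu>))) =
     (LINT y|lborel. I_density L m n up lo \<theta> a y * of_real x powr (e + \<i> * of_real (\<mu> * y)))"
proof -
  have l: "ln (cmod (a * of_real (x powr (- \<mu>)))) = ln (cmod a) - \<mu> * ln x"
    using x a by (simp add: norm_mult ln_mult ln_powr)
  have e: "exp (- (\<i> * of_real y) * (of_real (ln (cmod a) - \<mu> * ln x) + \<i> * of_real \<theta>)) * of_real x powr e =
      exp (of_real (\<theta> * y) - \<i> * of_real (y * ln (cmod a))) * of_real x powr (e + \<i> * of_real (\<mu> * y))" for y
    unfolding powr_of_real_exp[OF x] exp_add[symmetric] by (rule arg_cong[where f = exp]) (simp add: algebra_simps)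
  have "of_real x powr e * I_fun L m n up lo \<theta> (a * of_real (x powr (- \<mu>))) =
     (LINT y|lborel. (of_real x powr e / (2 * of_real pi * \<i>)) * (I_chi L m n up lo (\<i> * of_real y) *
               exp (- (\<i> * of_real y) * (of_real (ln (cmod a) - \<mu> * ln x) + \<i> * of_real \<theta>)) * \<i>))"
    unfolding I_fun_def l by simp
  also have "\<dots> = (LINT y|lborel. I_density L m n up lo \<theta> a y * of_real x powr (e + \<i> * of_real (\<mu> * y)))"
  proof (rule Bochner_Integration.integral_cong[OF refl])
    fix y :: real
    define P where "P = exp (- (\<i> * of_real y) * (of_real (ln (cmod a) - \<mu> * ln x) + \<i> * of_real \<theta>))"
    have "(of_real x powr e / (2 * of_real pi * \<i>)) * (I_chi L m n up lo (\<i> * of_real y) * P * \<i>)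
       = I_chi L m n up lo (\<i> * of_real y) * (P * of_real x powr e) / (2 * of_real pi)" by simp
    then show "(of_real x powr e / (2 * of_real pi * \<i>)) * (I_chi L m n up lo (\<i> * of_real y) *
               exp (- (\<i> * of_real y) * (of_real (ln (cmod a) - \<mu> * ln x) + \<i> * of_real \<theta>)) * \<i>) =
        I_density L m n up lo \<theta> a y * of_real x powr (e + \<i> * of_real (\<mu> * y))"
      unfolding P_def e I_density_def by simp
  qed
  finally show ?thesis .
qed

text \<open>
  In the first case any weight is integrable by exponential decay; in the second case the exponentials
  cancel, and the power \<open>p + w\<close> decides.
\<close>
lemma I_density_weighted_integrable:
  assumes b: "powr_exp_bounded p (- r) (\<lambda>y. I_chi L m n up lo (\<i> * of_real y))"
    and r: "\<bar>\<theta>\<bar> < r \<or> \<bar>\<theta>\<bar> = r \<and> p + w < -1"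
  shows "integrable lborel (\<lambda>y. I_density L m n up lo \<theta> a y * of_real ((1 + \<bar>y\<bar>) powr w))"
proof -
  obtain C where C: "C \<ge> 0" "\<And>y. cmod (I_chi L m n up lo (\<i> * of_real y)) \<le> C * ((1 + \<bar>y\<bar>) powr p * exp (- r * \<bar>y\<bar>))"
    and meas: "(\<lambda>y. I_chi L m n up lo (\<i> * of_real y)) \<in> borel_measurable borel"
    using b unfolding powr_exp_bounded_def by blast
  define W where "W = (\<lambda>y::real. C * ((1 + \<bar>y\<bar>) powr (p + w) * exp (- (r - \<bar>\<theta>\<bar>) * \<bar>y\<bar>)))"
  have "integrable lborel (\<lambda>y::real. (1 + \<bar>y\<bar>) powr (p + w) * exp (- (r - \<bar>\<theta>\<bar>) * \<bar>y\<bar>))"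
  proof (cases "\<bar>\<theta>\<bar> < r")
    case True
    then show ?thesis by (intro integrable_one_plus_abs_powr_exp) simp
  next
    case False
    then have e: "\<bar>\<theta>\<bar> = r" "p + w < -1" using r by auto
    show ?thesis using integrable_one_plus_abs_powr[OF e(2)] unfolding e(1) by simp
  qed
  then have "integrable lborel W" unfolding W_def by (rule integrable_mult_right)
  then show ?thesis
  proof (rule Bochner_Integration.integrable_bound)
    show "(\<lambda>y. I_density L m n up lo \<theta> a y * of_real ((1 + \<bar>y\<bar>) powr w)) \<in> borel_measurable lborel"
      unfolding I_density_def using meas by measurable
    show "AE y in lborel. norm (I_density L m n up lo \<theta> a y * of_real ((1 + \<bar>y\<bar>) powr w)) \<le> norm (W y)"
    proof (rule AE_I2)
      fix y :: real
      have "cmod (exp (of_real (\<theta> * y) - \<i> * of_real (y * ln (cmod a)))) = exp (\<theta> * y)" by simp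
      then have "norm (I_density L m n up lo \<theta> a y * of_real ((1 + \<bar>y\<bar>) powr w)) =
          cmod (I_chi L m n up lo (\<i> * of_real y)) * exp (\<theta> * y) / (2 * pi) * (1 + \<bar>y\<bar>) powr w"
        unfolding I_density_def by (simp add: norm_mult norm_divide)
      also have "\<dots> \<le> cmod (I_chi L m n up lo (\<i> * of_real y)) * exp (\<bar>\<theta>\<bar> * \<bar>y\<bar>) / 1 * (1 + \<bar>y\<bar>) powr w"
      proof (intro mult_right_mono frac_le mult_left_mono)
        show "exp (\<theta> * y) \<le> exp (\<bar>\<theta>\<bar> * \<bar>y\<bar>)" by (simp add: abs_mult[symmetric])
        show "1 \<le> 2 * pi" using pi_gt3 by simp
      qed auto
      also have "\<dots> \<le> C * ((1 + \<bar>y\<bar>) powr p * exp (- r * \<bar>y\<bar>)) * exp (\<bar>\<theta>\<bar> * \<bar>y\<bar>) / 1 * (1 + \<bar>y\<bar>) powr w"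
        by (intro mult_right_mono divide_right_mono C) auto
      also have "\<dots> = C * (((1 + \<bar>y\<bar>) powr p * (1 + \<bar>y\<bar>) powr w) * (exp (- r * \<bar>y\<bar>) * exp (\<bar>\<theta>\<bar> * \<bar>y\<bar>)))"
        by simp
      also have "\<dots> = W y" unfolding W_def powr_add[symmetric] exp_add[symmetric] by (simp add: algebra_simps)
      also have "\<dots> \<le> norm (W y)" by simp
      finally show "norm (I_density L m n up lo \<theta> a y * of_real ((1 + \<bar>y\<bar>) powr w)) \<le> norm (W y)" .
    qed
  qed
qed

lemma norm_vertical_line_le:
  "cmod (\<rho> - \<i> * of_real (\<mu> * y)) \<le> (cmod \<rho> + \<bar>\<mu>\<bar>) * (1 + \<bar>y\<bar>)"
proof -
  have "cmod (\<rho> - \<i> * of_real (\<mu> * y)) \<le> cmod \<rho> + \<bar>\<mu>\<bar> * \<bar>y\<bar>"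
    using norm_triangle_ineq4[of \<rho> "\<i> * of_real (\<mu> * y)"] by (simp add: norm_mult abs_mult)
  also have "\<dots> \<le> (cmod \<rho> + \<bar>\<mu>\<bar>) * (1 + \<bar>y\<bar>)" by (simp add: distrib_left distrib_right)
  finally show ?thesis .
qed

lemma pochhammer_line_bound:
  fixes z :: "real \<Rightarrow> complex"
  assumes z: "\<And>y. cmod (z y) \<le> B * (1 + \<bar>y\<bar>)"
  shows "\<exists>C\<ge>0. \<forall>y. cmod (pochhammer (z y) k) \<le> C * (1 + \<bar>y\<bar>) ^ k"
proof (induction k)
  case 0
  show ?case by (intro exI[of _ 1]) auto
next
  case (Suc k)
  then obtain C where C: "C \<ge> 0" "\<And>y. cmod (pochhammer (z y) k) \<le> C * (1 + \<bar>y\<bar>) ^ k" by blast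
  have B: "B \<ge> 0" using order_trans[OF norm_ge_zero z[of 0]] by simp
  have "cmod (pochhammer (z y) (Suc k)) \<le> (C * (B + real k)) * (1 + \<bar>y\<bar>) ^ Suc k" for y
  proof -
    have "cmod (z y + of_nat k) \<le> B * (1 + \<bar>y\<bar>) + real k"
      using norm_triangle_ineq[of "z y" "of_nat k"] z[of y] by simp
    also have "\<dots> \<le> (B + real k) * (1 + \<bar>y\<bar>)" by (simp add: distrib_left distrib_right)
    finally have "cmod (pochhammer (z y) k) * cmod (z y + of_nat k) \<le> (C * (1 + \<bar>y\<bar>) ^ k) * ((B + real k) * (1 + \<bar>y\<bar>))"
      using C by (intro mult_mono) auto
    then show ?thesis by (simp add: pochhammer_Suc norm_mult mult_ac)
  qed
  moreover have "C * (B + real k) \<ge> 0" using C(1) B by simp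
  ultimately show ?case by blast
qed

text \<open>
  Each differentiation under the integral sign multiplies the integrand by another factor \<open>-(\<nu> + k)\<close> and
  thus uses up one power of the weight. On a compact neighbourhood of \<open>t\<close> the powers of the variable
  are bounded, uniformly in \<open>y\<close>.
\<close>
lemma nth_deriv_power_integral:
  fixes h :: "real \<Rightarrow> complex" and \<nu> :: "real \<Rightarrow> complex"
  assumes h: "integrable lborel (\<lambda>y. h y * of_real ((1 + \<bar>y\<bar>) powr real K))"
    and nu: "\<And>y. \<nu> y = \<rho> - \<i> * of_real (\<mu> * y)"
    and f: "\<And>t. t > 0 \<Longrightarrow> f t = (LINT y|lborel. h y * of_real t powr (- \<nu> y))"
  shows "k \<le> K \<Longrightarrow> t > 0 \<Longrightarrow>
      nth_deriv k f t = (LINT y|lborel. h y * ((-1) ^ k * pochhammer (\<nu> y) k * of_real t powr (- \<nu> y - of_nat k)))"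
    and "times_differentiable K f"
proof -
  define P where "P = (\<lambda>k y. (-1) ^ k * pochhammer (\<nu> y) k)"
  define F where "F = (\<lambda>k t y. h y * (P k y * of_real t powr (- \<nu> y - of_nat k)))"
  have num: "\<nu> \<in> borel_measurable borel"
  proof -
    have "\<nu> = (\<lambda>y. \<rho> - \<i> * of_real (\<mu> * y))" by (rule ext) (rule nu)
    then show ?thesis by simp
  qed
  have Pm: "P k \<in> borel_measurable borel" for k
    unfolding P_def pochhammer_prod using num by measurable
  have gm: "(\<lambda>y. P k y * of_real t powr (- \<nu> y - of_nat k)) \<in> borel_measurable borel" if "t > 0" for k t
  proof -
    have "(\<lambda>y. P k y * exp ((- \<nu> y - of_nat k) * of_real (ln t))) \<in> borel_measurable borel" using Pm num by measurable
    then show ?thesis using that by (simp add: powr_of_real_exp)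
  qed
  have "cmod (\<nu> y) \<le> (cmod \<rho> + \<bar>\<mu>\<bar>) * (1 + \<bar>y\<bar>)" for y
    unfolding nu by (rule norm_vertical_line_le)
  from pochhammer_line_bound[OF this]
  have Pb: "\<exists>C\<ge>0. \<forall>y. cmod (P k y) \<le> C * (1 + \<bar>y\<bar>) powr real k" for k
    by (simp add: P_def norm_mult norm_power powr_realpow add_pos_nonneg)
  have gb: "cmod (P k y * of_real t powr (- \<nu> y - of_nat k)) \<le> (C * t powr (- Re \<rho> - real k)) * (1 + \<bar>y\<bar>) powr real K"
    if k: "k \<le> K" and t: "t > 0" and C: "C \<ge> 0" "\<And>y. cmod (P k y) \<le> C * (1 + \<bar>y\<bar>) powr real k" for C k t y
  proof -
    have "(1 + \<bar>y\<bar>) powr real k \<le> (1 + \<bar>y\<bar>) powr real K" using k by (intro powr_mono) auto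
    then have "C * (1 + \<bar>y\<bar>) powr real k \<le> C * (1 + \<bar>y\<bar>) powr real K" using C(1) by (rule mult_left_mono)
    then have "cmod (P k y) \<le> C * (1 + \<bar>y\<bar>) powr real K" using C(2)[of y] by linarith
    then have "cmod (P k y) * t powr (- Re \<rho> - real k) \<le> C * (1 + \<bar>y\<bar>) powr real K * t powr (- Re \<rho> - real k)"
      by (rule mult_right_mono) simp
    moreover have "cmod (of_real t powr (- \<nu> y - of_nat k)) = t powr (- Re \<rho> - real k)"
      using t by (simp add: norm_of_real_powr nu)
    ultimately show ?thesis by (simp add: norm_mult mult_ac)
  qed
  have Fint: "integrable lborel (F k t)" if "k \<le> K" "t > 0" for k t
  proof -
    obtain C where C: "C \<ge> 0" "\<And>y. cmod (P k y) \<le> C * (1 + \<bar>y\<bar>) powr real k" using Pb by blast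
    show ?thesis unfolding F_def
      by (rule weighted_density_times_integrable[OF h gm[OF that(2)] gb[OF that C]])
  qed
  have Fder: "((\<lambda>t. F k t y) has_vector_derivative F (Suc k) t y) (at t)" if t: "t > 0" for k t y
  proof -
    have "((\<lambda>t. F k t y) has_vector_derivative h y * (P k y * ((- \<nu> y - of_nat k) * of_real t powr (- \<nu> y - of_nat k - 1)))) (at t)"
      unfolding F_def by (intro has_vector_derivative_mult_right powr_has_vector_derivative t)
    moreover have "- \<nu> y - of_nat k - 1 = - \<nu> y - of_nat (Suc k)" by simp
    moreover have "P (Suc k) y = P k y * (- \<nu> y - of_nat k)" by (simp add: P_def pochhammer_Suc algebra_simps)
    ultimately show ?thesis by (simp add: F_def mult.assoc)
  qed
  have main: "((\<lambda>t. LINT y|lborel. F k t y) has_vector_derivative (LINT y|lborel. F (Suc k) t y)) (at t)"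
    if k: "k < K" and t: "t > 0" for k t
  proof -
    obtain C where C: "C \<ge> 0" "\<And>y. cmod (P (Suc k) y) \<le> C * (1 + \<bar>y\<bar>) powr real (Suc k)" using Pb by blast
    have cont: "continuous_on {t/2..2*t} (\<lambda>s. s powr (- Re \<rho> - real (Suc k)))"
      using t by (intro continuous_intros) auto
    obtain s0 where s0: "\<forall>s\<in>{t/2..2*t}. s powr (- Re \<rho> - real (Suc k)) \<le> s0 powr (- Re \<rho> - real (Suc k))"
      using continuous_attains_sup[OF _ _ cont] t by fastforce
    define M where "M = s0 powr (- Re \<rho> - real (Suc k))"
    have bd: "cmod (F (Suc k) s y) \<le> (C * M) * norm (h y * of_real ((1 + \<bar>y\<bar>) powr real K))" if s: "s \<in> {t/2<..<2*t}" for s y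
    proof -
      have s': "s > 0" using s t by auto
      have "cmod (P (Suc k) y * of_real s powr (- \<nu> y - of_nat (Suc k))) \<le> (C * s powr (- Re \<rho> - real (Suc k))) * (1 + \<bar>y\<bar>) powr real K"
        by (rule gb[OF _ s' C]) (use k in simp)
      also have "\<dots> \<le> (C * M) * (1 + \<bar>y\<bar>) powr real K"
        using s0 s C(1) unfolding M_def by (intro mult_right_mono mult_left_mono) auto
      finally have "cmod (h y) * cmod (P (Suc k) y * of_real s powr (- \<nu> y - of_nat (Suc k))) \<le> cmod (h y) * ((C * M) * (1 + \<bar>y\<bar>) powr real K)"
        by (rule mult_left_mono) simp
      then show ?thesis unfolding F_def norm_mult[of "h y"] by (simp add: mult_ac)
    qed
    show ?thesis
      by (rule has_vector_derivative_lebesgue_integral[OF _ _ Fint Fder bd, of "{t/2<..<2*t}"])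
        (use t k integrable_norm[OF h] in \<open>auto intro!: integrable_mult_right simp del: norm_mult\<close>)
  qed
  have deriv: "\<forall>t>0. nth_deriv k f t = (LINT y|lborel. F k t y)" if "k \<le> K" for k
    using that
  proof (induction k)
    case 0
    show ?case using f by (simp add: nth_deriv_def F_def P_def)
  next
    case (Suc k)
    show ?case
    proof (intro allI impI)
      fix t :: real assume t: "t > 0"
      have "(nth_deriv k f has_vector_derivative (LINT y|lborel. F (Suc k) t y)) (at t)"
        by (rule has_vector_derivative_transform_within_open[OF main[of k t], of "{0<..}"])
          (use Suc t in auto)
      then show "nth_deriv (Suc k) f t = (LINT y|lborel. F (Suc k) t y)"
        unfolding nth_deriv_def by (simp add: vector_derivative_at)
    qed
  qed
  show "nth_deriv k f t = (LINT y|lborel. h y * ((-1) ^ k * pochhammer (\<nu> y) k * of_real t powr (- \<nu> y - of_nat k)))"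
    if "k \<le> K" "t > 0" for k t
    using deriv[OF that(1)] that(2) by (simp add: F_def P_def)
  show "times_differentiable K f"
    unfolding times_differentiable_def
  proof (intro allI impI)
    fix k t assume k: "k < K" and t: "(0::real) < t"
    have "(nth_deriv k f has_vector_derivative (LINT y|lborel. F (Suc k) t y)) (at t)"
      by (rule has_vector_derivative_transform_within_open[OF main[OF k t], of "{0<..}"])
        (use deriv[of k] k t in auto)
    then show "nth_deriv k f differentiable at t"
      by (auto simp: has_vector_derivative_def differentiable_def)
  qed
qed

lemma I_chi_extend:
  assumes L: "Gamma_branch L" and s: "Re s = 0" and m: "m \<le> length lo"
  shows "I_chi L m (n + 2) ((a1, M, 1) # (a2, M, 1) # up) (lo @ [(b1, M, 1), (b2, M, 1)]) s =
     I_chi L m n up lo s * (Gamma (1 - a1 - of_real M * s) * Gamma (1 - a2 - of_real M * s) *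
       rGamma (1 - b1 - of_real M * s) * rGamma (1 - b2 - of_real M * s))"
  using m unfolding I_chi_def rGamma_inverse_Gamma
  by (simp add: Gamma_pow_1[OF L s] divide_inverse mult_ac)

lemma hyp2F1_eq_hyp_series: "hyp2F1 a b c z = hyp_series a b c z"
  unfolding hyp2F1_def hyp_series_def hyp_coeff_def ..

lemma pochhammer_times_rGamma: "pochhammer z n * rGamma (z + of_nat n) = rGamma (z :: complex)"
  using pochhammer_rGamma[of z n] by simp

lemma I_Delta_extend:
  assumes "m \<le> length lo"
  shows "I_Delta m (n + 2) ((a1, M, 1) # (a2, M, 1) # up) (lo @ [(b1, M, 1), (b2, M, 1)]) = I_Delta m n up lo"
  using assms unfolding I_Delta_def by simp

text \<open>
  The new parameters shift \<open>\<Omega>\<close> but leave \<open>\<Delta>\<close> unchanged. So the case distinction in the convergence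
  condition falls out the same way for both \<open>I\<close>-functions.
\<close>
lemma I_Omega_extend:
  "I_Omega ((a1, M, 1) # (a2, M, 1) # up) (lo @ [(b1, M, 1), (b2, M, 1)]) = I_Omega up lo + Re (b1 + b2 - a1 - a2)"
  unfolding I_Omega_def by simp

lemma saigo_integrand_eq_kernel:
  "saigo_integrand \<alpha> \<beta> \<gamma> g x t = saigo_kernel \<alpha> \<beta> \<gamma> (of_real x) (of_real t) * g t"
  by (simp add: saigo_integrand_def saigo_kernel_def hyp2F1_eq_hyp_series)

text \<open>
  The operator is applied with \<open>\<alpha>' = N - \<alpha>\<close>, \<open>\<beta>' = -\<beta> - N\<close>, \<open>\<gamma>' = \<alpha> + \<gamma>\<close> to the derivative of
  \<open>f\<^sup>(\<^sup>N\<^sup>-\<^sup>1\<^sup>)\<close>, a superposition of powers with exponents \<open>\<nu> + N - 1\<close>.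
\<close>
theorem corollary5p3:
  fixes \<alpha> \<beta> \<gamma> \<rho> a :: complex
    and \<mu> \<theta> x :: real
    and N m n :: nat
    and up lo up' lo' :: "triple list"
    and L :: "complex \<Rightarrow> real \<Rightarrow> real \<Rightarrow> complex \<Rightarrow> complex"
    and f :: "real \<Rightarrow> complex"
  assumes alpha: "Re \<alpha> > 0"
    and a_nz: "a \<noteq> 0"
    and arg_a: "a = of_real (cmod a) * cis \<theta>"
    and N_eq: "N = nat \<lfloor>Re \<alpha>\<rfloor> + 1"
    and mu: "\<mu> > 0"
    and rho: "Re \<rho> + real N > max (Re \<beta> + real N) (Re (- \<alpha> - \<gamma>))"
    and branch: "Gamma_branch L"
    and params: "I_params m n up lo"
    and sep: "I_separated m n up lo"
    and up'_eq: "up' = (1 + \<beta> - \<rho>, \<mu>, 1) # (1 - \<alpha> - \<gamma> - \<rho> - of_nat N, \<mu>, 1) # up"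
    and lo'_eq: "lo' = lo @ [(1 - \<rho>, \<mu>, 1), (1 + \<beta> - \<gamma> - \<rho> - of_nat N, \<mu>, 1)]"
    and conv: "I_convergence 0 m n up lo \<theta>"
    and conv': "I_convergence 0 m (n + 2) up' lo' \<theta>"
    and f_eq: "f = (\<lambda>t. of_real t powr (- \<rho>) * I_fun L m n up lo \<theta> (a * of_real (t powr (- \<mu>))))"
    and domain: "\<bar>\<theta>\<bar> = pi / 2 * I_Delta m n up lo \<Longrightarrow> times_differentiable N f"
    and x: "x > 0"
  shows "caputo_right_exists \<alpha> \<beta> \<gamma> f x \<and>
    caputo_right \<alpha> \<beta> \<gamma> f x =
      of_real x powr (\<beta> - \<rho>) * I_fun L m (n + 2) up' lo' \<theta> (a * of_real (x powr (- \<mu>)))"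
proof -
  define \<alpha>' \<beta>' \<gamma>' where "\<alpha>' = - \<alpha> + of_nat N" and "\<beta>' = - \<beta> - of_nat N" and "\<gamma>' = \<alpha> + \<gamma>"
  define \<nu> where "\<nu> = (\<lambda>y. \<rho> - \<i> * of_real (\<mu> * y))"
  define h where "h = I_density L m n up lo \<theta> a"
  define K where "K = N - 1"
  have NK: "N = Suc K" by (simp add: K_def N_eq)
  have m: "m \<le> length lo" using params by (simp add: I_params_def)
  have N: "Re \<alpha> < real N" "real K \<le> Re \<alpha>"
    using alpha unfolding NK[symmetric] K_def N_eq by (auto simp: of_nat_nat) linarith+
  have f: "f t = (LINT y|lborel. h y * of_real t powr (- \<nu> y))" if "t > 0" for t
    unfolding f_eq h_def \<nu>_def powr_times_I_fun[OF that a_nz] by simp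
  have bounded: "powr_exp_bounded (I_Omega up lo) (- (pi / 2 * I_Delta m n up lo)) (\<lambda>y. I_chi L m n up lo (\<i> * of_real y))"
    by (rule I_chi_bounded[OF branch params sep])
  have Delta': "I_Delta m (n + 2) up' lo' = I_Delta m n up lo"
    unfolding up'_eq lo'_eq by (rule I_Delta_extend[OF m])
  have Omega': "I_Omega up' lo' = I_Omega up lo + Re \<alpha>"
    unfolding up'_eq lo'_eq I_Omega_extend by simp
  obtain \<kappa> where kappa: "0 \<le> \<kappa>" "\<kappa> \<le> 1" "Re \<alpha>' + \<kappa> > 1"
    and hint: "integrable lborel (\<lambda>y. h y * of_real ((1 + \<bar>y\<bar>) powr (real K + \<kappa>)))"
    and diff: "times_differentiable N f"
  proof (cases "\<bar>\<theta>\<bar> < pi / 2 * I_Delta m n up lo")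
    case True
    have int: "integrable lborel (\<lambda>y. h y * of_real ((1 + \<bar>y\<bar>) powr w))" for w
      unfolding h_def by (rule I_density_weighted_integrable[OF bounded]) (use True in simp)
    \<comment> \<open>exponential decay: differentiation of any order is possible, and \<open>\<kappa> = 1\<close> will do\<close>
    show ?thesis
    proof (rule that[of 1])
      show "times_differentiable N f"
        by (rule nth_deriv_power_integral(2)[OF int _ f]) (auto simp: \<nu>_def)
    qed (use N int in \<open>auto simp: \<alpha>'_def\<close>)
  next
    case False
    then have eq: "\<bar>\<theta>\<bar> = pi / 2 * I_Delta m n up lo" using conv unfolding I_convergence_def by auto
    then have Om: "I_Omega up lo + Re \<alpha> < -1"
      using conv' unfolding I_convergence_def Delta' Omega' by auto
    \<comment> \<open>half of the slack in \<open>\<Omega> + Re \<alpha> < -1\<close>, cut off so that \<open>\<kappa> = 1 - (N - Re \<alpha>) + e\<close> stays at most 1\<close>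
    define e where "e = min (real N - Re \<alpha>) ((- 1 - I_Omega up lo - Re \<alpha>) / 2)"
    have e: "e > 0" "e \<le> real N - Re \<alpha>" "e < - 1 - I_Omega up lo - Re \<alpha>" using N Om by (auto simp: e_def min_def)
    show ?thesis
    proof (rule that[of "1 - (real N - Re \<alpha>) + e"])
      show "integrable lborel (\<lambda>y. h y * of_real ((1 + \<bar>y\<bar>) powr (real K + (1 - (real N - Re \<alpha>) + e))))"
        unfolding h_def by (rule I_density_weighted_integrable[OF bounded]) (use eq e NK in simp)
    qed (use N e NK domain[OF eq] in \<open>auto simp: \<alpha>'_def\<close>)
  qed
  have hK: "integrable lborel (\<lambda>y. h y * of_real ((1 + \<bar>y\<bar>) powr real K))"
  proof (rule weighted_density_times_integrable[OF hint])
    show "cmod (of_real ((1 + \<bar>y\<bar>) powr real K)) \<le> 1 * (1 + \<bar>y\<bar>) powr (real K + \<kappa>)" for y :: real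
      using kappa by (simp add: powr_mono)
  qed measurable
  have derivK: "nth_deriv K f t = (LINT y|lborel. h y * ((-1) ^ K * pochhammer (\<nu> y) K * of_real t powr (- \<nu> y - of_nat K)))"
    if "t > 0" for t
    by (rule nth_deriv_power_integral(1)[OF hK _ f order_refl that]) (auto simp: \<nu>_def)
  define H where "H = (\<lambda>y. h y * ((-1) ^ K * pochhammer (\<nu> y) K))"
  have num: "\<nu> \<in> borel_measurable borel" unfolding \<nu>_def by measurable
  have Hint: "integrable lborel (\<lambda>y. H y * of_real ((1 + \<bar>y\<bar>) powr \<kappa>))"
  proof -
    have "cmod (\<nu> y) \<le> (cmod \<rho> + \<bar>\<mu>\<bar>) * (1 + \<bar>y\<bar>)" for y
      unfolding \<nu>_def by (rule norm_vertical_line_le)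
    then obtain C where C: "C \<ge> 0" "\<And>y. cmod (pochhammer (\<nu> y) K) \<le> C * (1 + \<bar>y\<bar>) ^ K"
      using pochhammer_line_bound by blast
    have "integrable lborel (\<lambda>y. h y * ((-1) ^ K * pochhammer (\<nu> y) K * of_real ((1 + \<bar>y\<bar>) powr \<kappa>)))"
    proof (rule weighted_density_times_integrable[OF hint])
      show "(\<lambda>y. (-1) ^ K * pochhammer (\<nu> y) K * of_real ((1 + \<bar>y\<bar>) powr \<kappa>)) \<in> borel_measurable borel"
        unfolding pochhammer_prod using num by measurable
      fix y :: real
      have "cmod (pochhammer (\<nu> y) K) * (1 + \<bar>y\<bar>) powr \<kappa> \<le> C * (1 + \<bar>y\<bar>) ^ K * (1 + \<bar>y\<bar>) powr \<kappa>"
        using C(2)[of y] by (intro mult_right_mono) auto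
      also have "(1 + \<bar>y\<bar>) ^ K = (1 + \<bar>y\<bar>) powr real K" by (simp add: powr_realpow add_pos_nonneg)
      finally show "cmod ((-1) ^ K * pochhammer (\<nu> y) K * of_real ((1 + \<bar>y\<bar>) powr \<kappa>)) \<le> C * (1 + \<bar>y\<bar>) powr (real K + \<kappa>)"
        by (simp add: norm_mult norm_power powr_add mult_ac)
    qed
    then show ?thesis by (simp add: H_def mult.assoc)
  qed
  have rho': "Re \<rho> > Re \<beta>" "Re \<rho> + real N + Re \<alpha> + Re \<gamma> > 0" using rho by auto
  \<comment> \<open>the exponents are shifted by \<open>K = N - 1\<close>, since the powers come from the \<open>K\<close>-th derivative\<close>
  interpret mellin_density \<alpha>' \<beta>' \<gamma>' "\<rho> + of_nat K" \<mu> \<kappa> x H "\<lambda>y. \<nu> y + of_nat K"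
  proof
    show "Re \<alpha>' > 0" using N by (simp add: \<alpha>'_def)
    show "Re (1 + \<beta>' + (\<rho> + of_nat K)) > 0" using rho' NK by (simp add: \<beta>'_def)
    show "Re (1 + \<gamma>' + (\<rho> + of_nat K)) > 0" using rho' NK by (simp add: \<gamma>'_def)
    show "\<nu> y + of_nat K = \<rho> + of_nat K - \<i> * of_real (\<mu> * y)" for y by (simp add: \<nu>_def)
  qed (use x kappa Hint in auto)
  have tr: "transform t = nth_deriv K f t" if "t > 0" for t
    unfolding transform_def derivK[OF that] by (simp add: H_def mult.assoc)
  have der: "(transform has_vector_derivative nth_deriv N f t) (at t)" if t: "t > x" for t
  proof -
    have "nth_deriv K f differentiable at t" using diff t x unfolding times_differentiable_def NK by auto
    then have "(nth_deriv K f has_vector_derivative nth_deriv N f t) (at t)"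
      unfolding vector_derivative_works by (simp add: NK nth_deriv_def)
    then show ?thesis
      by (rule has_vector_derivative_transform_within_open[where S = "{0<..}"]) (use t x tr in auto)
  qed
  have int: "(saigo_integrand \<alpha>' \<beta>' \<gamma>' (nth_deriv N f) x has_integral (LINT y|lborel. H y * saigo_symbol y)) {x<..}"
    unfolding saigo_integrand_eq_kernel[abs_def] by (rule saigo_integral_of_derivative[OF der])
  have ord: "caputo_order \<alpha> = N" by (simp add: caputo_order_def N_eq)
  have ex: "caputo_right_exists \<alpha> \<beta> \<gamma> f x"
    using diff int unfolding caputo_right_exists_def ord Let_def \<alpha>'_def \<beta>'_def \<gamma>'_def by (auto simp: integrable_on_def)
  have "caputo_right \<alpha> \<beta> \<gamma> f x = (-1) ^ N * (1 / Gamma \<alpha>' * (LINT y|lborel. H y * saigo_symbol y))"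
    using integral_unique[OF int] unfolding caputo_right_def ord Let_def saigo_right_def \<alpha>'_def \<beta>'_def \<gamma>'_def by simp
  also have "\<dots> = (LINT y|lborel. (-1) ^ N / Gamma \<alpha>' * (H y * saigo_symbol y))" by simp
  also have "\<dots> = (LINT y|lborel. I_density L m (n + 2) up' lo' \<theta> a y * of_real x powr (\<beta> - \<rho> + \<i> * of_real (\<mu> * y)))"
  proof (rule Bochner_Integration.integral_cong[OF refl])
    fix y :: real
    define w where "w = \<nu> y"
    have chi: "I_chi L m (n + 2) up' lo' (\<i> * of_real y) = I_chi L m n up lo (\<i> * of_real y) *
       (Gamma (w - \<beta>) * Gamma (w + \<alpha> + \<gamma> + of_nat N) * rGamma w * rGamma (w - \<beta> + \<gamma> + of_nat N))"
      unfolding up'_eq lo'_eq by (subst I_chi_extend[OF branch _ m]) (simp_all add: w_def \<nu>_def algebra_simps)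
    have dens: "I_density L m (n + 2) up' lo' \<theta> a y = h y *
       (Gamma (w - \<beta>) * Gamma (w + \<alpha> + \<gamma> + of_nat N) * rGamma w * rGamma (w - \<beta> + \<gamma> + of_nat N))"
      unfolding I_density_def h_def chi by simp
    have G: "Gamma \<alpha>' \<noteq> 0" using Re_pos_not_nonpos_Int[of \<alpha>'] N by (simp add: Gamma_eq_zero_iff \<alpha>'_def)
    define v where "v = w + of_nat K"
    have e: "1 + \<beta>' + v = w - \<beta>" "1 + \<gamma>' + v = w + \<alpha> + \<gamma> + of_nat N"
      "1 + v = w + of_nat N" "1 + \<alpha>' + \<beta>' + \<gamma>' + v = w - \<beta> + \<gamma> + of_nat N"
      "- 1 - \<beta>' - v = \<beta> - \<rho> + \<i> * of_real (\<mu> * y)"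
      by (simp_all add: \<alpha>'_def \<beta>'_def \<gamma>'_def NK w_def v_def \<nu>_def)
    have "H y = h y * ((-1) ^ K * pochhammer w K)" by (simp add: H_def w_def)
    moreover have "saigo_symbol y = of_real x powr (\<beta> - \<rho> + \<i> * of_real (\<mu> * y)) * (- v *
        (Gamma \<alpha>' * Gamma (w - \<beta>) * Gamma (w + \<alpha> + \<gamma> + of_nat N) * rGamma (w + of_nat N) * rGamma (w - \<beta> + \<gamma> + of_nat N)))"
      unfolding saigo_symbol_def w_def[symmetric] v_def[symmetric] e ..
    ultimately have "(-1) ^ N / Gamma \<alpha>' * (H y * saigo_symbol y) =
       ((-1) ^ N * (-1) ^ K * (-1)) * h y * (pochhammer w K * v * rGamma (w + of_nat N)) *
       (Gamma (w - \<beta>) * Gamma (w + \<alpha> + \<gamma> + of_nat N) * rGamma (w - \<beta> + \<gamma> + of_nat N)) * of_real x powr (\<beta> - \<rho> + \<i> * of_real (\<mu> * y))"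
      using G by (simp add: mult_ac)
    also have "(-1) ^ N * (-1) ^ K * (-1) = (1::complex)" by (simp add: NK flip: power_add mult_2)
    also have "pochhammer w K * v * rGamma (w + of_nat N) = rGamma w"
      using pochhammer_times_rGamma[of w N] by (simp add: NK v_def pochhammer_Suc)
    finally show "(-1) ^ N / Gamma \<alpha>' * (H y * saigo_symbol y) =
       I_density L m (n + 2) up' lo' \<theta> a y * of_real x powr (\<beta> - \<rho> + \<i> * of_real (\<mu> * y))"
      unfolding dens by (simp add: mult_ac)
  qed
  also have "\<dots> = of_real x powr (\<beta> - \<rho>) * I_fun L m (n + 2) up' lo' \<theta> (a * of_real (x powr (- \<mu>)))"
    by (rule powr_times_I_fun[OF x a_nz, symmetric])
  finally show ?thesis using ex by blast
qed

end
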